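(* Let $n\to\infty$, let $e_1,\dots,e_N$ with $N=n(n-1)$ be a uniformly random permutation of the edges of the complete digraph on vertex set $[n]$, and let each edge independently be assigned a colour uniformly at random from a set $W$ of $(1+50\varepsilon)n$ colours, where $\varepsilon=\varepsilon(n)=\frac{\log\log n}{\log n}$. For $0\le m\le N$ let $\mathcal{D}(n,m)$ be the edge-coloured digraph on $[n]$ with edge set $\{e_1,\dots,e_m\}$. Let - $m_{\mathcal{Z}}$ be the least $m$ such that at most one vertex of $\mathcal{D}(n,m)$ has in-degree zero, - $m_{\mathcal{A}}$ be the least $m$ such that $\mathcal{D}(n,m)$ has an arborescence, - $m_{\mathcal{R}}$ be the least $m$ such that $\mathcal{D}(n,m)$ has a rainbow arborescence (if such an $m$ exists). Then, asymptotically almost surely, $m_{\mathcal{R}}$ is defined and $$m_{\mathcal{R}} = m_{\mathcal{A}} = m_{\mathcal{Z}}.$$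
   Context: The complete digraph on $[n]=\{1,\dots,n\}$ has as edges all ordered pairs $(u,v)$ with $u\neq v$; the edge $(u,v)$ is directed from its tail $u$ to its head $v$. The colours of the edges are mutually independent, and independent of the permutation. A digraph on $[n]$ "has an arborescence" if it contains a spanning arborescence as a subgraph, i.e. a directed rooted tree on all $n$ vertices in which all edges point away from the root (equivalently, there is a root $u$ such that for every other vertex $v$ the tree contains exactly one directed path from $u$ to $v$). An arborescence is rainbow if all its edges have pairwise different colours. An event holds asymptotically almost surely if its probability tends to $1$ as $n\to\infty$. $\log$ is the natural logarithm. Quantities such as $(1+50\varepsilon)n$ that must be integers are rounded up or down (either choice). *)

theory Defs
  imports
    "HOL-Probability.Probability"
    "HOL-Combinatorics.Multiset_Permutations"
    "Graph_Theory.Graph_Theory"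
begin

definition complete_arcs :: "nat \<Rightarrow> (nat \<times> nat) set" where
  "complete_arcs n = {(u, v). u \<in> {1..n} \<and> v \<in> {1..n} \<and> u \<noteq> v}"

definition digraph_at :: "nat \<Rightarrow> (nat \<times> nat) list \<Rightarrow> nat \<Rightarrow> nat pair_pre_digraph" where
  "digraph_at n es m = \<lparr> pverts = {1..n}, parcs = set (take m es) \<rparr>"

text \<open>
  The library's \<^const>\<open>spanning_tree\<close> only asks for weak connectedness and for the absence of
  directed cycles (\<^const>\<open>forest\<close>). Together with uniqueness of the directed path from the root
  to every other vertex this gives in-degree zero at the root and in-degree one elsewhere, that is,
  a tree in the undirected sense with all arcs pointing away from the root. Uniqueness of
  paths alone would still allow arcs pointing back towards the root.
\<close>

definition arborescence_of ::
    "nat pair_pre_digraph \<Rightarrow> nat pair_pre_digraph \<Rightarrow> bool" where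
  "arborescence_of T G \<longleftrightarrow>
     spanning_tree (with_proj T) (with_proj G) \<and>
     (\<exists>u\<in>pverts T. \<forall>v\<in>pverts T - {u}. \<exists>!p. pre_digraph.apath (with_proj T) u p v)"

definition has_arborescence :: "nat pair_pre_digraph \<Rightarrow> bool" where
  "has_arborescence G \<longleftrightarrow> (\<exists>T. arborescence_of T G)"

definition has_rainbow_arborescence ::
    "(nat \<times> nat \<Rightarrow> 'c) \<Rightarrow> nat pair_pre_digraph \<Rightarrow> bool" where
  "has_rainbow_arborescence c G \<longleftrightarrow> (\<exists>T. arborescence_of T G \<and> inj_on c (parcs T))"

text \<open>
  In the hitting times below the range \<open>m \<le> length es\<close> need not be imposed:
  \<^const>\<open>digraph_at\<close> is constant in \<open>m\<close> from there on, so a least \<open>m\<close>, if there is one, lies in it.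
  For \<open>n \<ge> 1\<close> and \<open>es\<close> a list of all arcs, the first two always exist; the third may fail to
  exist, in which case its value is unspecified and existence has to be stated separately.
\<close>

definition m_Z :: "nat \<Rightarrow> (nat \<times> nat) list \<Rightarrow> nat" where
  "m_Z n es = (LEAST m. card {v \<in> {1..n}. in_degree (with_proj (digraph_at n es m)) v = 0} \<le> 1)"

definition m_A :: "nat \<Rightarrow> (nat \<times> nat) list \<Rightarrow> nat" where
  "m_A n es = (LEAST m. has_arborescence (digraph_at n es m))"

definition m_R :: "nat \<Rightarrow> (nat \<times> nat) list \<Rightarrow> (nat \<times> nat \<Rightarrow> 'c) \<Rightarrow> nat" where
  "m_R n es c = (LEAST m. has_rainbow_arborescence c (digraph_at n es m))"

definition eps :: "nat \<Rightarrow> real" where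
  "eps n = ln (ln (real n)) / ln (real n)"

text \<open>
  A uniformly random ordering of the arcs, together with an independent family of colours, one
  per arc, each uniform on \<open>W\<close>. The value \<^const>\<open>undefined\<close> is what a colouring takes
  outside the arc set.
\<close>

definition coloured_process ::
    "nat \<Rightarrow> 'c set \<Rightarrow> ((nat \<times> nat) list \<times> (nat \<times> nat \<Rightarrow> 'c)) pmf" where
  "coloured_process n W =
     pair_pmf (pmf_of_set (permutations_of_set (complete_arcs n)))
              (Pi_pmf (complete_arcs n) undefined (\<lambda>_. pmf_of_set W))"

end

theory Submission
  imports Defs "HOL-Real_Asymp.Real_Asymp"
begin

text \<open>
  An arborescence leaves at most one vertex without in-arcs, so \<open>m_Z \<le> m_A \<le> m_R\<close>, and it suffices
  to find a rainbow arborescence at time \<open>m_Z\<close>. That time depends on the order of the heads only;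
  given the heads, the tails at the different vertices form independent random permutations.
  Write \<open>l = ln n\<close> and \<open>s = sqrt (ln l)\<close>. With high probability few vertices have at most
  \<open>l / 100\<close> in-arcs at time \<open>m_Z\<close> and all but one, the root \<open>z\<close>, have at least one. A vertex of low
  in-degree uses its first in-arc. Every other vertex has three blocks of \<open>k \<approx> l / 300\<close> in-arcs.
  Walking backwards through first blocks from an arbitrary vertex, always to a new vertex along a new
  colour, one meets an arc out of \<open>z\<close> shortly after \<open>n / s\<close> steps: this gives a rainbow path
  \<open>T\<close> of length at least \<open>n / s\<close> starting at \<open>z\<close>. The remaining vertices take an in-arc from \<open>T\<close> in
  the second block, or, if there are too few of them, an arc in the third block whose tail is
  neither of low degree nor deficient itself. Following such arcs backwards cannot create
  a cycle. Each vertex has a choice between many colours that are uniform on the unused ones,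
  of which \<open>50 \<epsilon> n\<close> are left over, and a union bound over the violations of Hall's condition
  gives distinct colours.
\<close>

section \<open>Arborescences\<close>

text \<open>The walk, the choice from \<open>T\<close> and the matching of colours compete for
  \<open>s\<close>, and this fixes its size. Because of used colours and spent or deficient
  vertices, an arc misses its target with probability of order \<open>1 / s\<close>; a block misses
  with probability about \<open>(1 / s) ^ k\<close>, that is \<open>n\<close> to the power
  \<open>- ln s / 300\<close>, which beats a union bound over vertices once \<open>s\<close> is
  large. On the other hand a block holds about \<open>k / s\<close> arcs out of \<open>T\<close>, so
  the number \<open>m\<close> of choices that can be guaranteed has order \<open>l / s\<close>. A
  violation of Hall's condition costs at most about \<open>(n / q) ^ m\<close> per vertex, where
  \<open>q\<close> is the number of colours and \<open>n / q\<close> is about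
  \<open>1 - 50 * ln l / l\<close>. The exponent has order \<open>ln l / s\<close>, and
  \<open>s = sqrt (ln l)\<close> makes both \<open>s\<close> and \<open>ln l / s\<close> unbounded.
  Degrees are inspected at a fixed time \<open>m0\<close>, about \<open>3 / 4 * n * l\<close>,
  instead of the random time \<open>m_Z\<close>. At \<open>m0\<close> about
  \<open>n powr (1 / 4)\<close> vertices still lack in-arcs, so \<open>m_Z\<close> comes later, and
  vertices of low degree can only become fewer in between.\<close>

lemma arborescence_of_parents:
  fixes G :: "nat pair_pre_digraph"
  assumes wf: "pair_wf_digraph G" and z: "z \<in> pverts G"
    and par: "\<And>v. v \<in> pverts G - {z} \<Longrightarrow> (par v, v) \<in> parcs G"
    and rk: "\<And>v. v \<in> pverts G - {z} \<Longrightarrow> (rk (par v) :: nat) < rk v"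
  shows "arborescence_of \<lparr> pverts = pverts G, parcs = (\<lambda>v. (par v, v)) ` (pverts G - {z}) \<rparr> G"
proof -
  define T where "T = \<lparr> pverts = pverts G, parcs = (\<lambda>v. (par v, v)) ` (pverts G - {z}) \<rparr>"
  have sub: "parcs T \<subseteq> parcs G" using par by (auto simp: T_def)
  interpret G: pair_wf_digraph G by (rule wf)
  have parV: "v = z" if "v \<in> pverts G" "par v \<notin> pverts G" for v
    using G.in_arcsD1[OF par[of v]] that by auto
  interpret T: pair_wf_digraph T
    by unfold_locales (auto simp: T_def parV)
  have arcT: "e \<in> parcs T \<Longrightarrow> fst e = par (snd e) \<and> snd e \<noteq> z \<and> snd e \<in> pverts G
      \<and> rk (fst e) < rk (snd e)" for e
    using rk by (auto simp: T_def)
  \<comment> \<open>\<open>rk\<close> grows along every arc of \<open>T\<close>, so closed walks are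
    empty: this excludes cycles and settles the base case of uniqueness.\<close>
  have incr: "q = [] \<and> u = v \<or> q \<noteq> [] \<and> rk u < rk v" if "T.awalk u q v" for u q v
    using that
  proof (induction q arbitrary: u)
    case (Cons e q)
    then show ?case using arcT[of e] by (force simp: T.awalk_Cons_iff)
  qed (auto simp: T.awalk_Nil_iff)
  have reach: "\<exists>q. T.awalk z q v" if "v \<in> pverts T" for v
    using that
  proof (induction "rk v" arbitrary: v rule: less_induct)
    case less
    show ?case
    proof (cases "v = z")
      case True
      then show ?thesis using less by (intro exI[of _ "[]"]) (simp add: T.awalk_Nil_iff)
    next
      case False
      then have v: "v \<in> pverts G - {z}" using less by (auto simp: T_def)
      then have a: "(par v, v) \<in> parcs T" by (auto simp: T_def)
      from less(1)[OF rk[OF v]] obtain q where "T.awalk z q (par v)"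
        using a T.in_arcsD1 by blast
      moreover have "T.awalk (par v) [(par v, v)] v"
        using T.arc_implies_awalk[of "(par v, v)"] a by simp
      ultimately show ?thesis using T.awalk_appendI by blast
    qed
  qed
  \<comment> \<open>Walks are compared from their ends: the last arc is determined by its head,
    since its tail must be \<open>par\<close> of that head.\<close>
  have uniq: "q = q'" if "T.awalk z q v" "T.awalk z q' v" for q q' v
    using that
  proof (induction q arbitrary: v q' rule: rev_induct)
    case Nil
    then show ?case using incr[of z q' v] by (auto simp: T.awalk_Nil_iff)
  next
    case (snoc e q)
    have e: "T.awalk z q (fst e)" "e \<in> parcs T" "snd e = v"
      using snoc.prems(1) by (auto simp: T.awalk_simps)
    then have "v \<noteq> z" using arcT[of e] by auto
    then obtain e' q'' where q': "q' = q'' @ [e']"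
      using snoc.prems(2) by (cases q' rule: rev_cases) (auto simp: T.awalk_Nil_iff)
    have e': "T.awalk z q'' (fst e')" "e' \<in> parcs T" "snd e' = v"
      using snoc.prems(2) by (auto simp: T.awalk_simps q')
    have "e = e'" using arcT[of e] arcT[of e'] e e' by (simp add: prod_eq_iff)
    then show ?case using snoc.IH[OF e(1)] e'(1) q' by auto
  qed
  have forest: "forest (with_proj T)"
    unfolding forest_def T.cycle_def using incr by force
  have reachT: "z \<rightarrow>\<^sup>*\<^bsub>with_proj T\<^esub> v" if "v \<in> pverts T" for v
    using reach[OF that] T.reachable_awalk by blast
  interpret M: pair_wf_digraph "mk_symmetric (with_proj T)" ..
  have conn: "connected (with_proj T)"
    unfolding connected_def strongly_connected_def
  proof (intro conjI ballI)
    show "verts (with_proj (mk_symmetric (with_proj T))) \<noteq> {}"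
      using z by (auto simp: T_def)
    fix u v assume uv: "u \<in> verts (with_proj (mk_symmetric (with_proj T)))"
      "v \<in> verts (with_proj (mk_symmetric (with_proj T)))"
    have "z \<rightarrow>\<^sup>*\<^bsub>mk_symmetric (with_proj T)\<^esub> w" if "w \<in> pverts T" for w
      using reachT[OF that] T.reachable_mk_symmetricI by blast
    then show "u \<rightarrow>\<^sup>*\<^bsub>mk_symmetric (with_proj T)\<^esub> v"
      using uv by (auto intro: M.reachable_trans[OF symmetric_reachable[OF symmetric_mk_symmetric]])
  qed
  have "spanning_tree (with_proj T) (with_proj G)"
    using conn forest sub T.wf_digraph_axioms G.wf_digraph_axioms
    by (auto simp: spanning_tree_def tree_def spanning_def subgraph_def compatible_def T_def)
  moreover have "\<exists>u\<in>pverts T. \<forall>v\<in>pverts T - {u}. \<exists>!p. T.apath u p v"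
  proof (intro bexI ballI)
    show "z \<in> pverts T" using z by (simp add: T_def)
    fix v assume "v \<in> pverts T - {z}"
    then have "\<exists>p. T.apath z p v" using reachT T.reachable_apath by blast
    then show "\<exists>!p. T.apath z p v" using uniq T.awalkI_apath by blast
  qed
  ultimately show ?thesis unfolding arborescence_of_def T_def by blast
qed

text \<open>The directed path from the root to any other vertex ends with an arc into that vertex.
  Applied at each time, this shows that no arborescence appears before \<open>m_Z\<close>.\<close>

lemma has_arborescence_indegree_zero:
  assumes "has_arborescence G" and fin: "finite (parcs G)"
  shows "\<exists>u. {v \<in> pverts G. in_degree (with_proj G) v = 0} \<subseteq> {u}"
proof -
  obtain T u where sp: "spanning_tree (with_proj T) (with_proj G)" and u: "u \<in> pverts T"
    and path: "\<And>v. v \<in> pverts T - {u} \<Longrightarrow> \<exists>p. pre_digraph.apath (with_proj T) u p v"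
    using assms unfolding has_arborescence_def arborescence_of_def by blast
  have sub: "parcs T \<subseteq> parcs G" and V: "pverts T = pverts G" and wfT: "wf_digraph (with_proj T)"
    using sp by (auto simp: spanning_tree_def spanning_def subgraph_def)
  interpret T: wf_digraph "with_proj T" by (rule wfT)
  have "in_degree (with_proj G) v \<noteq> 0" if v: "v \<in> pverts G - {u}" for v
  proof -
    obtain p where p: "T.apath u p v" using path v V by blast
    then have "p \<noteq> []" using v by (auto simp: T.apath_Nil_iff)
    then obtain q e where "p = q @ [e]" by (cases p rule: rev_cases) auto
    with p have "e \<in> parcs T" "snd e = v"
      unfolding T.apath_def by (auto simp: T.awalk_simps)
    then have "e \<in> in_arcs (with_proj G) v" using sub by (auto simp: in_arcs_def)
    moreover have "finite (in_arcs (with_proj G) v)" using fin by (simp add: in_arcs_def)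
    ultimately show ?thesis by (auto simp: in_degree_def)
  qed
  then have "{v \<in> pverts G. in_degree (with_proj G) v = 0} \<subseteq> {u}" by blast
  then show ?thesis ..
qed

section \<open>Sampling coloured in-arcs\<close>

lemma prob_bind_pmf:
  "measure_pmf.prob (bind_pmf p f) E = measure_pmf.expectation p (\<lambda>x. measure_pmf.prob (f x) E)"
  by (simp add: measure_pmf_bind measure_pmf.measure_bind[where N="count_space UNIV"]
      measure_pmf_in_subprob_algebra)

lemma integrable_pmf_bounded:
  fixes f :: "'a \<Rightarrow> real"
  assumes "\<And>x. \<bar>f x\<bar> \<le> B"
  shows "integrable (measure_pmf p) f"
  using assms by (intro measure_pmf.integrable_const_bound[where B=B]) auto

text \<open>The pattern of every staged exposure below: pay for a bad first stage, otherwise bound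
  the second stage conditionally on the first.\<close>

lemma prob_bind_pmf_le_add:
  assumes bad: "measure_pmf.prob p B \<le> b1"
    and good: "\<And>x. x \<in> set_pmf p \<Longrightarrow> x \<notin> B \<Longrightarrow> measure_pmf.prob (f x) E \<le> b2"
    and "0 \<le> b2"
  shows "measure_pmf.prob (bind_pmf p f) E \<le> b1 + b2"
proof -
  have "measure_pmf.expectation p (\<lambda>x. measure_pmf.prob (f x) E)
      \<le> measure_pmf.expectation p (\<lambda>x. indicator B x + b2)"
    using \<open>0 \<le> b2\<close> good
    by (intro integral_mono_AE Bochner_Integration.integrable_add measure_pmf.integrable_const
        integrable_pmf_bounded[where B=1])
      (auto simp: AE_measure_pmf_iff indicator_def add_increasing2)
  also have "\<dots> = measure_pmf.prob p B + b2"
    by (subst Bochner_Integration.integral_add)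
      (auto intro!: integrable_pmf_bounded[where B=1] simp: indicator_def)
  finally show ?thesis using bad by (simp add: prob_bind_pmf)
qed

text \<open>\<open>sample W k A\<close> draws \<open>k\<close> distinct tails from \<open>A\<close> in random order, each with an independent
  colour from \<open>W\<close>. Only meaningful for \<open>k \<le> card A\<close>, since \<^const>\<open>pmf_of_set\<close> is unspecified on
  the empty set.\<close>

primrec sample :: "'c set \<Rightarrow> nat \<Rightarrow> 'a set \<Rightarrow> ('a \<times> 'c) list pmf" where
  "sample W 0 A = return_pmf []"
| "sample W (Suc k) A = bind_pmf (pmf_of_set A) (\<lambda>u. bind_pmf (pmf_of_set W)
      (\<lambda>c. map_pmf ((#) (u, c)) (sample W k (A - {u}))))"

text \<open>This lets the in-arcs of a vertex be revealed block by block: given one block, the next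
  is again a sample, from the tails not drawn yet.\<close>

lemma sample_add:
  "sample W (j + k) A =
     bind_pmf (sample W j A) (\<lambda>a. map_pmf ((@) a) (sample W k (A - fst ` set a)))"
proof (induction j arbitrary: A)
  case 0
  have "((@) []) = (\<lambda>x. x :: ('a \<times> 'b) list)" by auto
  then show ?case by (simp add: bind_return_pmf)
next
  case (Suc j)
  show ?case
    by (simp add: Suc.IH map_pmf_def bind_assoc_pmf bind_return_pmf Diff_insert2[symmetric]
        set_diff_eq cong: bind_pmf_cong)
qed

lemma length_sample: "xs \<in> set_pmf (sample W k A) \<Longrightarrow> length xs = k"
  by (induction k arbitrary: A xs) auto

lemma sample_fst:
  assumes "finite A" "k \<le> card A" "xs \<in> set_pmf (sample W k A)"
  shows "fst ` set xs \<subseteq> A \<and> card (fst ` set xs) \<le> k"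
  using assms
proof (induction k arbitrary: A xs)
  case (Suc k)
  then have "A \<noteq> {}" by auto
  with Suc.prems obtain u c ys where "u \<in> A" "xs = (u, c) # ys"
    "ys \<in> set_pmf (sample W k (A - {u}))" by auto
  moreover then have "fst ` set ys \<subseteq> A - {u} \<and> card (fst ` set ys) \<le> k"
    using Suc.prems by (intro Suc.IH) auto
  moreover have "card (insert u (fst ` set ys)) \<le> Suc (card (fst ` set ys))"
    by (rule card_insert_le_m1) auto
  ultimately show ?case by auto
qed auto

text \<open>In-lists can thus be cut to prescribed lengths and remain samples.\<close>

lemma map_take_sample:
  "map_pmf (take j) (sample W (j + k) A) = sample W j A"
proof -
  have "map_pmf (take j) (sample W (j + k) A) = bind_pmf (sample W j A) (\<lambda>a.
     map_pmf (\<lambda>_. a) (sample W k (A - fst ` set a)))"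
    unfolding sample_add map_bind_pmf
    by (intro bind_pmf_cong refl) (simp add: pmf.map_comp o_def length_sample cong: map_pmf_cong)
  then show ?thesis by (simp add: map_pmf_const bind_return_pmf')
qed

lemma prob_bind_pmf_of_set:
  assumes "finite A" "A \<noteq> {}"
  shows "measure_pmf.prob (bind_pmf (pmf_of_set A) f) E = (\<Sum>x\<in>A. measure_pmf.prob (f x) E) / card A"
  using assms by (simp add: prob_bind_pmf integral_pmf_of_set)

lemma prob_sample_Suc:
  assumes "finite A" "A \<noteq> {}" "finite W" "W \<noteq> {}"
  shows "measure_pmf.prob (sample W (Suc k) A) E =
    (\<Sum>u\<in>A. (\<Sum>c\<in>W. measure_pmf.prob (sample W k (A - {u})) {xs. (u, c) # xs \<in> E}) / card W) / card A"
  using assms by (simp add: prob_bind_pmf_of_set vimage_def)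

lemma average_le_two_valued:
  fixes f :: "'a \<Rightarrow> real"
  assumes "finite A" "A \<noteq> {}"
    and "\<And>x. x \<in> A \<Longrightarrow> x \<in> U \<Longrightarrow> f x \<le> a" and "\<And>x. x \<in> A \<Longrightarrow> x \<notin> U \<Longrightarrow> f x \<le> b"
  shows "sum f A / card A \<le> card (A \<inter> U) / card A * a + (1 - card (A \<inter> U) / card A) * b"
proof -
  have "sum f A = sum f (A \<inter> U) + sum f (A - U)"
    using assms(1) sum.Int_Diff by metis
  also have "\<dots> \<le> card (A \<inter> U) * a + card (A - U) * b"
    using assms by (intro add_mono sum_bounded_above) auto
  also have "real (card (A - U)) = real (card A) - real (card (A \<inter> U))"
    using assms(1) by (simp add: card_Diff_subset_Int of_nat_diff card_mono)
  finally have "sum f A / card A \<le> (card (A \<inter> U) * a + (real (card A) - card (A \<inter> U)) * b) / card A"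
    by (intro divide_right_mono) auto
  also have "\<dots> = card (A \<inter> U) / card A * a + (1 - card (A \<inter> U) / card A) * b"
    using assms by (simp add: field_simps add_divide_distrib)
  finally show ?thesis .
qed

definition hits :: "'a set \<Rightarrow> 'c set \<Rightarrow> ('a \<times> 'c) list \<Rightarrow> nat" where
  "hits U C xs = length (filter (\<lambda>x. x \<in> U \<times> C) xs)"

lemma hits_Nil [simp]: "hits U C [] = 0"
  and hits_Cons [simp]: "hits U C ((u, c) # xs) = (if u \<in> U \<and> c \<in> C then 1 else 0) + hits U C xs"
  by (simp_all add: hits_def)

text \<open>Chernoff's method: on the event, \<open>\<theta> ^ hits U C xs\<close> is at least
  \<open>\<theta> ^ m\<close>. The draws are without replacement, but \<open>k\<close> draws remove
  at most \<open>k\<close> elements of \<open>U\<close>, so each draw hits with conditional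
  probability at least \<open>\<pi>\<close>. Subtracting \<open>k\<close> in the hypothesis keeps it
  stable when one tail is removed and \<open>k\<close> drops by one.\<close>

lemma prob_hits_le:
  fixes \<theta> \<pi> :: real
  assumes "finite A" "finite W" "W \<noteq> {}" "k \<le> card A" "0 \<le> \<theta>" "\<theta> \<le> 1" "0 \<le> \<pi>"
    and "\<pi> * card A * card W \<le> (real (card (A \<inter> U)) - k) * card (W \<inter> C)"
  shows "\<theta> ^ m * measure_pmf.prob (sample W k A) {xs. hits U C xs \<le> m} \<le> (1 - \<pi> * (1 - \<theta>)) ^ k"
  using assms(1,4,8)
proof (induction k arbitrary: A m)
  case 0
  then show ?case using assms by (simp add: indicator_def power_le_one)
next
  case (Suc k)
  have ne: "A \<noteq> {}" using Suc.prems by auto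
  then have cA: "0 < real (card A)" using Suc.prems by (simp add: card_gt_0_iff)
  have cW: "0 < real (card W)" using assms by (simp add: card_gt_0_iff)
  define h where "h = card (A \<inter> U) / card A"
  define w where "w = card (W \<inter> C) / card W"
  define R where "R = (1 - \<pi> * (1 - \<theta>)) ^ k"
  have "card (A \<inter> U) \<le> card A" "card (W \<inter> C) \<le> card W"
    using Suc.prems assms by (auto intro: card_mono)
  then have hw: "0 \<le> h" "h \<le> 1" "0 \<le> w" "w \<le> 1" using cA cW by (auto simp: h_def w_def)
  have "\<pi> * card A * card W \<le> card (A \<inter> U) * card (W \<inter> C)"
    by (rule order_trans[OF Suc.prems(3)]) (simp add: mult_right_mono)
  then have \<pi>le: "\<pi> \<le> h * w" using cA cW by (simp add: h_def w_def field_simps)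
  then have "\<pi> \<le> 1" using hw by (meson mult_le_one order_trans)
  then have R: "0 \<le> R" using assms by (auto simp: R_def mult_le_one)
  let ?E = "\<lambda>m. {xs. hits U C xs \<le> m}"
  have IH: "\<theta> ^ m' * measure_pmf.prob (sample W k (A - {u})) (?E m') \<le> R" if u: "u \<in> A" for u m'
    unfolding R_def
  proof (rule Suc.IH)
    have "\<pi> * card (A - {u}) * card W \<le> \<pi> * card A * card W"
      using assms Suc.prems by (intro mult_right_mono mult_left_mono) (auto intro: card_mono)
    also have "\<dots> \<le> (real (card (A \<inter> U)) - Suc k) * card (W \<inter> C)" by (rule Suc.prems)
    also have "\<dots> \<le> (real (card ((A - {u}) \<inter> U)) - k) * card (W \<inter> C)"
    proof (intro mult_right_mono)
      have "card (A \<inter> U) \<le> Suc (card ((A - {u}) \<inter> U))"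
        using card_insert_le_m1[of "Suc (card ((A - {u}) \<inter> U))" "(A - {u}) \<inter> U" u] Suc.prems
          card_mono[of "insert u ((A - {u}) \<inter> U)" "A \<inter> U"] by fastforce
      then show "real (card (A \<inter> U)) - Suc k \<le> real (card ((A - {u}) \<inter> U)) - k" by simp
    qed simp
    finally show "\<pi> * card (A - {u}) * card W \<le> (real (card ((A - {u}) \<inter> U)) - k) * card (W \<inter> C)" .
  qed (use Suc.prems u in auto)
  define g where "g u c = measure_pmf.prob (sample W k (A - {u})) {xs. hits U C ((u, c) # xs) \<le> m}" for u c
  have "\<theta> ^ m * measure_pmf.prob (sample W (Suc k) A) (?E m)
      = (\<Sum>u\<in>A. (\<Sum>c\<in>W. \<theta> ^ m * g u c) / card W) / card A"
    unfolding prob_sample_Suc[OF Suc.prems(1) ne assms(2,3)]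
    by (simp add: sum_distrib_left sum_divide_distrib g_def)
  also have "\<dots> \<le> card (A \<inter> U) / card A * (w * (\<theta> * R) + (1 - w) * R) + (1 - card (A \<inter> U) / card A) * R"
  proof (rule average_le_two_valued)
    fix u assume u: "u \<in> A" "u \<in> U"
    show "(\<Sum>c\<in>W. \<theta> ^ m * g u c) / card W \<le> w * (\<theta> * R) + (1 - w) * R"
      unfolding w_def
    proof (rule average_le_two_valued)
      \<comment> \<open>A hit lowers the budget from \<open>m\<close> to \<open>m - 1\<close> and
        gains a factor \<open>\<theta>\<close>; for \<open>m = 0\<close> the event has become
        impossible.\<close>
      fix c assume "c \<in> C"
      then show "\<theta> ^ m * g u c \<le> \<theta> * R"
        using u IH[OF u(1), of "m - 1"] R assms
        by (cases m) (auto simp: g_def mult.assoc intro: mult_left_mono)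
    qed (use IH u assms in \<open>auto simp: g_def\<close>)
  next
    fix u assume u: "u \<in> A" "u \<notin> U"
    have "(\<Sum>c\<in>W. \<theta> ^ m * g u c) \<le> card W * R"
      using IH u by (intro sum_bounded_above) (auto simp: g_def)
    then show "(\<Sum>c\<in>W. \<theta> ^ m * g u c) / card W \<le> R" using cW by (simp add: field_simps)
  qed (use Suc.prems ne in auto)
  also have "\<dots> = (1 - h * w * (1 - \<theta>)) * R" by (simp add: h_def[symmetric] algebra_simps)
  also have "\<dots> \<le> (1 - \<pi> * (1 - \<theta>)) * R"
    using \<pi>le R assms by (intro mult_right_mono) (auto intro: mult_right_mono)
  finally show ?case by (simp add: R_def)
qed

text \<open>The second summand makes the bound multiplicative: a sample with too few hits is charged
  \<open>r ^ m\<close>, the price of the later sample that will replace it.\<close>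

lemma prob_hit_colours_le:
  fixes r :: real
  assumes "finite A" "finite W" "W \<noteq> {}" "k \<le> card A" "W \<inter> C \<noteq> {}" "Y \<subseteq> W \<inter> C"
    and r: "r = card Y / card (W \<inter> C)"
  shows "measure_pmf.prob (sample W k A) {xs. m \<le> hits U C xs \<and> set xs \<inter> U \<times> C \<subseteq> U \<times> Y}
    + r ^ m * measure_pmf.prob (sample W k A) {xs. hits U C xs < m} \<le> r ^ m"
  using assms(1,4)
proof (induction k arbitrary: A m)
  case 0
  then show ?case by (auto simp: indicator_def)
next
  case (Suc k)
  let ?E = "\<lambda>m. {xs. m \<le> hits U C xs \<and> set xs \<inter> U \<times> C \<subseteq> U \<times> Y}" and ?L = "\<lambda>m. {xs. hits U C xs < m}"
  have ne: "A \<noteq> {}" using Suc.prems by auto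
  then have cA: "0 < real (card A)" using Suc.prems by (simp add: card_gt_0_iff)
  have cW: "0 < real (card W)" "0 < real (card (W \<inter> C))" using assms by (auto simp: card_gt_0_iff)
  have r0: "0 \<le> r" by (simp add: r)
  show ?case
  proof (cases m)
    case 0
    then show ?thesis by simp
  next
    case (Suc m')
    define P Q where "P m u = measure_pmf.prob (sample W k (A - {u})) (?E m)"
      and "Q m u = measure_pmf.prob (sample W k (A - {u})) (?L m)" for m u
    have IH: "P m u + r ^ m * Q m u \<le> r ^ m" if "u \<in> A" for m u
      unfolding P_def Q_def using that Suc.prems by (intro Suc.IH) auto
    have PQ0: "0 \<le> P m u" "0 \<le> Q m u" for m u by (auto simp: P_def Q_def)
    define g where "g u c = measure_pmf.prob (sample W k (A - {u})) {xs. (u, c) # xs \<in> ?E m}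
        + r ^ m * measure_pmf.prob (sample W k (A - {u})) {xs. (u, c) # xs \<in> ?L m}" for u c
    have "measure_pmf.prob (sample W (Suc k) A) (?E m) + r ^ m * measure_pmf.prob (sample W (Suc k) A) (?L m)
        = (\<Sum>u\<in>A. (\<Sum>c\<in>W. g u c) / card W) / card A"
      unfolding prob_sample_Suc[OF Suc.prems(1) ne assms(2,3)]
      by (simp add: sum_distrib_left sum_divide_distrib g_def sum.distrib add_divide_distrib)
    also have "\<dots> \<le> (\<Sum>u\<in>A. r ^ m) / card A"
    proof (intro divide_right_mono sum_mono)
      fix u assume u: "u \<in> A"
      have miss: "g u c \<le> r ^ m" if "u \<notin> U \<or> c \<notin> C" for c
      proof -
        have "g u c = P m u + r ^ m * Q m u"
          unfolding g_def P_def Q_def using that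
          by (intro arg_cong2[where f="(+)"] arg_cong2[where f="(*)"] arg_cong2[where f=measure_pmf.prob]) auto
        then show ?thesis using IH[OF u] by simp
      qed
      have "(\<Sum>c\<in>W. g u c) \<le> card W * r ^ m"
      proof (cases "u \<in> U")
        case True
        \<comment> \<open>The colours fall into three classes: those in \<open>Y\<close> use up one
          of the \<open>m\<close> hits, the others in \<open>C\<close> destroy the event and leave
          only the charge, and those outside \<open>C\<close> change nothing.\<close>
        have Yg: "g u c = P m' u + r ^ m * Q m' u" if "c \<in> Y" for c
          unfolding g_def P_def Q_def using that True assms Suc
          by (intro arg_cong2[where f="(+)"] arg_cong2[where f="(*)"] arg_cong2[where f=measure_pmf.prob]) auto
        have Cg: "g u c = r ^ m * Q m' u" if "c \<in> W \<inter> C - Y" for c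
        proof -
          have 1: "{xs. (u, c) # xs \<in> ?E m} = {}" using that True by auto
          have 2: "{xs. (u, c) # xs \<in> ?L m} = ?L m'" using that True Suc by auto
          show ?thesis by (simp only: g_def Q_def 1 2) simp
        qed
        have "(\<Sum>c\<in>W. g u c) = (\<Sum>c\<in>W \<inter> C. g u c) + (\<Sum>c\<in>W - C. g u c)"
          using assms sum.Int_Diff by metis
        also have "(\<Sum>c\<in>W - C. g u c) \<le> card (W - C) * r ^ m"
          using miss by (intro sum_bounded_above) auto
        also have "(\<Sum>c\<in>W \<inter> C. g u c) = (\<Sum>c\<in>Y. g u c) + (\<Sum>c\<in>W \<inter> C - Y. g u c)"
          using assms by (metis (no_types, lifting) add.commute finite_Int sum.subset_diff)
        also have "(\<Sum>c\<in>Y. g u c) = card Y * (P m' u + r ^ m * Q m' u)" using Yg by simp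
        also have "(\<Sum>c\<in>W \<inter> C - Y. g u c) = (real (card (W \<inter> C)) - card Y) * (r ^ m * Q m' u)"
        proof -
          have "finite (W \<inter> C)" using assms by simp
          then have "finite Y" "card Y \<le> card (W \<inter> C)"
            using finite_subset[OF assms(6)] card_mono[OF _ assms(6)] by auto
          then have "real (card (W \<inter> C - Y)) = real (card (W \<inter> C)) - card Y"
            by (simp add: card_Diff_subset[OF _ assms(6)] of_nat_diff)
          then show ?thesis using Cg by simp
        qed
        \<comment> \<open>The choice of \<open>r\<close> as the fraction of \<open>Y\<close> in
          \<open>W \<inter> C\<close> makes both contributions recombine into the induction
          hypothesis for \<open>m'\<close>.\<close>
        also have "card Y * (P m' u + r ^ m * Q m' u) + (real (card (W \<inter> C)) - card Y) * (r ^ m * Q m' u)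
            = card (W \<inter> C) * (r * (P m' u + r ^ m' * Q m' u))"
          using cW Suc by (simp add: r field_simps)
        also have "\<dots> \<le> card (W \<inter> C) * (r * r ^ m')"
          using IH[OF u, of m'] r0 by (intro mult_left_mono) auto
        also have "real (card (W \<inter> C)) * (r * r ^ m') + card (W - C) * r ^ m = card W * r ^ m"
        proof -
          have "real (card W) = card (W \<inter> C) + card (W - C)"
            using card_Int_Diff[OF assms(2), of C] by simp
          then show ?thesis by (simp only: Suc) (simp add: algebra_simps)
        qed
        finally show ?thesis by simp
      qed (use miss in \<open>auto intro: sum_bounded_above\<close>)
      then show "(\<Sum>c\<in>W. g u c) / card W \<le> r ^ m" using cW by (simp add: field_simps)
    qed simp
    also have "\<dots> = r ^ m" using cA by simp
    finally show ?thesis .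
  qed
qed

text \<open>The tail \<open>z\<close> is among \<open>k\<close> draws from \<open>A\<close> with
  probability \<open>k / card A\<close>, and its colour is independent of that.\<close>

lemma prob_miss_pair_le:
  fixes A :: "'a set"
  assumes "finite A" "finite W" "W \<noteq> {}" "k \<le> card A" "z \<in> A"
  shows "measure_pmf.prob (sample W k A) {xs. set xs \<inter> {z} \<times> C = {}}
    \<le> 1 - k / card A * (card (W \<inter> C) / card W)"
  using assms(1,4,5)
proof (induction k arbitrary: A)
  case (Suc k)
  define w where "w = card (W \<inter> C) / card W"
  have ne: "A \<noteq> {}" using Suc.prems by auto
  then have cA: "0 < card A" using Suc.prems by (simp add: card_gt_0_iff)
  have cW: "0 < real (card W)" using assms by (simp add: card_gt_0_iff)
  define g where "g u c = measure_pmf.prob (sample W k (A - {u})) {xs. set ((u, c) # xs) \<inter> {z} \<times> C = {}}" for u c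
  have "measure_pmf.prob (sample W (Suc k) A) {xs. set xs \<inter> {z} \<times> C = {}}
      = (\<Sum>u\<in>A. (\<Sum>c\<in>W. g u c) / card W) / card A"
    unfolding prob_sample_Suc[OF Suc.prems(1) ne assms(2,3)]
    by (simp add: g_def)
  also have "\<dots> \<le> card (A \<inter> {z}) / card A * (1 - w)
      + (1 - card (A \<inter> {z}) / card A) * (1 - k / (card A - 1) * w)"
  proof (rule average_le_two_valued)
    fix u assume u: "u \<in> A" "u \<in> {z}"
    have "(\<Sum>c\<in>W. g u c) / card W \<le> w * 0 + (1 - w) * 1"
      unfolding w_def using u
      by (intro average_le_two_valued) (use assms in \<open>auto simp: g_def\<close>)
    then show "(\<Sum>c\<in>W. g u c) / card W \<le> 1 - w" by simp
  next
    fix u assume u: "u \<in> A" "u \<notin> {z}"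
    have "g u c \<le> 1 - k / (card A - 1) * w" for c
    proof -
      have "g u c = measure_pmf.prob (sample W k (A - {u})) {xs. set xs \<inter> {z} \<times> C = {}}"
        using u by (auto simp: g_def)
      also have "\<dots> \<le> 1 - k / card (A - {u}) * (card (W \<inter> C) / card W)"
        using u Suc.prems by (intro Suc.IH) auto
      finally show ?thesis using u Suc.prems cA by (simp add: w_def of_nat_diff)
    qed
    then have "(\<Sum>c\<in>W. g u c) \<le> card W * (1 - k / (card A - 1) * w)"
      by (intro sum_bounded_above) auto
    then show "(\<Sum>c\<in>W. g u c) / card W \<le> 1 - k / (card A - 1) * w" using cW by (simp add: field_simps)
  qed (use Suc.prems ne in auto)
  also have "\<dots> = 1 - Suc k / card A * w"
  proof -
    have "card (A \<inter> {z}) = 1" using Suc.prems by simp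
    moreover have "1 / real (card A) * (1 - w) + (1 - 1 / real (card A)) * (1 - k / (card A - 1) * w)
        = 1 - Suc k / card A * w"
    \<comment> \<open>For a one-element \<open>A\<close> the quotient by \<open>card A - 1\<close>
      is a division by zero, but then \<open>k = 0\<close> and the numerator vanishes.\<close>
    proof (cases "card A = 1")
      case True
      then have "k = 0" using Suc.prems by simp
      then show ?thesis using True by simp
    next
      case False
      then have "real (card A) > 1" using cA by simp
      then show ?thesis by (simp add: divide_simps) (simp add: algebra_simps)
    qed
    ultimately show ?thesis by simp
  qed
  finally show ?case by (simp add: w_def)
qed simp

section \<open>Hall's theorem\<close>

text \<open>The induction of Halmos and Vaughan. If a nonempty proper subset \<open>J\<close> is
  tight, \<open>J\<close> is matched by itself and the rest outside the neighbours of
  \<open>J\<close>. If every nonempty proper subset has a surplus, an arbitrary value for one index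
  costs the others at most one neighbour and Hall's condition survives.\<close>

lemma hall_marriage:
  fixes N :: "'i \<Rightarrow> 'c set"
  assumes "finite I" "\<And>i. i \<in> I \<Longrightarrow> finite (N i)"
    and "\<And>J. J \<subseteq> I \<Longrightarrow> card J \<le> card (\<Union> (N ` J))"
  shows "\<exists>f. inj_on f I \<and> (\<forall>i\<in>I. f i \<in> N i)"
  using assms
proof (induction "card I" arbitrary: I N rule: less_induct)
  case less
  note fin = less.prems(1,2) and hall = less.prems(3)
  have finU: "finite (\<Union> (N ` J))" if "J \<subseteq> I" for J
    using that fin by (meson finite_UN_I finite_subset subsetD)
  consider (empty) "I = {}"
    | (tight) J where "J \<subseteq> I" "J \<noteq> {}" "J \<noteq> I" "card (\<Union> (N ` J)) = card J"
    | (loose) i where "i \<in> I" "\<And>J. J \<subseteq> I \<Longrightarrow> J \<noteq> {} \<Longrightarrow> J \<noteq> I \<Longrightarrow> card J < card (\<Union> (N ` J))"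
  proof (cases "\<exists>J. J \<subseteq> I \<and> J \<noteq> {} \<and> J \<noteq> I \<and> card (\<Union> (N ` J)) = card J")
    case True
    then show ?thesis using that(2) by blast
  next
    case False
    then have "card J < card (\<Union> (N ` J))" if "J \<subseteq> I" "J \<noteq> {}" "J \<noteq> I" for J
    proof -
      have "card J \<noteq> card (\<Union> (N ` J))" using False that by metis
      then show ?thesis using hall[OF that(1)] by simp
    qed
    then show ?thesis using that(1,3) by blast
  qed
  then show ?case
  proof cases
    case empty
    then show ?thesis by simp
  next
    case tight
    have finJ: "finite J" using tight fin finite_subset by blast
    have "card J < card I" using tight fin by (intro psubset_card_mono) auto
    then have "\<exists>f. inj_on f J \<and> (\<forall>i\<in>J. f i \<in> N i)"
      using tight fin hall finJ by (intro less.hyps) auto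
    then obtain f where f: "inj_on f J" "\<And>i. i \<in> J \<Longrightarrow> f i \<in> N i" by blast
    define M where "M i = N i - \<Union> (N ` J)" for i
    have "\<exists>g. inj_on g (I - J) \<and> (\<forall>i\<in>I - J. g i \<in> M i)"
    proof (rule less.hyps)
      show "card (I - J) < card I"
        using tight fin by (intro psubset_card_mono) auto
      fix K assume K: "K \<subseteq> I - J"
      have finK: "finite K" using K fin finite_subset by blast
      have "card K + card J = card (K \<union> J)"
        using K finJ finK by (subst card_Un_disjoint) auto
      also have "\<dots> \<le> card (\<Union> (N ` (K \<union> J)))" using K tight by (intro hall) auto
      also have "\<Union> (N ` (K \<union> J)) = \<Union> (M ` K) \<union> \<Union> (N ` J)" by (auto simp: M_def)
      also have "card \<dots> = card (\<Union> (M ` K)) + card (\<Union> (N ` J))"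
        using K finU[of K] finU[of J] tight
        by (intro card_Un_disjoint) (auto simp: M_def intro: finite_subset[of _ "\<Union> (N ` K)"])
      finally show "card K \<le> card (\<Union> (M ` K))" using tight by simp
    qed (use fin in \<open>auto simp: M_def\<close>)
    then obtain g where g: "inj_on g (I - J)" "\<And>i. i \<in> I - J \<Longrightarrow> g i \<in> M i" by blast
    define h where "h i = (if i \<in> J then f i else g i)" for i
    have "inj_on h I"
    proof (rule inj_onI)
      fix i j assume ij: "i \<in> I" "j \<in> I" "h i = h j"
      have "i \<in> J \<longleftrightarrow> j \<in> J" using ij f(2)[of i] f(2)[of j] g(2)[of i] g(2)[of j]
        by (auto simp: h_def M_def split: if_splits)
      then show "i = j" using ij f(1) g(1) by (auto simp: h_def inj_on_def split: if_splits)
    qed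
    moreover have "\<forall>i\<in>I. h i \<in> N i" using f(2) g(2) by (auto simp: h_def M_def)
    ultimately show ?thesis by blast
  next
    case loose
    have "card {i} \<le> card (\<Union> (N ` {i}))" using loose by (intro hall) auto
    then have "N i \<noteq> {}" by auto
    then obtain x where x: "x \<in> N i" by blast
    define M where "M j = N j - {x}" for j
    have "\<exists>g. inj_on g (I - {i}) \<and> (\<forall>j\<in>I - {i}. g j \<in> M j)"
    proof (rule less.hyps)
      show "card (I - {i}) < card I" using loose fin by (intro psubset_card_mono) auto
      fix K assume K: "K \<subseteq> I - {i}"
      show "card K \<le> card (\<Union> (M ` K))"
      proof (cases "K = {}")
        case False
        then have "card K < card (\<Union> (N ` K))" using K loose by (intro loose(2)) auto
        also have "\<dots> \<le> card (insert x (\<Union> (M ` K)))"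
          using K finU[of K] by (intro card_mono) (auto simp: M_def)
        also have "\<dots> \<le> Suc (card (\<Union> (M ` K)))"
          by (rule card_insert_le_m1) auto
        finally show ?thesis by simp
      qed simp
    qed (use fin in \<open>auto simp: M_def\<close>)
    then obtain g where g: "inj_on g (I - {i})" "\<And>j. j \<in> I - {i} \<Longrightarrow> g j \<in> M j" by blast
    have "g j \<noteq> x" if "j \<in> I - {i}" for j using g(2)[OF that] by (auto simp: M_def)
    then have "inj_on (g(i := x)) I"
      using g(1) unfolding inj_on_def by (metis DiffI empty_iff fun_upd_apply insert_iff)
    moreover have "\<forall>j\<in>I. (g(i := x)) j \<in> N j" using g x by (auto simp: M_def)
    ultimately show ?thesis by blast
  qed
qed

section \<open>Exposing product distributions, and the single in-arcs of vertices of low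
  degree\<close>

lemma Pi_pmf_insert_first:
  assumes "finite A" "x \<notin> A"
  shows "Pi_pmf (insert x A) d p = bind_pmf (p x) (\<lambda>y. map_pmf (\<lambda>f. f(x := y)) (Pi_pmf A d p))"
  using assms by (simp add: Pi_pmf_insert' map_pmf_def)

lemma Pi_pmf_insert_last:
  assumes "finite A" "x \<notin> A"
  shows "Pi_pmf (insert x A) d p = bind_pmf (Pi_pmf A d p) (\<lambda>f. map_pmf (\<lambda>y. f(x := y)) (p x))"
  using assms by (subst Pi_pmf_insert') (auto simp: map_pmf_def intro: bind_commute_pmf)

text \<open>Here the cost \<open>b\<close> of the second stage is weighted by the probability of
  \<open>D\<close>; iterating this yields a geometric factor where the purely additive bound would
  not.\<close>

lemma prob_bind_pmf_le_indicator:
  assumes "\<And>x. x \<in> set_pmf p \<Longrightarrow> measure_pmf.prob (f x) E \<le> indicator B x + b * indicator D x" and "0 \<le> b"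
  shows "measure_pmf.prob (bind_pmf p f) E \<le> measure_pmf.prob p B + b * measure_pmf.prob p D"
proof -
  have "measure_pmf.expectation p (\<lambda>x. measure_pmf.prob (f x) E)
      \<le> measure_pmf.expectation p (\<lambda>x. indicator B x + b * indicator D x)"
    using assms
    by (intro integral_mono_AE Bochner_Integration.integrable_add integrable_mult_right
        integrable_pmf_bounded[where B=1]) (auto simp: AE_measure_pmf_iff indicator_def)
  also have "\<dots> = measure_pmf.prob p B + b * measure_pmf.prob p D"
  proof -
    have "integrable (measure_pmf p) (indicator C :: _ \<Rightarrow> real)" for C
      by (intro integrable_pmf_bounded[where B=1]) (auto simp: indicator_def)
    then show ?thesis by simp
  qed
  finally show ?thesis by (simp add: prob_bind_pmf)
qed

lemma prob_sample_1_le: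
  assumes "finite A" "A \<noteq> {}" "finite W" "W \<noteq> {}"
  shows "measure_pmf.prob (sample W 1 A) {xs. fst (hd xs) \<in> S \<or> snd (hd xs) \<in> F}
    \<le> card (A \<inter> S) / card A + card (W \<inter> F) / card W"
proof -
  define g where "g u c = measure_pmf.prob (sample W 0 (A - {u})) {xs. fst (hd ((u, c) # xs)) \<in> S \<or> snd (hd ((u, c) # xs)) \<in> F}" for u c
  have hw: "card (A \<inter> S) / card A \<le> 1" "card (W \<inter> F) / card W \<le> 1"
    using assms by (auto simp: divide_le_eq_1 card_mono card_gt_0_iff)
  have "measure_pmf.prob (sample W 1 A) {xs. fst (hd xs) \<in> S \<or> snd (hd xs) \<in> F}
      = (\<Sum>u\<in>A. (\<Sum>c\<in>W. g u c) / card W) / card A"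
    unfolding One_nat_def prob_sample_Suc[OF assms] by (simp add: g_def)
  also have "\<dots> \<le> card (A \<inter> S) / card A * 1 + (1 - card (A \<inter> S) / card A) * (card (W \<inter> F) / card W)"
  proof (rule average_le_two_valued)
    fix u assume "u \<in> A" "u \<in> S"
    have "(\<Sum>c\<in>W. g u c) \<le> real (card W) * 1" by (intro sum_bounded_above) (simp add: g_def)
    then show "(\<Sum>c\<in>W. g u c) / card W \<le> 1" using assms by (simp add: divide_le_eq_1 card_gt_0_iff)
  next
    fix u assume "u \<in> A" "u \<notin> S"
    then have "(\<Sum>c\<in>W. g u c) / card W \<le> card (W \<inter> F) / card W * 1 + (1 - card (W \<inter> F) / card W) * 0"
      by (intro average_le_two_valued assms) (auto simp: g_def)
    then show "(\<Sum>c\<in>W. g u c) / card W \<le> card (W \<inter> F) / card W" by simp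
  qed (use assms in auto)
  also have "\<dots> \<le> card (A \<inter> S) / card A * 1 + 1 * (card (W \<inter> F) / card W)"
    using hw by (intro add_mono mult_right_mono) auto
  finally show ?thesis by simp
qed

text \<open>The vertices of \<open>S\<close> are exposed one at a time. A new arc is bad only if its
  tail lies in \<open>S\<close> or its colour is one of the fewer than \<open>card S\<close> colours
  seen so far. Tails outside \<open>S\<close> later rule out cycles among these forced arcs.\<close>

lemma prob_single_arcs_clash_le:
  fixes S V :: "'v set" and W :: "'c set"
  assumes V: "finite V" "S \<subseteq> V" "2 \<le> card V" and W: "finite W" "W \<noteq> {}" and "S' \<subseteq> S"
  shows "measure_pmf.prob (Pi_pmf S' [] (\<lambda>v. sample W 1 (V - {v})))
      {f. \<not> ((\<forall>v\<in>S'. fst (hd (f v)) \<notin> S) \<and> inj_on (\<lambda>v. snd (hd (f v))) S')}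
    \<le> card S' * (card S / (card V - 1) + card S / card W)"
proof -
  have "finite S" using V finite_subset by blast
  then have "finite S'" using assms finite_subset by blast
  then show ?thesis using \<open>S' \<subseteq> S\<close>
  proof (induction S')
    case (insert v S')
    define G where "G S' f \<longleftrightarrow> (\<forall>v\<in>S'. fst (hd (f v)) \<notin> S) \<and> inj_on (\<lambda>v. snd (hd (f v))) S'"
      for S' and f :: "'v \<Rightarrow> ('v \<times> 'c) list"
    let ?p = "\<lambda>v. sample W 1 (V - {v})" and ?b = "card S / (card V - 1) + card S / card W"
    have ne: "V - {v} \<noteq> {}"
    proof
      assume "V - {v} = {}"
      then have "card V \<le> card {v}" by (intro card_mono) auto
      then show False using V by simp
    qed
    have cV: "card (V - {v}) = card V - 1" using insert V by auto
    have "measure_pmf.prob (bind_pmf (Pi_pmf S' [] ?p) (\<lambda>f. map_pmf (\<lambda>y. f(v := y)) (?p v))) {f. \<not> G (insert v S') f}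
      \<le> card S' * ?b + ?b"
    proof (rule prob_bind_pmf_le_add)
      show "measure_pmf.prob (Pi_pmf S' [] ?p) {f. \<not> G S' f} \<le> card S' * ?b"
        using insert by (simp add: G_def)
      fix f assume "f \<notin> {f. \<not> G S' f}"
      then have G: "G S' f" by simp
      define F where "F = (\<lambda>v. snd (hd (f v))) ` S'"
      have sub: "{y. \<not> G (insert v S') (f(v := y))} \<subseteq> {y. fst (hd y) \<in> S \<or> snd (hd y) \<in> F}"
      proof
        fix y assume y: "y \<in> {y. \<not> G (insert v S') (f(v := y))}"
        show "y \<in> {y. fst (hd y) \<in> S \<or> snd (hd y) \<in> F}"
        proof (rule ccontr)
          assume n: "y \<notin> {y. fst (hd y) \<in> S \<or> snd (hd y) \<in> F}"
          let ?h = "\<lambda>w. snd (hd ((f(v := y)) w))"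
          have eq: "?h w = snd (hd (f w))" if "w \<in> S'" for w using that insert.hyps by auto
          have "inj_on ?h S'" using G eq unfolding G_def inj_on_def by simp
          moreover have "?h v \<notin> ?h ` (S' - {v})"
            using n eq unfolding F_def by force
          ultimately have "inj_on ?h (insert v S')" unfolding inj_on_insert by blast
          then have "G (insert v S') (f(v := y))" using G n by (simp add: G_def)
          then show False using y by simp
        qed
      qed
      have "measure_pmf.prob (map_pmf (\<lambda>y. f(v := y)) (?p v)) {f. \<not> G (insert v S') f}
          \<le> measure_pmf.prob (?p v) {y. fst (hd y) \<in> S \<or> snd (hd y) \<in> F}"
        using sub by (auto simp: vimage_def intro!: measure_pmf.finite_measure_mono)
      also have "\<dots> \<le> card ((V - {v}) \<inter> S) / card (V - {v}) + card (W \<inter> F) / card W"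
        using V W ne by (intro prob_sample_1_le) auto
      also have "\<dots> \<le> ?b"
      proof (intro add_mono)
        show "card ((V - {v}) \<inter> S) / card (V - {v}) \<le> card S / (card V - 1)"
          unfolding cV using \<open>finite S\<close> V by (auto intro!: divide_right_mono card_mono simp: of_nat_diff)
        have "card (W \<inter> F) \<le> card F" using insert by (intro card_mono) (auto simp: F_def)
        also have "\<dots> \<le> card S'" unfolding F_def using insert by (intro card_image_le) auto
        also have "\<dots> \<le> card S" using insert \<open>finite S\<close> by (intro card_mono) auto
        finally show "card (W \<inter> F) / card W \<le> card S / card W" by (intro divide_right_mono) auto
      qed
      finally show "measure_pmf.prob (map_pmf (\<lambda>y. f(v := y)) (?p v)) {f. \<not> G (insert v S') f} \<le> ?b" .
    qed (use V in auto)
    then show ?case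
      using insert by (simp add: Pi_pmf_insert_last G_def algebra_simps add_divide_distrib)
  qed simp
qed

section \<open>A rainbow path starting at the root\<close>

text \<open>The list runs backwards: its last vertex has an in-arc from \<open>z\<close>, and each colour belongs to the
  arc entering the vertex it is paired with.\<close>

fun chain :: "('v \<Rightarrow> ('v \<times> 'c) list) \<Rightarrow> 'v \<Rightarrow> ('v \<times> 'c) list \<Rightarrow> bool" where
  "chain X z [] \<longleftrightarrow> True"
| "chain X z (p # ps) \<longleftrightarrow> ((if ps = [] then z else fst (hd ps)), snd p) \<in> set (X (fst p)) \<and> chain X z ps"

lemma chain_cong: "(\<And>v. v \<in> fst ` set ps \<Longrightarrow> X v = X' v) \<Longrightarrow> chain X z ps \<longleftrightarrow> chain X' z ps"
  by (induction ps) auto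

text \<open>\<open>y\<close> is the end far from \<open>z\<close>, \<open>A\<close> the vertices
  still unexplored and \<open>F\<close> the forbidden colours. The two counters describe the search:
  \<open>i\<close> steps are compulsory, then up to \<open>j\<close> vertices are tested for an
  in-arc from \<open>z\<close>.\<close>

definition rainbow_path where
  "rainbow_path X z A F y i j \<longleftrightarrow> (\<exists>ps. ps \<noteq> [] \<and> fst (hd ps) = y \<and> distinct (map fst ps) \<and> fst ` set ps \<subseteq> A
     \<and> distinct (map snd ps) \<and> snd ` set ps \<inter> F = {} \<and> chain X z ps \<and> i < length ps \<and> length ps \<le> i + j)"

text \<open>One more vertex can be booked as a compulsory step or as a failed test, hence the
  conjunction.\<close>

lemma rainbow_path_step:
  assumes "(u, c) \<in> set x" "u \<in> A - {y}" "c \<notin> F" "y \<in> A"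
    and "rainbow_path f z (A - {y}) (insert c F) u i j"
  shows "rainbow_path (f(y := x)) z A F y (Suc i) j \<and> rainbow_path (f(y := x)) z A F y i (Suc j)"
proof -
  obtain ps where ps: "ps \<noteq> []" "fst (hd ps) = u" "distinct (map fst ps)" "fst ` set ps \<subseteq> A - {y}"
     "distinct (map snd ps)" "snd ` set ps \<inter> insert c F = {}" "chain f z ps" "i < length ps" "length ps \<le> i + j"
    using assms(5) unfolding rainbow_path_def by blast
  have "chain (f(y := x)) z ps \<longleftrightarrow> chain f z ps"
    using ps by (intro chain_cong) auto
  then have "chain (f(y := x)) z ((y, c) # ps)" using ps assms by simp
  then show ?thesis
    unfolding rainbow_path_def using ps assms
    by (intro conjI exI[of _ "(y, c) # ps"]) auto
qed

text \<open>Only the list of the current vertex \<open>y\<close> is exposed at each step, so the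
  lists on \<open>A - {y}\<close> stay independent and the induction continues from the new vertex.
  At least \<open>\<alpha>\<close> vertices remain and at most \<open>\<gamma>\<close> colours are
  forbidden throughout, so one \<open>\<eta>\<close> bounds every dead end; the \<open>j\<close>
  tests for \<open>z\<close> multiply.\<close>

lemma prob_no_rainbow_path_le:
  fixes p :: "'v \<Rightarrow> ('v \<times> 'c) list pmf" and \<eta> \<pi> :: real
  assumes "finite A" "y \<in> A" "\<alpha> + i + j \<le> card A" "finite F" "card F + i + j \<le> \<gamma>"
    and fresh: "\<And>y U F. y \<in> A \<Longrightarrow> U \<subseteq> A \<Longrightarrow> \<alpha> \<le> card U \<Longrightarrow> finite F \<Longrightarrow> card F \<le> \<gamma> \<Longrightarrow>
      measure_pmf.prob (p y) {xs. set xs \<inter> U \<times> (-F) = {}} \<le> \<eta>"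
    and root: "\<And>y F. y \<in> A \<Longrightarrow> finite F \<Longrightarrow> card F \<le> \<gamma> \<Longrightarrow>
      measure_pmf.prob (p y) {xs. set xs \<inter> {z} \<times> (-F) = {}} \<le> 1 - \<pi>"
    and "0 \<le> \<eta>" "0 \<le> \<pi>" "\<pi> \<le> 1"
  shows "measure_pmf.prob (Pi_pmf A [] p) {f. \<not> rainbow_path f z A F y i j} \<le> real (i + j) * \<eta> + (1 - \<pi>) ^ j"
  using assms
proof (induction "i + j" arbitrary: i j A F y)
  case 0
  then show ?case by simp
next
  case (Suc n)
  note pre = Suc.prems(1-5,8-10) and fresh = Suc.prems(6) and root = Suc.prems(7) and n = Suc.hyps(2)
  have cA: "card (A - {y}) = card A - 1" "0 < card A" using pre(1,2) by (auto simp: card_gt_0_iff)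
  let ?NF = "{xs. set xs \<inter> (A - {y}) \<times> (-F) = {}}" and ?NZ = "{xs. set xs \<inter> {z} \<times> (-F) = {}}"
  let ?q = "\<lambda>x. map_pmf (\<lambda>f. f(y := x)) (Pi_pmf (A - {y}) [] p)"
  have Pi: "Pi_pmf A [] p = bind_pmf (p y) ?q"
  proof -
    have "insert y (A - {y}) = A" using pre(2) by auto
    then show ?thesis using Pi_pmf_insert_first[of "A - {y}" y "[]" p] pre(1) by (metis Diff_iff finite_Diff insertI1)
  qed
  have NF: "measure_pmf.prob (p y) ?NF \<le> \<eta>"
    by (rule fresh) (use pre n cA in auto)
  have step: "measure_pmf.prob (Pi_pmf (A - {y}) [] p) {f. \<not> rainbow_path f z (A - {y}) (insert c F) u i' j'}
      \<le> real (i' + j') * \<eta> + (1 - \<pi>) ^ j'"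
    if "i' + j' = n" "u \<in> A - {y}" for i' j' u c
  proof (rule Suc.hyps(1))
    show "n = i' + j'" using that by simp
    show "\<alpha> + i' + j' \<le> card (A - {y})" using pre n cA that by simp
    show "card (insert c F) + i' + j' \<le> \<gamma>"
      using pre n that card_insert_le_m1[of "Suc (card F)" F c] by simp
    show "measure_pmf.prob (p y') {xs. set xs \<inter> U \<times> (-F') = {}} \<le> \<eta>"
      if "y' \<in> A - {y}" "U \<subseteq> A - {y}" "\<alpha> \<le> card U" "finite F'" "card F' \<le> \<gamma>" for y' U F'
      using that by (intro fresh) auto
    show "measure_pmf.prob (p y') {xs. set xs \<inter> {z} \<times> (-F') = {}} \<le> 1 - \<pi>"
      if "y' \<in> A - {y}" "finite F'" "card F' \<le> \<gamma>" for y' F'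
      using that by (intro root) auto
  qed (use pre that in auto)
  show ?case
  proof (cases i)
    case (Suc i')
    have "measure_pmf.prob (bind_pmf (p y) ?q) {f. \<not> rainbow_path f z A F y i j}
        \<le> \<eta> + (real (i' + j) * \<eta> + (1 - \<pi>) ^ j)"
    proof (rule prob_bind_pmf_le_add[OF NF])
      fix x assume "x \<notin> ?NF"
      then obtain u c where uc: "(u, c) \<in> set x" "u \<in> A - {y}" "c \<notin> F" by auto
      have "measure_pmf.prob (?q x) {f. \<not> rainbow_path f z A F y i j}
          \<le> measure_pmf.prob (Pi_pmf (A - {y}) [] p) {f. \<not> rainbow_path f z (A - {y}) (insert c F) u i' j}"
      proof -
        have "rainbow_path (f(y := x)) z A F y i j" if "rainbow_path f z (A - {y}) (insert c F) u i' j" for f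
          using rainbow_path_step[OF uc pre(2) that] Suc by simp
        then have "(\<lambda>f. f(y := x)) -` {f. \<not> rainbow_path f z A F y i j}
            \<subseteq> {f. \<not> rainbow_path f z (A - {y}) (insert c F) u i' j}" by auto
        then show ?thesis by (simp add: measure_pmf.finite_measure_mono)
      qed
      also have "\<dots> \<le> real (i' + j) * \<eta> + (1 - \<pi>) ^ j"
        using uc n Suc by (intro step) auto
      finally show "measure_pmf.prob (?q x) {f. \<not> rainbow_path f z A F y i j} \<le> real (i' + j) * \<eta> + (1 - \<pi>) ^ j" .
    qed (use pre in auto)
    then show ?thesis unfolding Pi Suc by (simp add: algebra_simps)
  next
    case 0
    show ?thesis
    proof (cases j)
      case (Suc j')
      define b where "b = j' * \<eta> + (1 - \<pi>) ^ j'"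
      have b: "0 \<le> b" using pre(6-8) by (simp add: b_def)
      \<comment> \<open>Both tests read the same list and need not be independent. A dead end is
        charged in full to \<open>?NF\<close>; otherwise the search goes on, with failure
        probability at most \<open>b\<close>, only when \<open>z\<close> was missed.\<close>
      have "measure_pmf.prob (bind_pmf (p y) ?q) {f. \<not> rainbow_path f z A F y i j}
          \<le> measure_pmf.prob (p y) ?NF + b * measure_pmf.prob (p y) ?NZ"
      proof (rule prob_bind_pmf_le_indicator[OF _ b])
        fix x
        show "measure_pmf.prob (?q x) {f. \<not> rainbow_path f z A F y i j} \<le> indicator ?NF x + b * indicator ?NZ x"
        proof (cases "x \<in> ?NZ")
          case False
          then obtain c where "(z, c) \<in> set x" "c \<notin> F" by auto
          then have "rainbow_path (f(y := x)) z A F y i j" for f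
            unfolding rainbow_path_def using \<open>y \<in> A\<close> 0 Suc
            by (intro exI[of _ "[(y, c)]"]) auto
          then have "measure_pmf.prob (?q x) {f. \<not> rainbow_path f z A F y i j} = 0" by simp
          then show ?thesis using mult_nonneg_nonneg[OF b indicator_pos_le] by (metis add_nonneg_nonneg indicator_pos_le)
        next
          case True
          show ?thesis
          proof (cases "x \<in> ?NF")
            case False
            then obtain u c where uc: "(u, c) \<in> set x" "u \<in> A - {y}" "c \<notin> F" by auto
            have "measure_pmf.prob (?q x) {f. \<not> rainbow_path f z A F y i j}
              \<le> measure_pmf.prob (Pi_pmf (A - {y}) [] p) {f. \<not> rainbow_path f z (A - {y}) (insert c F) u i j'}"
      proof -
        have "rainbow_path (f(y := x)) z A F y i j" if "rainbow_path f z (A - {y}) (insert c F) u i j'" for f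
          using rainbow_path_step[OF uc pre(2) that] Suc by simp
        then have "(\<lambda>f. f(y := x)) -` {f. \<not> rainbow_path f z A F y i j}
            \<subseteq> {f. \<not> rainbow_path f z (A - {y}) (insert c F) u i j'}" by auto
        then show ?thesis by (simp add: measure_pmf.finite_measure_mono)
      qed
            also have "\<dots> \<le> real (i + j') * \<eta> + (1 - \<pi>) ^ j'"
              by (rule step) (use n Suc uc in simp_all)
            finally have "measure_pmf.prob (?q x) {f. \<not> rainbow_path f z A F y i j} \<le> b"
              unfolding b_def 0 by simp
            moreover have "indicator ?NF x = (0::real)" "indicator ?NZ x = (1::real)" using False True by simp_all
            ultimately show ?thesis by simp
          next
            case NF: True
            have ind: "indicator ?NF x = (1::real)" "indicator ?NZ x = (1::real)" using NF True by simp_all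
            have "measure_pmf.prob (?q x) {f. \<not> rainbow_path f z A F y i j} \<le> 1" by (rule measure_pmf.prob_le_1)
            then show ?thesis unfolding ind using b by linarith
          qed
        qed
      qed
      also have "\<dots> \<le> \<eta> + b * (1 - \<pi>)"
      proof (intro add_mono[OF NF] mult_left_mono[OF _ b])
        show "measure_pmf.prob (p y) ?NZ \<le> 1 - \<pi>" by (rule root) (use pre(2,4,5) in simp_all)
      qed
      finally have le: "measure_pmf.prob (bind_pmf (p y) ?q) {f. \<not> rainbow_path f z A F y i j}
          \<le> \<eta> + b * (1 - \<pi>)" .
      have "b * (1 - \<pi>) \<le> j' * \<eta> + (1 - \<pi>) ^ j"
      proof -
        have "j' * \<eta> * (1 - \<pi>) \<le> j' * \<eta>"
          using pre(6-8) by (intro mult_right_le_one_le) auto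
        moreover have "b * (1 - \<pi>) = j' * \<eta> * (1 - \<pi>) + (1 - \<pi>) ^ j"
          by (simp add: b_def Suc algebra_simps)
        ultimately show ?thesis by linarith
      qed
      with le have "measure_pmf.prob (bind_pmf (p y) ?q) {f. \<not> rainbow_path f z A F y i j}
          \<le> \<eta> + (j' * \<eta> + (1 - \<pi>) ^ j)" by linarith
      moreover have "real (i + j) * \<eta> = \<eta> + j' * \<eta>" using 0 Suc by (simp add: algebra_simps)
      ultimately show ?thesis unfolding Pi by linarith
    next
      case j0: 0
      then show ?thesis using 0 n by simp
    qed
  qed
qed

section \<open>Distinct colours for the remaining vertices\<close>

lemma prob_Un_le_card:
  fixes \<epsilon> :: real
  assumes "finite I" "\<And>i. i \<in> I \<Longrightarrow> measure_pmf.prob P (E i) \<le> \<epsilon>"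
  shows "measure_pmf.prob P (\<Union>i\<in>I. E i) \<le> card I * \<epsilon>"
proof -
  have "measure_pmf.prob P (\<Union>i\<in>I. E i) \<le> (\<Sum>i\<in>I. measure_pmf.prob P (E i))"
    using assms(1) by (intro measure_pmf.finite_measure_subadditive_finite) auto
  also have "\<dots> \<le> real (card I) * \<epsilon>" using assms(2) by (rule sum_bounded_above)
  finally show ?thesis .
qed

text \<open>Markov's inequality for the number of events that occur.\<close>

lemma prob_card_gt_le:
  fixes t \<epsilon> :: real
  assumes "finite I" "\<And>i. i \<in> I \<Longrightarrow> measure_pmf.prob P (E i) \<le> \<epsilon>" "0 < t"
  shows "measure_pmf.prob P {x. t < card {i \<in> I. x \<in> E i}} \<le> card I * \<epsilon> / t"
proof -
  have ind: "integrable (measure_pmf P) (indicator B :: _ \<Rightarrow> real)" for B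
    by (intro integrable_pmf_bounded[where B=1]) (auto simp: indicator_def)
  have "t * measure_pmf.prob P {x. t < card {i \<in> I. x \<in> E i}}
      = measure_pmf.expectation P (\<lambda>x. t * indicator {x. t < card {i \<in> I. x \<in> E i}} x)" by simp
  also have "\<dots> \<le> measure_pmf.expectation P (\<lambda>x. \<Sum>i\<in>I. indicator (E i) x)"
  proof (intro integral_mono Bochner_Integration.integrable_sum integrable_mult_right ind)
    fix x
    have "(\<Sum>i\<in>I. indicator (E i) x) = real (card {i \<in> I. x \<in> E i})"
      using assms(1) by (simp add: indicator_def Int_def)
    then show "t * indicator {x. t < card {i \<in> I. x \<in> E i}} x \<le> (\<Sum>i\<in>I. indicator (E i) x)"
      by (simp add: indicator_def)
  qed
  also have "\<dots> = (\<Sum>i\<in>I. measure_pmf.prob P (E i))" by (simp add: ind)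
  also have "\<dots> \<le> real (card I) * \<epsilon>" using assms(2) by (rule sum_bounded_above)
  finally show ?thesis using assms(3) by (simp add: field_simps)
qed

lemma prob_Pi_pmf_component:
  assumes "finite A" "x \<in> A"
  shows "measure_pmf.prob (Pi_pmf A d p) {f. f x \<in> E} = measure_pmf.prob (p x) E"
proof -
  have "measure_pmf.prob (p x) E = measure_pmf.prob (map_pmf (\<lambda>f. f x) (Pi_pmf A d p)) E"
    using assms by (simp add: Pi_pmf_component)
  then show ?thesis by (simp add: vimage_def)
qed

text \<open>\<open>b v\<close> and \<open>c v\<close> are the second and the third block of in-arcs of \<open>v\<close>, \<open>T\<close> is the path, \<open>C\<close> the set
  of unused colours and \<open>R\<close> the complement of the vertices of low degree.\<close>

definition short_of where
  "short_of U T C m b = {v \<in> U. hits T C (b v) \<le> m}"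

definition available where
  "available U T R C m b c v = {x \<in> C. if v \<in> short_of U T C m b
     then \<exists>u\<in>R - short_of U T C m b. (u, x) \<in> set (c v) else \<exists>u\<in>T. (u, x) \<in> set (b v)}"

text \<open>A violation of Hall's condition in a form whose probability factorises: every vertex of
  \<open>X\<close> finds its colours inside \<open>Y\<close>, although it has more than
  \<open>m\<close> relevant hits. A vertex that is not short has them by definition in its second
  block; for a short one the clause on \<open>hits\<close> demands them in the third.\<close>

definition confined where
  "confined U T R C m X Y b c \<longleftrightarrow> (\<forall>v\<in>X. if v \<in> short_of U T C m b
     then m < hits (R - short_of U T C m b) C (c v) \<and> available U T R C m b c v \<subseteq> Y
     else available U T R C m b c v \<subseteq> Y)"

text \<open>Hall's theorem gives a set \<open>X\<close> with fewer than \<open>card X\<close>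
  available colours. Enlarging these to exactly \<open>card X - 1\<close> colours means that the
  union bound needs only one size of \<open>Y\<close> for each size of \<open>X\<close>.\<close>

lemma hall_violation_confined:
  assumes "finite U" "finite C" "card U \<le> card C"
    and "\<And>v. v \<in> short_of U T C m b \<Longrightarrow> m < hits (R - short_of U T C m b) C (c v)"
    and no: "\<nexists>col. inj_on col U \<and> (\<forall>v\<in>U. col v \<in> available U T R C m b c v)"
  shows "\<exists>x\<in>{1..card U}. \<exists>X\<in>{X. X \<subseteq> U \<and> card X = x}. \<exists>Y\<in>{Y. Y \<subseteq> C \<and> card Y = x - 1}. confined U T R C m X Y b c"
proof -
  let ?N = "available U T R C m b c"
  have sub: "?N v \<subseteq> C" for v by (auto simp: available_def)
  have "\<not> (\<forall>X. X \<subseteq> U \<longrightarrow> card X \<le> card (\<Union> (?N ` X)))"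
    using hall_marriage[of U ?N] assms sub finite_subset[OF sub \<open>finite C\<close>] by blast
  then obtain X where X: "X \<subseteq> U" "card (\<Union> (?N ` X)) < card X" by auto
  have cX: "card X \<le> card U" using X assms by (intro card_mono) auto
  have "\<Union> (?N ` X) \<subseteq> C" using sub by blast
  moreover have "card (\<Union> (?N ` X)) \<le> card X - 1" "card X - 1 \<le> card C" using X cX assms(3) by auto
  ultimately obtain Y where Y: "\<Union> (?N ` X) \<subseteq> Y" "Y \<subseteq> C" "card Y = card X - 1"
    using exists_subset_between[of "\<Union> (?N ` X)" "card X - 1" C] assms(2) by auto
  have av: "?N v \<subseteq> Y" if "v \<in> X" for v using Y(1) that by blast
  have "confined U T R C m X Y b c"
    unfolding confined_def
  proof
    fix v assume v: "v \<in> X"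
    show "if v \<in> short_of U T C m b then m < hits (R - short_of U T C m b) C (c v) \<and> ?N v \<subseteq> Y else ?N v \<subseteq> Y"
      using av[OF v] assms(4)[of v] by (cases "v \<in> short_of U T C m b") simp_all
  qed
  moreover have "card X \<in> {1..card U}" using X cX by simp
  moreover have "X \<in> {X'. X' \<subseteq> U \<and> card X' = card X}" using X by simp
  moreover have "Y \<in> {Y'. Y' \<subseteq> C \<and> card Y' = card X - 1}" using Y by simp
  ultimately show ?thesis by blast
qed

text \<open>Each vertex of \<open>X\<close> should cost \<open>r ^ Suc m\<close>, but which block
  pays for it depends on which vertices are short, and through the tails allowed in the third block
  all second blocks interact. Conditionally on \<open>b\<close> the third blocks are independent,
  and their cost is bounded by a quantity that ignores the identity of the short vertices. What
  remains is a product over \<open>v\<close> of functions of \<open>b v\<close>, whose expectation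
  factorises.\<close>

lemma prob_confined_le:
  fixes A :: "'v \<Rightarrow> 'v set" and W :: "'c set" and r :: real
  assumes "finite U" "finite W" "W \<noteq> {}" "C \<subseteq> W" "C \<noteq> {}"
    and A: "\<And>v. v \<in> U \<Longrightarrow> finite (A v)" "\<And>v. v \<in> U \<Longrightarrow> 2 * k \<le> card (A v)"
    and X: "X \<subseteq> U" and Y: "Y \<subseteq> C" and r: "r = card Y / card C"
  shows "measure_pmf.prob (bind_pmf (Pi_pmf U [] (\<lambda>v. sample W k (A v)))
      (\<lambda>b. map_pmf (Pair b) (Pi_pmf U [] (\<lambda>v. sample W k (A v - fst ` set (b v))))))
      {(b, c). confined U T R C m X Y b c} \<le> (r ^ Suc m) ^ card X"
proof -
  let ?B = "Pi_pmf U [] (\<lambda>v. sample W k (A v))"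
  let ?C = "\<lambda>b. Pi_pmf U [] (\<lambda>v. sample W k (A v - fst ` set (b v)))"
  have WC: "W \<inter> C = C" using assms by auto
  have r0: "0 \<le> r" by (simp add: r)
  define E1 where "E1 = {xs. Suc m \<le> hits T C xs \<and> set xs \<inter> T \<times> C \<subseteq> T \<times> Y}"
  define E2 where "E2 = {xs :: ('v \<times> 'c) list. hits T C xs < Suc m}"
  \<comment> \<open>\<open>g v\<close> depends on \<open>b v\<close> alone: it is 1 if the second
    block has enough hits and is confined, the price of the third block if it has too few, and 0 if
    it has enough hits but escapes \<open>Y\<close>.\<close>
  define g where "g v xs = (if v \<in> X then indicator E1 xs + r ^ Suc m * indicator E2 xs else 1 :: real)" for v :: 'v and xs
  have g0: "0 \<le> g v xs" for v xs using r0 by (auto simp: g_def)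
  have gint: "integrable (measure_pmf p) (g v)" for v p
    using r0 by (intro integrable_pmf_bounded[where B="1 + r ^ Suc m"]) (auto simp: g_def indicator_def)
  have key: "measure_pmf.prob (?C b) {c. confined U T R C m X Y b c} \<le> (\<Prod>v\<in>U. g v (b v))"
    if b: "b \<in> set_pmf ?B" for b
  proof -
    let ?F = "short_of U T C m b"
    define D where "D v = (if v \<in> X then if v \<in> ?F
        then {xs. Suc m \<le> hits (R - ?F) C xs \<and> set xs \<inter> (R - ?F) \<times> C \<subseteq> (R - ?F) \<times> Y}
        else {xs. b v \<in> E1} else UNIV)" for v
    have "{c. confined U T R C m X Y b c} \<subseteq> Pi U D"
    proof
      fix c assume "c \<in> {c. confined U T R C m X Y b c}"
      then have cf: "confined U T R C m X Y b c" by simp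
      show "c \<in> Pi U D"
      proof
        fix v assume v: "v \<in> U"
        show "c v \<in> D v"
        proof (cases "v \<in> X")
          case vX: True
          show ?thesis
          proof (cases "v \<in> ?F")
            case True
            then have "m < hits (R - ?F) C (c v)" "available U T R C m b c v \<subseteq> Y"
              using cf vX unfolding confined_def by auto
            then show ?thesis using True vX by (auto simp: D_def available_def)
          next
            case False
            then have "available U T R C m b c v \<subseteq> Y" using cf vX unfolding confined_def by auto
            then have "b v \<in> E1" using False v by (auto simp: E1_def available_def short_of_def)
            then show ?thesis using False vX by (simp add: D_def)
          qed
        qed (simp add: D_def)
      qed
    qed
    then have "measure_pmf.prob (?C b) {c. confined U T R C m X Y b c} \<le> measure_pmf.prob (?C b) (Pi U D)"
      by (intro measure_pmf.finite_measure_mono) auto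
    also have "\<dots> = (\<Prod>v\<in>U. measure_pmf.prob (sample W k (A v - fst ` set (b v))) (D v))"
      using assms(1) by (rule measure_Pi_pmf_Pi)
    also have "\<dots> \<le> (\<Prod>v\<in>U. g v (b v))"
    proof (intro prod_mono conjI)
      fix v assume v: "v \<in> U"
      show "measure_pmf.prob (sample W k (A v - fst ` set (b v))) (D v) \<le> g v (b v)"
      proof (cases "v \<in> X")
        case vX: True
        show ?thesis
        proof (cases "v \<in> ?F")
          case True
          have "b v \<in> set_pmf (sample W k (A v))"
            using b v assms(1) by (auto simp: set_Pi_pmf PiE_dflt_def)
          then have s: "fst ` set (b v) \<subseteq> A v" "card (fst ` set (b v)) \<le> k"
            using sample_fst[OF A(1)[OF v], of k "b v" W] A(2)[OF v] by auto
          have "k \<le> card (A v - fst ` set (b v))"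
            using s A(2)[OF v] by (subst card_Diff_subset) auto
          \<comment> \<open>The bound \<open>r ^ Suc m\<close> is the same for every set of tails,
            so it does not matter that \<open>R - ?F\<close> is determined by
            \<open>b\<close>.\<close>
          then have "measure_pmf.prob (sample W k (A v - fst ` set (b v))) (D v)
              + r ^ Suc m * measure_pmf.prob (sample W k (A v - fst ` set (b v))) {xs. hits (R - ?F) C xs < Suc m} \<le> r ^ Suc m"
            using True vX A(1)[OF v] assms(2-5) Y r WC unfolding D_def
            by (simp only: if_True) (intro prob_hit_colours_le; simp add: WC)
          moreover have "0 \<le> r ^ Suc m * measure_pmf.prob (sample W k (A v - fst ` set (b v))) {xs. hits (R - ?F) C xs < Suc m}"
            using r0 by simp
          ultimately have "measure_pmf.prob (sample W k (A v - fst ` set (b v))) (D v) \<le> r ^ Suc m" by linarith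
          moreover have "b v \<in> E2" "b v \<notin> E1" using True by (auto simp: short_of_def E1_def E2_def)
          ultimately show ?thesis using vX by (simp add: g_def)
        next
          case False
          then have "b v \<notin> E2" using v by (auto simp: short_of_def E2_def)
          then show ?thesis using False vX by (auto simp: g_def D_def)
        qed
      qed (simp add: g_def)
    qed simp
    finally show ?thesis .
  qed
  have "measure_pmf.prob (bind_pmf ?B (\<lambda>b. map_pmf (Pair b) (?C b))) {(b, c). confined U T R C m X Y b c}
      = measure_pmf.expectation ?B (\<lambda>b. measure_pmf.prob (?C b) {c. confined U T R C m X Y b c})"
    by (simp add: prob_bind_pmf vimage_def)
  also have "\<dots> \<le> measure_pmf.expectation ?B (\<lambda>b. \<Prod>v\<in>U. g v (b v))"
    by (intro integral_mono_AE integrable_pmf_bounded[where B=1] integrable_prod_Pi_pmf assms(1) gint)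
      (auto simp: AE_measure_pmf_iff key)
  also have "\<dots> = (\<Prod>v\<in>U. measure_pmf.expectation (sample W k (A v)) (g v))"
    using assms(1) gint g0 by (intro expectation_prod_Pi_pmf) auto
  also have "\<dots> \<le> (\<Prod>v\<in>U. if v \<in> X then r ^ Suc m else 1)"
  proof (intro prod_mono conjI)
    fix v assume v: "v \<in> U"
    show "0 \<le> measure_pmf.expectation (sample W k (A v)) (g v)" by (intro integral_nonneg_AE) (simp add: g0)
    have ind: "integrable (measure_pmf p) (indicator B :: _ \<Rightarrow> real)" for B and p :: "('v \<times> 'c) list pmf"
      by (intro integrable_pmf_bounded[where B=1]) (auto simp: indicator_def)
    have "measure_pmf.expectation (sample W k (A v)) (g v)
        = measure_pmf.prob (sample W k (A v)) E1 + r ^ Suc m * measure_pmf.prob (sample W k (A v)) E2" if "v \<in> X"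
      using that by (simp add: g_def[abs_def] ind)
    moreover have "measure_pmf.prob (sample W k (A v)) E1 + r ^ Suc m * measure_pmf.prob (sample W k (A v)) E2 \<le> r ^ Suc m"
      unfolding E1_def E2_def using A[OF v] assms(2-5) Y r
      by (intro prob_hit_colours_le) (simp_all add: WC)
    moreover have "measure_pmf.expectation (sample W k (A v)) (g v) = 1" if "v \<notin> X"
      using that by (simp add: g_def[abs_def])
    ultimately show "measure_pmf.expectation (sample W k (A v)) (g v) \<le> (if v \<in> X then r ^ Suc m else 1)" by auto
  qed
  also have "\<dots> = (\<Prod>v\<in>U \<inter> X. r ^ Suc m)" using assms(1) by (simp only: prod.inter_restrict)
  also have "\<dots> = (r ^ Suc m) ^ card X" using X by (simp add: inf.absorb2)
  finally show ?thesis .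
qed

text \<open>Three ways to fail: more than \<open>t\<close> vertices are short, by Markov's
  inequality; few are short, but one of them has too few hits in its third block; or Hall's
  condition is violated although all hits are there. The bound \<open>\<epsilon>2\<close> has to
  hold for every admissible set \<open>F\<close> of short vertices, because that set is known only
  after the second blocks.\<close>

lemma prob_no_assignment_le:
  fixes A :: "'v \<Rightarrow> 'v set" and W :: "'c set" and \<epsilon>1 \<epsilon>2 t :: real
  assumes fin: "finite U" "finite W" "W \<noteq> {}" "C \<subseteq> W" "C \<noteq> {}" "card U \<le> card C"
    and A: "\<And>v. v \<in> U \<Longrightarrow> finite (A v)" "\<And>v. v \<in> U \<Longrightarrow> 2 * k \<le> card (A v)"
    and e1: "\<And>v. v \<in> U \<Longrightarrow> measure_pmf.prob (sample W k (A v)) {xs. hits T C xs \<le> m} \<le> \<epsilon>1"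
    and e2: "\<And>v xs F. v \<in> U \<Longrightarrow> xs \<in> set_pmf (sample W k (A v)) \<Longrightarrow> F \<subseteq> U \<Longrightarrow> card F \<le> t \<Longrightarrow>
      measure_pmf.prob (sample W k (A v - fst ` set xs)) {xs. hits (R - F) C xs \<le> m} \<le> \<epsilon>2"
    and "0 < t" "0 \<le> \<epsilon>2"
  shows "measure_pmf.prob (bind_pmf (Pi_pmf U [] (\<lambda>v. sample W k (A v)))
      (\<lambda>b. map_pmf (Pair b) (Pi_pmf U [] (\<lambda>v. sample W k (A v - fst ` set (b v))))))
      {(b, c). \<nexists>col. inj_on col U \<and> (\<forall>v\<in>U. col v \<in> available U T R C m b c v)}
    \<le> card U * \<epsilon>1 / t + card U * \<epsilon>2 + (\<Sum>x=1..card U. real (card U choose x) * real (card C choose (x - 1))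
        * ((real (x - 1) / card C) ^ Suc m) ^ x)"
proof -
  let ?B = "Pi_pmf U [] (\<lambda>v. sample W k (A v))"
  let ?C = "\<lambda>b. Pi_pmf U [] (\<lambda>v. sample W k (A v - fst ` set (b v)))"
  let ?P = "bind_pmf ?B (\<lambda>b. map_pmf (Pair b) (?C b))"
  let ?short = "short_of U T C m"
  define weak where "weak = {(b, c). \<exists>v\<in>?short b. hits (R - ?short b) C (c v) \<le> m}"
  define conf where "conf = (\<Union>x\<in>{1..card U}. \<Union>Z\<in>{X. X \<subseteq> U \<and> card X = x} \<times> {Y. Y \<subseteq> C \<and> card Y = x - 1}.
     {(b, c). confined U T R C m (fst Z) (snd Z) b c})"
  have finC: "finite C" using fin finite_subset by blast
  have "{(b, c). \<nexists>col. inj_on col U \<and> (\<forall>v\<in>U. col v \<in> available U T R C m b c v)} \<subseteq> weak \<union> conf"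
  proof clarify
    fix b c assume n: "(b, c) \<notin> conf" "\<nexists>col. inj_on col U \<and> (\<forall>v\<in>U. col v \<in> available U T R C m b c v)"
    show "(b, c) \<in> weak"
    proof (rule ccontr)
      assume "(b, c) \<notin> weak"
      then have "m < hits (R - ?short b) C (c v)" if "v \<in> ?short b" for v
        using that by (auto simp: weak_def not_le)
      from hall_violation_confined[OF fin(1) finC fin(6) this n(2)] n(1) show False
        by (force simp: conf_def)
    qed
  qed
  then have "measure_pmf.prob ?P {(b, c). \<nexists>col. inj_on col U \<and> (\<forall>v\<in>U. col v \<in> available U T R C m b c v)}
      \<le> measure_pmf.prob ?P (weak \<union> conf)"
    by (intro measure_pmf.finite_measure_mono) auto
  also have "\<dots> \<le> measure_pmf.prob ?P weak + measure_pmf.prob ?P conf"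
    by (intro measure_Un_le) auto
  finally have split: "measure_pmf.prob ?P {(b, c). \<nexists>col. inj_on col U \<and> (\<forall>v\<in>U. col v \<in> available U T R C m b c v)}
      \<le> measure_pmf.prob ?P weak + measure_pmf.prob ?P conf" .
  have "measure_pmf.prob ?P weak \<le> card U * \<epsilon>1 / t + card U * \<epsilon>2"
  proof (rule prob_bind_pmf_le_add)
    have "measure_pmf.prob ?B {b. t < card {v \<in> U. b \<in> {b. b v \<in> {xs. hits T C xs \<le> m}}}} \<le> card U * \<epsilon>1 / t"
      using fin(1) assms(11)
    proof (intro prob_card_gt_le)
      fix v assume "v \<in> U"
      then show "measure_pmf.prob ?B {b. b v \<in> {xs. hits T C xs \<le> m}} \<le> \<epsilon>1"
        using fin(1) e1 by (subst prob_Pi_pmf_component) auto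
    qed
    then show "measure_pmf.prob ?B {b. t < card (?short b)} \<le> card U * \<epsilon>1 / t"
      by (simp add: short_of_def)
    fix b assume b: "b \<in> set_pmf ?B" "b \<notin> {b. t < card (?short b)}"
    have "measure_pmf.prob (map_pmf (Pair b) (?C b)) weak
        \<le> measure_pmf.prob (?C b) (\<Union>v\<in>U. {c. c v \<in> {xs. hits (R - ?short b) C xs \<le> m}})"
      by (auto simp: weak_def short_of_def vimage_def intro!: measure_pmf.finite_measure_mono)
    also have "\<dots> \<le> card U * \<epsilon>2"
    proof (intro prob_Un_le_card fin(1))
      fix v assume v: "v \<in> U"
      have "b v \<in> set_pmf (sample W k (A v))"
        using b v fin(1) by (auto simp: set_Pi_pmf PiE_dflt_def)
      then have "measure_pmf.prob (sample W k (A v - fst ` set (b v))) {xs. hits (R - ?short b) C xs \<le> m} \<le> \<epsilon>2"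
        using v b by (intro e2) (auto simp: short_of_def)
      then show "measure_pmf.prob (?C b) {c. c v \<in> {xs. hits (R - ?short b) C xs \<le> m}} \<le> \<epsilon>2"
        using v fin(1) by (subst prob_Pi_pmf_component) auto
    qed
    finally show "measure_pmf.prob (map_pmf (Pair b) (?C b)) weak \<le> card U * \<epsilon>2" .
  qed (use assms in simp)
  moreover have "measure_pmf.prob ?P conf \<le> (\<Sum>x=1..card U. real (card U choose x) * real (card C choose (x - 1))
        * ((real (x - 1) / card C) ^ Suc m) ^ x)"
  proof -
    let ?Q = "\<lambda>x. {X. X \<subseteq> U \<and> card X = x} \<times> {Y. Y \<subseteq> C \<and> card Y = x - 1}"
    have "measure_pmf.prob ?P conf \<le> (\<Sum>x=1..card U. measure_pmf.prob ?P
        (\<Union>Z\<in>?Q x. {(b, c). confined U T R C m (fst Z) (snd Z) b c}))"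
      unfolding conf_def by (intro measure_pmf.finite_measure_subadditive_finite) auto
    also have "\<dots> \<le> (\<Sum>x=1..card U. real (card (?Q x)) * ((real (x - 1) / card C) ^ Suc m) ^ x)"
    proof (intro sum_mono prob_Un_le_card)
      fix x :: nat and Z assume x: "x \<in> {1..card U}" and Z: "Z \<in> ?Q x"
      have "measure_pmf.prob ?P {(b, c). confined U T R C m (fst Z) (snd Z) b c}
          \<le> ((real (card (snd Z)) / card C) ^ Suc m) ^ card (fst Z)"
        using Z by (intro prob_confined_le fin A refl) auto
      moreover have "card (snd Z) = x - 1" "card (fst Z) = x" using Z x by auto
      ultimately show "measure_pmf.prob ?P {(b, c). confined U T R C m (fst Z) (snd Z) b c}
          \<le> ((real (x - 1) / card C) ^ Suc m) ^ x" by simp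
    qed (use fin(1) finC in auto)
    also have "\<dots> = (\<Sum>x=1..card U. real (card U choose x) * real (card C choose (x - 1))
        * ((real (x - 1) / card C) ^ Suc m) ^ x)"
      using fin(1) finC by (intro sum.cong) (auto simp: card_cartesian_product n_subsets)
    finally show ?thesis .
  qed
  ultimately show ?thesis using split by linarith
qed

section \<open>Estimating the union bound over violations of Hall's condition\<close>

lemma power_div_exp_le_fact: "(real x / exp 1) ^ x \<le> fact x"
proof -
  have "real x ^ x / fact x \<le> exp (real x)"
  proof -
    \<comment> \<open>A single term of the exponential series suffices.\<close>
    have "(\<Sum>n\<in>{x}. real x ^ n /\<^sub>R fact n) \<le> exp (real x)"
      unfolding exp_def by (intro sum_le_suminf summable_exp_generic) auto
    then show ?thesis by (simp add: divide_inverse mult.commute)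
  qed
  moreover have "exp (real x) = exp 1 ^ x" by (simp add: exp_of_nat_mult[symmetric])
  ultimately show ?thesis by (simp add: power_divide field_simps)
qed

lemma binomial_le_power_exp:
  assumes "0 < x"
  shows "real (n choose x) \<le> (exp 1 * n / x) ^ x"
proof -
  have "real (n choose x) * fact x \<le> real n ^ x"
    using binomial_fact_pow[of n x] by (metis of_nat_fact of_nat_le_iff of_nat_mult of_nat_power)
  then have "real (n choose x) \<le> real n ^ x / fact x" by (simp add: field_simps)
  also have "\<dots> \<le> real n ^ x / (real x / exp 1) ^ x"
    using assms by (intro divide_left_mono power_div_exp_le_fact mult_pos_pos) auto
  also have "\<dots> = (exp 1 * n / x) ^ x" by (simp add: power_divide power_mult_distrib field_simps)
  finally show ?thesis .
qed

text \<open>No case distinction on \<open>x\<close> is needed: with \<open>y = x - 1\<close> both binomials are at most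
  \<open>(e q / y)\<close> to the power \<open>x\<close>, and two of the \<open>Suc m\<close> factors \<open>y / q\<close> absorb them.\<close>

lemma hall_sum_le:
  fixes r :: real
  assumes "u \<le> q" "0 < q" "real u / q \<le> r" "0 \<le> r" "r \<le> 1" "1 \<le> m" and D: "exp 2 * r ^ (m - 1) \<le> \<delta>" "\<delta> \<le> 1 / 2"
  shows "(\<Sum>x=1..u. real (u choose x) * real (q choose (x - 1)) * ((real (x - 1) / q) ^ Suc m) ^ x) \<le> 2 * \<delta>"
proof -
  have d0: "0 \<le> \<delta>" using D(1) assms(4) by (meson exp_ge_zero mult_nonneg_nonneg order_trans zero_le_power)
  have "(\<Sum>x=1..u. real (u choose x) * real (q choose (x - 1)) * ((real (x - 1) / q) ^ Suc m) ^ x) \<le> (\<Sum>x=1..u. \<delta> ^ x)"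
  proof (rule sum_mono)
    fix x assume x: "x \<in> {1..u}"
    show "real (u choose x) * real (q choose (x - 1)) * ((real (x - 1) / q) ^ Suc m) ^ x \<le> \<delta> ^ x"
    proof (cases "x = 1")
      \<comment> \<open>For \<open>x = 1\<close> the set \<open>Y\<close> is empty and the term
        vanishes; in the other case \<open>y\<close> is positive and may be divided by.\<close>
      case True
      then show ?thesis using d0 by simp
    next
      case False
      define y where "y = x - 1"
      have y: "0 < y" "x = Suc y" using x False by (auto simp: y_def)
      have yq: "real y \<le> u" "y \<le> q" using x y assms(1) by auto
      define \<rho> where "\<rho> = y / q"
      have \<rho>: "0 < \<rho>" "\<rho> \<le> r" "\<rho> \<le> 1"
      proof -
        show "0 < \<rho>" using y assms by (simp add: \<rho>_def)
        have "\<rho> \<le> real u / q" unfolding \<rho>_def using yq by (intro divide_right_mono) auto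
        then show "\<rho> \<le> r" using assms by simp
        then show "\<rho> \<le> 1" using assms by simp
      qed
      have e1: "(1::real) \<le> exp 1" by simp
      have e\<rho>: "1 \<le> exp 1 / \<rho>"
        using \<rho>(1) order_trans[OF \<rho>(3) e1] by (simp add: le_divide_eq)
      have "real (u choose x) \<le> (exp 1 * u / x) ^ x" using x by (intro binomial_le_power_exp) auto
      also have "\<dots> \<le> (exp 1 * q / y) ^ x"
        using y assms(1) by (intro power_mono frac_le mult_left_mono) auto
      finally have 1: "real (u choose x) \<le> (exp 1 / \<rho>) ^ x" by (simp add: \<rho>_def)
      have "real (q choose y) \<le> (exp 1 * q / y) ^ y" using y by (intro binomial_le_power_exp) auto
      also have "\<dots> = (exp 1 / \<rho>) ^ y" by (simp add: \<rho>_def)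
      also have "\<dots> \<le> (exp 1 / \<rho>) ^ x" using e\<rho> y by (intro power_increasing) auto
      finally have 2: "real (q choose y) \<le> (exp 1 / \<rho>) ^ x" .
      have "real (u choose x) * real (q choose y) * (\<rho> ^ Suc m) ^ x
          \<le> (exp 1 / \<rho>) ^ x * (exp 1 / \<rho>) ^ x * (\<rho> ^ Suc m) ^ x"
        using 1 2 \<rho> by (intro mult_right_mono mult_mono) auto
      also have "\<dots> = (exp 1 / \<rho> * (exp 1 / \<rho>) * \<rho> ^ Suc m) ^ x" by (simp only: power_mult_distrib)
      also have "exp 1 / \<rho> * (exp 1 / \<rho>) * \<rho> ^ Suc m = exp 2 * \<rho> ^ (m - 1)"
      proof -
        obtain k where "m = Suc k" using assms(6) by (cases m) auto
        moreover have "exp 2 = exp 1 * exp (1::real)" by (simp add: exp_add[symmetric])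
        ultimately show ?thesis using \<rho>(1) by (simp add: field_simps)
      qed
      also have "(exp 2 * \<rho> ^ (m - 1)) ^ x \<le> \<delta> ^ x"
      proof (intro power_mono)
        have "exp 2 * \<rho> ^ (m - 1) \<le> exp 2 * r ^ (m - 1)"
          using \<rho> by (intro mult_left_mono power_mono) auto
        then show "exp 2 * \<rho> ^ (m - 1) \<le> \<delta>" using D(1) by (rule order_trans)
      qed (use \<rho> in auto)
      finally have "real (u choose x) * real (q choose y) * (\<rho> ^ Suc m) ^ x \<le> \<delta> ^ x" .
      then show ?thesis unfolding y_def[symmetric] \<rho>_def .
    qed
  qed
  also have "\<dots> = \<delta> * (\<Sum>x<u. \<delta> ^ x)"
    by (simp add: sum_distrib_left sum.atLeast1_atMost_eq)
  also have "\<dots> \<le> 2 * \<delta>"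
  proof -
    have "(\<Sum>x<u. \<delta> ^ x) \<le> (\<Sum>x<u. (1 / 2) ^ x)" using d0 D by (intro sum_mono power_mono) auto
    also have "\<dots> = 2 * (1 - (1 / 2) ^ u)" by (simp add: sum_gp_strict)
    also have "\<dots> \<le> (2 :: real)" by simp
    finally show ?thesis using mult_left_mono[OF _ d0] by (simp add: mult.commute[of 2])
  qed
  finally show ?thesis .
qed

section \<open>Choosing a rainbow set of in-arcs\<close>

text \<open>The strictly decreasing \<open>rk\<close> certifies acyclicity without mentioning paths,
  which is the form that \<open>arborescence_of_parents\<close> accepts. \<open>X v\<close> lists
  the tails and colours of the in-arcs of \<open>v\<close> that may be used.\<close>

definition rainbow_choice where
  "rainbow_choice V z X \<longleftrightarrow> (\<exists>par col rk. inj_on col (V - {z}) \<and>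
     (\<forall>v\<in>V - {z}. (par v, col v) \<in> set (X v) \<and> (rk (par v) :: nat) < rk v))"

text \<open>The rank is the distance from \<open>z\<close> along the path. Its bound by
  \<open>length ps\<close> leaves room to rank all other vertices above the path.\<close>

lemma chain_parents:
  assumes "chain X z ps" "distinct (map fst ps)" "z \<notin> fst ` set ps"
  shows "\<exists>par rk. rk z = (0::nat) \<and> (\<forall>v c. (v, c) \<in> set ps \<longrightarrow> (par v, c) \<in> set (X v) \<and> rk (par v) < rk v
    \<and> rk v \<le> length ps \<and> par v \<in> insert z (fst ` set ps))"
  using assms
proof (induction ps)
  case (Cons p ps)
  have "chain X z ps" "distinct (map fst ps)" "z \<notin> fst ` set ps" using Cons.prems by auto
  from Cons.IH[OF this] obtain par rk where IH: "rk z = (0::nat)" "\<And>v c. (v, c) \<in> set ps \<Longrightarrow> (par v, c) \<in> set (X v) \<and> rk (par v) < rk v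
    \<and> rk v \<le> length ps \<and> par v \<in> insert z (fst ` set ps)"
    by blast
  obtain v c where p: "p = (v, c)" by (cases p)
  define u where "u = (if ps = [] then z else fst (hd ps))"
  have u: "u \<in> insert z (fst ` set ps)" by (auto simp: u_def)
  have nv: "v \<notin> fst ` set ps" "v \<noteq> z" using Cons.prems p by auto
  have arc: "(u, c) \<in> set (X v)" using Cons.prems p by (auto simp: u_def)
  have rku: "rk u \<le> length ps" using u IH by auto
  show ?case
  proof (intro exI conjI allI impI)
    show "(rk(v := Suc (length ps))) z = 0" using nv IH by simp
    fix w d assume e: "(w, d) \<in> set (p # ps)"
    have "((par(v := u)) w, d) \<in> set (X w)
      \<and> (rk(v := Suc (length ps))) ((par(v := u)) w) < (rk(v := Suc (length ps))) w
      \<and> (rk(v := Suc (length ps))) w \<le> length (p # ps)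
      \<and> (par(v := u)) w \<in> insert z (fst ` set (p # ps))"
    proof (cases "w = v")
      case True
      then have "d = c" using e p nv by force
      have "u \<noteq> v" using u nv by auto
      then show ?thesis using True arc rku u \<open>d = c\<close> by auto
    next
      case False
      then have m: "(w, d) \<in> set ps" using e p by auto
      have "par w \<noteq> v" using IH(2)[OF m] nv by auto
      then show ?thesis using IH(2)[OF m] False by auto
    qed
    then show "((par(v := u)) w, d) \<in> set (X w)"
      and "(rk(v := Suc (length ps))) ((par(v := u)) w) < (rk(v := Suc (length ps))) w"
      and "(rk(v := Suc (length ps))) w \<le> length (p # ps)"
      and "(par(v := u)) w \<in> insert z (fst ` set (p # ps))" by blast+
  qed
qed auto

text \<open>Colours are distinct within each of \<open>S\<close>, \<open>T\<close> and
  \<open>U\<close>, and the three palettes are disjoint because the path avoids the colours of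
  \<open>S\<close> and \<open>C\<close> avoids both. Acyclicity comes from a layered rank.\<close>

lemma rainbow_choice_combine:
  assumes S: "S \<subseteq> V - {z}" "\<And>v. v \<in> S \<Longrightarrow> hd (s v) \<in> set (X v) \<and> fst (hd (s v)) \<in> V - S"
      "inj_on (\<lambda>v. snd (hd (s v))) S"
    and ps: "chain X z ps" "distinct (map fst ps)" "distinct (map snd ps)" "fst ` set ps \<subseteq> V - {z} - S"
      "snd ` set ps \<inter> (\<lambda>v. snd (hd (s v))) ` S = {}"
    and T: "T = fst ` set ps" and U: "U = V - {z} - S - T"
    and C: "C \<inter> (snd ` set ps \<union> (\<lambda>v. snd (hd (s v))) ` S) = {}"
    and col: "inj_on col U" "\<And>v. v \<in> U \<Longrightarrow> col v \<in> available U T (V - S) C m b c v"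
    and bc: "\<And>v. v \<in> U \<Longrightarrow> set (b v) \<subseteq> set (X v)" "\<And>v. v \<in> U \<Longrightarrow> set (c v) \<subseteq> set (X v)"
  shows "rainbow_choice V z X"
proof -
  have zT: "z \<notin> fst ` set ps" using ps(4) by auto
  obtain tp tr where t: "tr z = (0::nat)" "\<And>v c. (v, c) \<in> set ps \<Longrightarrow> (tp v, c) \<in> set (X v) \<and> tr (tp v) < tr v
    \<and> tr v \<le> length ps \<and> tp v \<in> insert z (fst ` set ps)"
    using chain_parents[OF ps(1,2) zT] by blast
  have tcol: "\<exists>c. (v, c) \<in> set ps" if "v \<in> T" for v using that T by auto
  define tc where "tc v = (SOME c. (v, c) \<in> set ps)" for v
  have tc: "(v, tc v) \<in> set ps" if "v \<in> T" for v
    unfolding tc_def using tcol[OF that] by (rule someI_ex)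
  let ?F = "short_of U T C m b" and ?L = "length ps"
  define up where "up v = (SOME u. (u, col v) \<in> set (X v) \<and> (if v \<in> ?F then u \<in> V - S - ?F else u \<in> T))" for v
  have up: "(up v, col v) \<in> set (X v) \<and> (if v \<in> ?F then up v \<in> V - S - ?F else up v \<in> T)" if v: "v \<in> U" for v
    unfolding up_def
  proof (rule someI_ex)
    show "\<exists>u. (u, col v) \<in> set (X v) \<and> (if v \<in> ?F then u \<in> V - S - ?F else u \<in> T)"
      using col(2)[OF v] bc[OF v] unfolding available_def by (cases "v \<in> ?F") (simp_all, blast+)
  qed
  have colC: "col v \<in> C" if "v \<in> U" for v using col(2)[OF that] by (simp add: available_def)
  define par where "par v = (if v \<in> S then fst (hd (s v)) else if v \<in> T then tp v else up v)" for v
  define cl where "cl v = (if v \<in> S then snd (hd (s v)) else if v \<in> T then tc v else col v)" for v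
  \<comment> \<open>Every layer takes its tails strictly below: the path from itself and
    \<open>z\<close>, the other vertices of \<open>U\<close> from the path, short ones from anything
    that is neither short nor in \<open>S\<close>, and \<open>S\<close> from anything outside
    \<open>S\<close>.\<close>
  define rk where "rk v = (if v = z then 0 else if v \<in> S then ?L + 3 else if v \<in> T then tr v
      else if v \<in> ?F then ?L + 2 else ?L + 1)" for v
  have FU: "?F \<subseteq> U" by (auto simp: short_of_def)
  have part: "v \<in> S \<or> v \<in> T \<or> v \<in> U" if "v \<in> V - {z}" for v using that U by auto
  have TS: "T \<inter> S = {}" "T \<subseteq> V - {z}" "U \<inter> S = {}" "U \<inter> T = {}" "z \<notin> S" "z \<notin> T" "z \<notin> U"
    using ps(4) S(1) T U by auto
  have trL: "tr v \<le> ?L" if "v \<in> T" for v using t(2)[OF tc[OF that]] by simp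
  have rkV: "rk v \<le> ?L + 2" if "v \<notin> S" for v
    using that trL[of v] by (auto simp: rk_def)
  have main: "(par v, cl v) \<in> set (X v) \<and> rk (par v) < rk v" if v: "v \<in> V - {z}" for v
  proof -
    consider "v \<in> S" | "v \<in> T" | "v \<in> U" using part[OF v] by blast
    then show ?thesis
    proof cases
      case 1
      then have "par v \<notin> S" "rk v = ?L + 3" using S(2)[OF 1] v by (auto simp: par_def rk_def)
      then show ?thesis using rkV[of "par v"] 1 S(2)[OF 1] by (simp add: par_def cl_def)
    next
      case 2
      then have nS: "v \<notin> S" using TS by blast
      have "tp v = z \<or> tp v \<in> T" using t(2)[OF tc[OF 2]] T by auto
      then have "rk (tp v) = tr (tp v)" using t(1) TS by (auto simp: rk_def)
      moreover have "rk v = tr v" using 2 nS v by (simp add: rk_def)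
      ultimately show ?thesis using t(2)[OF tc[OF 2]] 2 nS by (simp add: par_def cl_def)
    next
      case 3
      then have n: "v \<notin> S" "v \<notin> T" using TS by blast+
      have u: "(up v, col v) \<in> set (X v)" "if v \<in> ?F then up v \<in> V - S - ?F else up v \<in> T" using up[OF 3] by auto
      have "rk (up v) < rk v"
      proof (cases "v \<in> ?F")
        case True
        then have "up v \<notin> S" "up v \<notin> ?F" using u by auto
        then have "rk (up v) \<le> ?L + 1" using trL[of "up v"] by (auto simp: rk_def)
        then show ?thesis using True n v by (simp add: rk_def)
      next
        case False
        then have uT: "up v \<in> T" using u by auto
        then have "up v \<noteq> z" "up v \<notin> S" using TS by auto
        then have "rk (up v) \<le> ?L" using trL[OF uT] uT by (simp add: rk_def)
        then show ?thesis using False n v by (simp add: rk_def)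
      qed
      then show ?thesis using u n by (simp add: par_def cl_def)
    qed
  qed
  have "inj_on cl (V - {z})"
  proof (rule inj_onI)
    fix v w assume vw: "v \<in> V - {z}" "w \<in> V - {z}" "cl v = cl w"
    have clS: "cl x \<in> (\<lambda>v. snd (hd (s v))) ` S" if "x \<in> S" for x using that by (auto simp: cl_def)
    have clT: "cl x \<in> snd ` set ps" if "x \<in> T" for x
    proof -
      have "cl x = tc x" using that TS(1) by (auto simp: cl_def)
      then show ?thesis using imageI[OF tc[OF that], of snd] by simp
    qed
    have clU: "cl x \<in> C" if "x \<in> U" for x
    proof -
      have "x \<notin> S" "x \<notin> T" using that TS by auto
      then show ?thesis using colC[OF that] by (simp add: cl_def)
    qed
    have same: "v \<in> S \<and> w \<in> S \<or> v \<in> T \<and> w \<in> T \<or> v \<in> U \<and> w \<in> U"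
    proof -
      have ST: "\<not> (x \<in> S \<and> y \<in> T)" if "cl x = cl y" for x y
        using clS[of x] clT[of y] that ps(5) by auto
      have SU: "\<not> (x \<in> S \<and> y \<in> U)" if "cl x = cl y" for x y
        using clS[of x] clU[of y] that C by auto
      have TU: "\<not> (x \<in> T \<and> y \<in> U)" if "cl x = cl y" for x y
        using clT[of x] clU[of y] that C by auto
      show ?thesis
        using part[OF vw(1)] part[OF vw(2)] ST[OF vw(3)] SU[OF vw(3)] TU[OF vw(3)]
          ST[OF vw(3)[symmetric]] SU[OF vw(3)[symmetric]] TU[OF vw(3)[symmetric]] by blast
    qed
    have "inj_on cl S" using S(3) by (simp add: inj_on_def cl_def)
    moreover have "inj_on cl T"
    proof (rule inj_onI)
      fix v w assume vw: "v \<in> T" "w \<in> T" "cl v = cl w"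
      then have "v \<notin> S" "w \<notin> S" using TS by auto
      then have "tc v = tc w" using vw by (simp add: cl_def)
      then have "(v, tc v) \<in> set ps" "(w, tc v) \<in> set ps" using tc[OF vw(1)] tc[OF vw(2)] by simp_all
      then show "v = w" using inj_onD[of snd "set ps" "(v, tc v)" "(w, tc v)"] ps(3) by (simp add: distinct_map)
    qed
    moreover have "inj_on cl U"
    proof -
      have "cl x = col x" if "x \<in> U" for x using that TS by (auto simp: cl_def)
      then show ?thesis using col(1) by (simp add: inj_on_def)
    qed
    ultimately show "v = w" using same vw(3) by (auto dest: inj_onD)
  qed
  then show ?thesis unfolding rainbow_choice_def using main by blast
qed

lemma rainbow_choice_cong:
  assumes "\<And>v. v \<in> V - {z} \<Longrightarrow> X v = X' v"
  shows "rainbow_choice V z X \<longleftrightarrow> rainbow_choice V z X'"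
  unfolding rainbow_choice_def using assms by auto

section \<open>Failure bound for a given root and a given set of low degree\<close>

lemma Pi_pmf_map_dependent:
  assumes "finite A"
  shows "Pi_pmf A d (\<lambda>x. map_pmf (h x) (q x)) = map_pmf (\<lambda>c x. if x \<in> A then h x (c x) else d) (Pi_pmf A d' q)"
  using assms by (simp add: map_pmf_def Pi_pmf_bind[where d'=d'])

text \<open>Used to forget in-lists: if replacing the lists outside \<open>B\<close> by the default
  keeps a bad outcome bad, the event can be bounded on \<open>B\<close> alone.\<close>

lemma prob_Pi_pmf_subset_le:
  assumes "finite A" "B \<subseteq> A" "\<And>f. f \<in> E \<Longrightarrow> (\<lambda>x. if x \<in> B then f x else d) \<in> E'"
  shows "measure_pmf.prob (Pi_pmf A d p) E \<le> measure_pmf.prob (Pi_pmf B d p) E'"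
  unfolding Pi_pmf_subset[OF assms(1,2)] measure_map_pmf
  by (intro measure_pmf.finite_measure_mono) (use assms(3) in auto)

lemma rainbow_choice_mono:
  assumes "rainbow_choice V z X" "\<And>v. v \<in> V - {z} \<Longrightarrow> set (X v) \<subseteq> set (X' v)"
  shows "rainbow_choice V z X'"
  using assms unfolding rainbow_choice_def by (meson subsetD)

lemma hits_eq_0_iff: "hits U C xs = 0 \<longleftrightarrow> set xs \<inter> U \<times> C = {}"
  by (auto simp: hits_def filter_empty_conv)

lemma half_le_one: "x \<le> 1 \<Longrightarrow> x / 2 \<le> (1 :: real)"
  by simp

text \<open>Converts rates measured against all \<open>n\<close> vertices and \<open>q\<close>
  colours into the hypothesis of \<open>prob_hits_le\<close>, where only \<open>N \<le> n\<close>
  tails are left.\<close>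

lemma rate_le:
  fixes a a' b b' :: real
  assumes "0 < n" "0 < q" "0 \<le> a'" "a' \<le> a" "0 \<le> b'" "b' \<le> b" "N \<le> n"
  shows "a' / real n * (b' / real q) * real N * real q \<le> a * b"
proof -
  have "a' / real n * (b' / real q) * real N * real q = a' * b' * (real N / real n)"
    using assms by simp
  also have "\<dots> \<le> a' * b' * 1"
    using assms by (intro mult_left_mono) auto
  also have "\<dots> \<le> a * b" using assms by (simp add: mult_mono)
  finally show ?thesis .
qed

text \<open>\<open>S\<close> is the set of low degree, of size at most \<open>\<sigma>\<close>, and
  the path has more than \<open>i\<close> and at most \<open>2 * i\<close> vertices.
  \<open>\<beta>\<close> bounds the colours in use as well as the vertices excluded by
  \<open>S\<close>, by the path, as the root and as the current head; the final 2 stands for the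
  last two. \<open>t\<close> bounds the number of short vertices and \<open>\<theta>\<close> is the
  Chernoff parameter for the third block.\<close>

context
  fixes V :: "'v set" and W :: "'c set" and z :: 'v and S :: "'v set" and \<sigma> n q k i m \<beta> :: nat and t \<theta> \<delta> :: real
  assumes V: "finite V" "z \<in> V" "S \<subseteq> V - {z}" "card S \<le> \<sigma>" "card V = n"
    and W: "finite W" "card W = q" "n \<le> q"
    and \<beta>: "\<beta> = \<sigma> + 2 * i + 2" "\<beta> + 3 * k + t \<le> n" "2 * k \<le> i"
    and t: "1 \<le> t" and \<theta>: "0 < \<theta>" "\<theta> \<le> 1" and m: "1 \<le> m"
    and \<delta>: "exp 2 * (real n / q) ^ (m - 1) \<le> \<delta>" "\<delta> \<le> 1 / 2"
begin

private lemma n_pos: "0 < n" "\<beta> + 3 * k + 1 \<le> n" "0 < q" "W \<noteq> {}" "finite S" "\<beta> \<le> q" "\<beta> < n"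
proof -
  have "real (\<beta> + 3 * k + 1) \<le> n" using \<beta>(2) t by simp
  then show 1: "\<beta> + 3 * k + 1 \<le> n" by linarith
  then show "0 < n" "0 < q" "W \<noteq> {}" "\<beta> \<le> q" "\<beta> < n" using W by auto
  show "finite S" using V finite_subset by blast
qed

private lemma colour_avoid:
  assumes "finite F" "card F \<le> \<beta>"
  shows "real q - \<beta> \<le> card (W \<inter> - F)"
proof -
  have "card W - card F \<le> card (W - F)" by (rule diff_card_le_card_Diff) (rule assms)
  moreover have "W \<inter> - F = W - F" by auto
  ultimately show ?thesis using W assms by simp
qed

private lemma fresh:
  assumes y: "y \<in> V" and U: "U \<subseteq> V" "n - 1 - \<sigma> - 2 * i \<le> card U" and F: "finite F" "card F \<le> \<beta>"
  shows "measure_pmf.prob (sample W k (V - {y})) {xs. set xs \<inter> U \<times> (- F) = {}}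
    \<le> (1 - (real n - \<beta> - k) / n * ((real q - \<beta>) / q)) ^ k"
proof -
  let ?\<pi> = "(real n - \<beta> - k) / n * ((real q - \<beta>) / q)"
  have cV: "card (V - {y}) = n - 1" using V y by simp
  \<comment> \<open>With \<open>\<theta> = 0\<close> and \<open>m = 0\<close>, where
    \<open>0 ^ 0 = 1\<close>, the Chernoff bound becomes the plain product bound for no hit at
    all.\<close>
  have "0 ^ 0 * measure_pmf.prob (sample W k (V - {y})) {xs. hits U (- F) xs \<le> 0} \<le> (1 - ?\<pi> * (1 - 0)) ^ k"
  proof (rule prob_hits_le)
    have "card U \<le> Suc (card ((V - {y}) \<inter> U))"
    proof -
      have "card U \<le> card (insert y ((V - {y}) \<inter> U))" using U V by (intro card_mono) auto
      also have "\<dots> \<le> Suc (card ((V - {y}) \<inter> U))" by (rule card_insert_le_m1) auto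
      finally show ?thesis .
    qed
    then have a: "real n - \<beta> - k \<le> real (card ((V - {y}) \<inter> U)) - k" using U(2) n_pos \<beta>(1) by linarith
    show "?\<pi> * card (V - {y}) * card W \<le> (real (card ((V - {y}) \<inter> U)) - k) * card (W \<inter> - F)"
      unfolding W(2) using n_pos by (intro rate_le a colour_avoid F) (auto simp: cV)
    show "0 \<le> ?\<pi>" using n_pos by simp
    show "k \<le> card (V - {y})" using cV n_pos by linarith
  qed (use V W n_pos in auto)
  then show ?thesis by (simp add: hits_eq_0_iff)
qed

private lemma root:
  assumes y: "y \<in> V" "y \<noteq> z" and F: "finite F" "card F \<le> \<beta>"
  shows "measure_pmf.prob (sample W k (V - {y})) {xs. set xs \<inter> {z} \<times> (- F) = {}}
    \<le> 1 - real k / n * ((real q - \<beta>) / q)"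
proof -
  have cV: "card (V - {y}) = n - 1" using V y by simp
  have "measure_pmf.prob (sample W k (V - {y})) {xs. set xs \<inter> {z} \<times> (- F) = {}}
     \<le> 1 - k / card (V - {y}) * (card (W \<inter> - F) / card W)"
    using V W n_pos cV y by (intro prob_miss_pair_le) auto
  also have "\<dots> \<le> 1 - real k / n * ((real q - \<beta>) / q)"
  proof (intro diff_left_mono mult_mono)
    show "real k / n \<le> k / card (V - {y})" unfolding cV
      using n_pos \<beta>(1) by (intro divide_left_mono mult_pos_pos) auto
    show "(real q - \<beta>) / q \<le> card (W \<inter> - F) / card W"
      unfolding W(2) using colour_avoid[OF F] by (intro divide_right_mono) auto
  qed (use n_pos in auto)
  finally show ?thesis .
qed

text \<open>The first block \<open>a\<close> enters only through the at most \<open>k\<close> tails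
  that it removes, so the bound holds for every outcome of the path search.\<close>

private lemma assignment:
  fixes a :: "'v \<Rightarrow> ('v \<times> 'c) list"
  assumes T: "T \<subseteq> V - {z} - S" "i \<le> card T" "card T \<le> 2 * i" and U: "U = V - {z} - S - T"
    and Y: "finite Y" "card Y \<le> card S + card T" and C: "C = W - Y"
    and a: "\<And>v. v \<in> U \<Longrightarrow> card (fst ` set (a v)) \<le> k"
  shows "measure_pmf.prob (bind_pmf (Pi_pmf U [] (\<lambda>v. sample W k (V - {v} - fst ` set (a v))))
      (\<lambda>b. map_pmf (Pair b) (Pi_pmf U [] (\<lambda>v. sample W k (V - {v} - fst ` set (a v) - fst ` set (b v))))))
      {(b, c). \<nexists>col. inj_on col U \<and> (\<forall>v\<in>U. col v \<in> available U T (V - S) C m b c v)}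
    \<le> n * (2 ^ m * (1 - (real i - 2 * k) / n * ((real q - \<beta>) / q) / 2) ^ k) / t
      + n * ((1 - (real n - \<beta> - 3 * k - t) / n * ((real q - \<beta>) / q) * (1 - \<theta>)) ^ k / \<theta> ^ m) + 2 * \<delta>"
proof -
  let ?A = "\<lambda>v. V - {v} - fst ` set (a v)"
  let ?\<pi>1 = "(real i - 2 * k) / n * ((real q - \<beta>) / q)"
  let ?\<pi>2 = "(real n - \<beta> - 3 * k - t) / n * ((real q - \<beta>) / q)"
  let ?\<epsilon>1 = "2 ^ m * (1 - ?\<pi>1 / 2) ^ k" and ?\<epsilon>2 = "(1 - ?\<pi>2 * (1 - \<theta>)) ^ k / \<theta> ^ m"
  have finU: "finite U" and UV: "U \<subseteq> V - {z}" using V U by auto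
  have finT: "finite T" using finite_subset[OF T(1)] V by simp
  have WC: "W \<inter> C = C" using C by auto
  have cY: "card Y \<le> \<beta>" using Y T V(4) \<beta>(1) by linarith
  have cC: "real q - \<beta> \<le> card C" using colour_avoid[OF Y(1) cY] C by (simp add: Diff_eq)
  have cC': "q \<le> card C + card S + card T"
    using diff_card_le_card_Diff[OF Y(1), of W] Y(2) W(2) unfolding C by linarith
  have cU: "card U + card S + card T + 1 = n"
  proof -
    have "card (V - {z}) = card (U \<union> S \<union> T)" using U T V(3) by (intro arg_cong[where f=card]) auto
    also have "\<dots> = card U + card S + card T"
      using U T finU finT n_pos(5) by (subst card_Un_disjoint; (subst card_Un_disjoint)?) auto
    finally show ?thesis using V n_pos by simp
  qed
  have cUn: "card U \<le> n" using cU by simp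
  have cApos: "card (?A v) + k + 1 \<ge> n" if "v \<in> U" for v
  proof -
    have "card (V - {v}) - card (fst ` set (a v)) \<le> card (?A v)" by (rule diff_card_le_card_Diff) auto
    then show ?thesis using a[OF that] that UV V by auto
  qed
  have cAn: "card (?A v - B) \<le> n" for v B
    using V by (metis Diff_subset card_mono order_trans)
  have \<pi>0: "0 \<le> ?\<pi>1" "0 \<le> ?\<pi>2" using n_pos \<beta> by (auto intro!: mult_nonneg_nonneg divide_nonneg_nonneg)
  have \<pi>2le: "?\<pi>2 \<le> 1"
  proof -
    have "(real n - \<beta> - 3 * k - t) / n \<le> 1" "(real q - \<beta>) / q \<le> 1" "0 \<le> (real q - \<beta>) / q" using n_pos t by (auto simp: divide_le_eq_1)
    then show ?thesis by (meson mult_le_one)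
  qed
  have "measure_pmf.prob (bind_pmf (Pi_pmf U [] (\<lambda>v. sample W k (?A v)))
      (\<lambda>b. map_pmf (Pair b) (Pi_pmf U [] (\<lambda>v. sample W k (?A v - fst ` set (b v))))))
      {(b, c). \<nexists>col. inj_on col U \<and> (\<forall>v\<in>U. col v \<in> available U T (V - S) C m b c v)}
    \<le> card U * ?\<epsilon>1 / t + card U * ?\<epsilon>2 + (\<Sum>x=1..card U. real (card U choose x) * real (card C choose (x - 1))
        * ((real (x - 1) / card C) ^ Suc m) ^ x)"
  proof (rule prob_no_assignment_le)
    show "C \<noteq> {}" using cC n_pos W(3) by (metis \<beta>(1) card.empty diff_gt_0_iff_gt of_nat_0 of_nat_less_iff not_le order_less_le_trans)
    show "card U \<le> card C" using cU cC' W(3) by linarith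
    show "2 * k \<le> card (?A v)" if "v \<in> U" for v using cApos[OF that] n_pos by linarith
  next
    fix v assume v: "v \<in> U"
    \<comment> \<open>Only about \<open>i\<close> of the \<open>n\<close> tails are hits here, so
      the gain is a small exponential whatever the parameter; \<open>1 / 2\<close> keeps the loss at
      \<open>2 ^ m\<close>.\<close>
    have "(1 / 2) ^ m * measure_pmf.prob (sample W k (?A v)) {xs. hits T C xs \<le> m} \<le> (1 - ?\<pi>1 * (1 - 1 / 2)) ^ k"
    proof (rule prob_hits_le)
      have "card T - card (fst ` set (a v)) \<le> card (T - fst ` set (a v))" by (rule diff_card_le_card_Diff) auto
      also have "T - fst ` set (a v) = ?A v \<inter> T" using v U T by auto
      finally have "real i - 2 * k \<le> real (card (?A v \<inter> T)) - k" using a[OF v] T by linarith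
      then show "?\<pi>1 * card (?A v) * card W \<le> (real (card (?A v \<inter> T)) - k) * card (W \<inter> C)"
        unfolding W(2) WC using n_pos \<beta>(3) cC cAn[of v "{}"] by (intro rate_le) auto
      show "k \<le> card (?A v)" using cApos[OF v] n_pos by linarith
    qed (use V W n_pos \<pi>0 in auto)
    then show "measure_pmf.prob (sample W k (?A v)) {xs. hits T C xs \<le> m} \<le> ?\<epsilon>1"
      by (simp add: power_one_over field_simps)
  next
    fix v xs F assume v: "v \<in> U" and xs: "xs \<in> set_pmf (sample W k (?A v))" and F: "F \<subseteq> U" "real (card F) \<le> t"
    have kA: "k \<le> card (?A v)" using cApos[OF v] n_pos by linarith
    have cx: "card (fst ` set xs) \<le> k" using sample_fst[OF _ kA xs] V by auto
    have finF: "finite F" using F finU finite_subset by blast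
    let ?A' = "?A v - fst ` set xs" and ?D = "S \<union> F \<union> {v} \<union> fst ` set (a v) \<union> fst ` set xs"
    have "card ?D \<le> card S + card F + 1 + k + k"
      using card_Un_le[of "S \<union> F \<union> {v} \<union> fst ` set (a v)" "fst ` set xs"] card_Un_le[of "S \<union> F \<union> {v}" "fst ` set (a v)"]
        card_Un_le[of "S \<union> F" "{v}"] card_Un_le[of S F] a[OF v] cx by simp
    moreover have "card V - card ?D \<le> card (?A' \<inter> (V - S - F))"
    proof -
      have "V - ?D = ?A' \<inter> (V - S - F)" by auto
      then show ?thesis using diff_card_le_card_Diff[of ?D V] finF n_pos by simp
    qed
    ultimately have ge: "real n - \<beta> - 3 * k - t \<le> real (card (?A' \<inter> (V - S - F))) - k"
      using F(2) V(4,5) \<beta>(1) by linarith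
    \<comment> \<open>In the third block nearly every arc is a hit. A small \<open>\<theta>\<close>
      therefore makes the base itself small, which has to compensate a union bound over all
      vertices.\<close>
    have "\<theta> ^ m * measure_pmf.prob (sample W k ?A') {xs. hits (V - S - F) C xs \<le> m} \<le> (1 - ?\<pi>2 * (1 - \<theta>)) ^ k"
    proof (rule prob_hits_le)
      show "?\<pi>2 * card ?A' * card W \<le> (real (card (?A' \<inter> (V - S - F))) - k) * card (W \<inter> C)"
        unfolding W(2) WC using n_pos \<beta>(2) cC cAn[of v] ge by (intro rate_le) auto
      have "card (?A v) - card (fst ` set xs) \<le> card ?A'" by (rule diff_card_le_card_Diff) auto
      then show "k \<le> card ?A'" using cApos[OF v] n_pos cx by linarith
    qed (use V W n_pos \<pi>0 \<theta> in auto)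
    then show "measure_pmf.prob (sample W k ?A') {xs. hits (V - S - F) C xs \<le> m} \<le> ?\<epsilon>2"
      using \<theta> by (simp add: field_simps)
  next
    have "?\<pi>2 * (1 - \<theta>) \<le> 1" by (rule mult_le_one) (use \<pi>2le \<theta> in auto)
    then show "0 \<le> ?\<epsilon>2" using \<theta> by simp
  qed (use finU V W n_pos C t in auto)
  also have "card U * ?\<epsilon>1 / t + card U * ?\<epsilon>2 + (\<Sum>x=1..card U. real (card U choose x) * real (card C choose (x - 1))
        * ((real (x - 1) / card C) ^ Suc m) ^ x) \<le> n * ?\<epsilon>1 / t + n * ?\<epsilon>2 + 2 * \<delta>"
  proof (intro add_mono)
    have "?\<pi>1 \<le> 1"
    proof -
      have "(real i - 2 * k) / n \<le> 1" "(real q - \<beta>) / q \<le> 1" "0 \<le> (real q - \<beta>) / q" using n_pos \<beta>(1) by (auto simp: divide_le_eq_1)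
      then show ?thesis by (meson mult_le_one)
    qed
    then have "0 \<le> (1 - ?\<pi>1 / 2) ^ k" by (intro zero_le_power) (simp only: diff_ge_0_iff_ge half_le_one)
    then have "0 \<le> ?\<epsilon>1" by (intro mult_nonneg_nonneg) auto
    then show "card U * ?\<epsilon>1 / t \<le> n * ?\<epsilon>1 / t" using cUn t by (intro divide_right_mono mult_right_mono) auto
    have "?\<pi>2 * (1 - \<theta>) \<le> 1" by (rule mult_le_one) (use \<pi>2le \<theta> in auto)
    then show "card U * ?\<epsilon>2 \<le> n * ?\<epsilon>2" using cUn \<theta> by (intro mult_right_mono) auto
    have cCpos: "0 < card C" using cC' cU n_pos W(3) by linarith
    show "(\<Sum>x=1..card U. real (card U choose x) * real (card C choose (x - 1)) * ((real (x - 1) / card C) ^ Suc m) ^ x) \<le> 2 * \<delta>"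
    proof (rule hall_sum_le[where r = "real n / q"])
      \<comment> \<open>Vertices and colours lose the same number \<open>x\<close>, and since
        \<open>n \<le> q\<close> the ratio \<open>(n - x) / (q - x)\<close> is at most
        \<open>n / q\<close>.\<close>
      define x where "x = card S + card T"
      have "real (card U) * q \<le> (real n - x) * q" using cU by (intro mult_right_mono) (simp_all add: x_def)
      also have "\<dots> \<le> real n * (real q - x)" using mult_right_mono[of "real n" q x] W(3) by (simp add: algebra_simps)
      also have "\<dots> \<le> real n * card C" using cC' by (intro mult_left_mono) (simp_all add: x_def)
      finally show "real (card U) / card C \<le> real n / q" using cCpos n_pos by (simp add: field_simps)
      show "card U \<le> card C" using cU cC' W(3) by linarith
    qed (use cCpos n_pos W(3) m \<delta> in auto)
  qed
  finally show ?thesis .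
qed

text \<open>The path is determined by \<open>s\<close> and the first blocks. Given these, the
  remaining blocks of different vertices are independent and merely avoid tails already drawn, so
  they may be sampled after \<open>T\<close> is known.\<close>

private lemma second_stage:
  assumes s: "\<And>v. v \<in> S \<Longrightarrow> s v \<noteq> [] \<and> fst (hd (s v)) \<in> V - S" "inj_on (\<lambda>v. snd (hd (s v))) S"
    and a: "\<And>v. v \<in> V - {z} - S \<Longrightarrow> a v \<in> set_pmf (sample W k (V - {v}))"
    and path: "rainbow_path a z (V - {z} - S) ((\<lambda>v. snd (hd (s v))) ` S) y i i"
  shows "measure_pmf.prob (Pi_pmf (V - {z} - S) [] (\<lambda>v. sample W (k + k) (V - {v} - fst ` set (a v))))
      {g. \<not> rainbow_choice V z (\<lambda>v. if v \<in> S then s v else a v @ g v)}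
    \<le> n * (2 ^ m * (1 - (real i - 2 * k) / n * ((real q - \<beta>) / q) / 2) ^ k) / t
      + n * ((1 - (real n - \<beta> - 3 * k - t) / n * ((real q - \<beta>) / q) * (1 - \<theta>)) ^ k / \<theta> ^ m) + 2 * \<delta>"
proof -
  let ?cS = "(\<lambda>v. snd (hd (s v))) ` S"
  obtain ps where ps: "distinct (map fst ps)" "fst ` set ps \<subseteq> V - {z} - S" "distinct (map snd ps)"
    "snd ` set ps \<inter> ?cS = {}" "chain a z ps" "i < length ps" "length ps \<le> i + i"
    using path unfolding rainbow_path_def by blast
  define T where "T = fst ` set ps"
  define U where "U = V - {z} - S - T"
  define Y where "Y = snd ` set ps \<union> ?cS"
  define C where "C = W - Y"
  have finU: "finite U" using V by (simp add: U_def)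
  have cT: "card T = length ps" using ps(1) distinct_card[of "map fst ps"] by (simp add: T_def)
  have cY: "card Y \<le> card S + card T"
  proof -
    have "card (snd ` set ps) \<le> length ps" using card_image_le[of "set ps" snd] card_length[of ps] by simp
    moreover have "card ?cS \<le> card S" using n_pos by (intro card_image_le) auto
    ultimately show ?thesis using card_Un_le[of "snd ` set ps" ?cS] cT by (simp add: Y_def)
  qed
  have ak: "card (fst ` set (a v)) \<le> k" if "v \<in> U" for v
  proof -
    have "card (V - {v}) = n - 1" using that V by (simp add: U_def)
    then have "k \<le> card (V - {v})" using n_pos by linarith
    then show ?thesis using sample_fst[OF _ _ a[of v]] that V by (auto simp: U_def)
  qed
  let ?A = "\<lambda>v. V - {v} - fst ` set (a v)"
  let ?X = "\<lambda>g v. if v \<in> S then s v else a v @ g v"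
  let ?B = "Pi_pmf U [] (\<lambda>v. sample W k (?A v))"
  let ?C = "\<lambda>b. Pi_pmf U [] (\<lambda>v. sample W k (?A v - fst ` set (b v)))"
  let ?h = "\<lambda>b c v. if v \<in> U then b v @ c v else []"
  have law: "Pi_pmf U [] (\<lambda>v. sample W (k + k) (?A v)) = map_pmf (\<lambda>(b, c). ?h b c) (bind_pmf ?B (\<lambda>b. map_pmf (Pair b) (?C b)))"
  proof -
    have "Pi_pmf U [] (\<lambda>v. sample W (k + k) (?A v)) = bind_pmf ?B (\<lambda>b. Pi_pmf U []
        (\<lambda>v. map_pmf ((@) (b v)) (sample W k (?A v - fst ` set (b v)))))"
      unfolding sample_add by (rule Pi_pmf_bind[OF finU])
    also have "\<dots> = bind_pmf ?B (\<lambda>b. map_pmf (?h b) (?C b))"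
      by (simp add: Pi_pmf_map_dependent[OF finU, where d' = "[]"])
    finally show ?thesis by (simp add: map_bind_pmf pmf.map_comp o_def)
  qed
  \<comment> \<open>Emptying the later blocks on the path only removes arcs, and
    \<open>rainbow_choice\<close> is monotone in the lists, so the failure event can only
    grow.\<close>
  have "measure_pmf.prob (Pi_pmf (V - {z} - S) [] (\<lambda>v. sample W (k + k) (?A v))) {g. \<not> rainbow_choice V z (?X g)}
      \<le> measure_pmf.prob (Pi_pmf U [] (\<lambda>v. sample W (k + k) (?A v))) {g. \<not> rainbow_choice V z (?X g)}"
  proof (rule prob_Pi_pmf_subset_le)
    fix g assume g: "g \<in> {g. \<not> rainbow_choice V z (?X g)}"
    have "rainbow_choice V z (?X g)" if "rainbow_choice V z (?X (\<lambda>v. if v \<in> U then g v else []))"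
      by (rule rainbow_choice_mono[OF that]) auto
    then show "(\<lambda>v. if v \<in> U then g v else []) \<in> {g. \<not> rainbow_choice V z (?X g)}" using g by blast
  qed (use V in \<open>auto simp: U_def\<close>)
  also have "\<dots> \<le> measure_pmf.prob (bind_pmf ?B (\<lambda>b. map_pmf (Pair b) (?C b)))
      {(b, c). \<nexists>col. inj_on col U \<and> (\<forall>v\<in>U. col v \<in> available U T (V - S) C m b c v)}"
    unfolding law measure_map_pmf
  proof (intro measure_pmf.finite_measure_mono subsetI)
    fix bc assume bc: "bc \<in> (\<lambda>(b, c). ?h b c) -` {g. \<not> rainbow_choice V z (?X g)}"
    obtain b c where [simp]: "bc = (b, c)" by (cases bc)
    have "rainbow_choice V z (?X (?h b c))" if col: "inj_on col U" "\<forall>v\<in>U. col v \<in> available U T (V - S) C m b c v" for col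
    proof (rule rainbow_choice_combine[where s = s and ps = ps and T = T and U = U and C = C and b = b and c = c and col = col and m = m])
      show "hd (s v) \<in> set (?X (?h b c) v) \<and> fst (hd (s v)) \<in> V - S" if "v \<in> S" for v using s(1)[OF that] that by simp
      have "chain (\<lambda>v. a v @ ?h b c v) z ps" using ps(5) by (induction ps) auto
      moreover have "chain (?X (?h b c)) z ps \<longleftrightarrow> chain (\<lambda>v. a v @ ?h b c v) z ps"
        using ps(2) by (intro chain_cong) auto
      ultimately show "chain (?X (?h b c)) z ps" by simp
      show "C \<inter> (snd ` set ps \<union> ?cS) = {}" by (auto simp: C_def Y_def)
    qed (use V s(2) ps col in \<open>auto simp: T_def U_def\<close>)
    then show "bc \<in> {(b, c). \<nexists>col. inj_on col U \<and> (\<forall>v\<in>U. col v \<in> available U T (V - S) C m b c v)}"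
      using bc by auto
  qed simp
  also have "\<dots> \<le> n * (2 ^ m * (1 - (real i - 2 * k) / n * ((real q - \<beta>) / q) / 2) ^ k) / t
      + n * ((1 - (real n - \<beta> - 3 * k - t) / n * ((real q - \<beta>) / q) * (1 - \<theta>)) ^ k / \<theta> ^ m) + 2 * \<delta>"
    by (rule assignment[OF _ _ _ U_def _ cY C_def ak]) (use ps cT n_pos in \<open>auto simp: T_def Y_def\<close>)
  finally show ?thesis .
qed

text \<open>Three stages are exposed in turn: the single arcs on \<open>S\<close>, the first blocks,
  the remaining two blocks. They cost \<open>?e1\<close>, \<open>?e2\<close> and \<open>?e3\<close>,
  each uniformly over the good outcomes of the stages before it.\<close>

lemma prob_no_rainbow_choice_le:
  shows "measure_pmf.prob (Pi_pmf (V - {z}) [] (\<lambda>v. sample W (if v \<in> S then 1 else k + (k + k)) (V - {v})))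
      {X. \<not> rainbow_choice V z X}
    \<le> \<sigma> * (\<sigma> / (real n - 1) + \<sigma> / q)
      + (2 * i * (1 - (real n - \<beta> - k) / n * ((real q - \<beta>) / q)) ^ k + (1 - real k / n * ((real q - \<beta>) / q)) ^ i)
      + (n * (2 ^ m * (1 - (real i - 2 * k) / n * ((real q - \<beta>) / q) / 2) ^ k) / t
      + n * ((1 - (real n - \<beta> - 3 * k - t) / n * ((real q - \<beta>) / q) * (1 - \<theta>)) ^ k / \<theta> ^ m) + 2 * \<delta>)"
    (is "_ \<le> ?e1 + ?e2 + ?e3")
proof -
  let ?Bg = "V - {z} - S"
  let ?PS = "Pi_pmf S [] (\<lambda>v. sample W 1 (V - {v}))"
  let ?q = "\<lambda>a. Pi_pmf ?Bg [] (\<lambda>v. sample W (k + k) (V - {v} - fst ` set (a v)))"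
  let ?PA = "Pi_pmf ?Bg [] (\<lambda>v. sample W k (V - {v}))"
  have finBg: "finite ?Bg" using V by simp
  have cV: "card (V - {v}) = n - 1" if "v \<in> V" for v using that V by simp
  have cBg: "card ?Bg = n - 1 - card S" using V n_pos cV[of z] by (simp add: card_Diff_subset)
  have "card ?Bg > 0" using cBg n_pos \<beta>(1) V(4) by linarith
  then obtain y where y: "y \<in> ?Bg" by (metis card_gt_0_iff ex_in_conv)
  have nonneg: "0 \<le> (real q - \<beta>) / q" "(real q - \<beta>) / q \<le> 1" using n_pos by auto
  have e3: "0 \<le> ?e3"
  proof -
    have "(real i - 2 * k) / n * ((real q - \<beta>) / q) \<le> 1 * 1" "(real n - \<beta> - 3 * k - t) / n * ((real q - \<beta>) / q) \<le> 1 * 1"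
      using nonneg n_pos \<beta>(1) t by (intro mult_mono; simp)+
    moreover have "0 \<le> (real n - \<beta> - 3 * k - t) / n * ((real q - \<beta>) / q)"
      using n_pos \<beta>(2) by (intro mult_nonneg_nonneg divide_nonneg_nonneg) auto
    moreover have "0 \<le> \<delta>" using \<delta>(1) by (rule order_trans[rotated]) auto
    moreover have "(real i - 2 * k) / n * ((real q - \<beta>) / q) / 2 \<le> 1"
      using half_le_one calculation(1) by (simp only: mult_1)
    moreover have "(real n - \<beta> - 3 * k - t) / n * ((real q - \<beta>) / q) * (1 - \<theta>) \<le> 1"
      by (rule mult_le_one) (use calculation(2) \<theta> in auto)
    ultimately have "0 \<le> (1 - (real i - 2 * k) / n * ((real q - \<beta>) / q) / 2) ^ k"
      "0 \<le> (1 - (real n - \<beta> - 3 * k - t) / n * ((real q - \<beta>) / q) * (1 - \<theta>)) ^ k" "0 \<le> \<delta>"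
      by (simp_all only: zero_le_power diff_ge_0_iff_ge)
    then show ?thesis using t \<theta> by (intro add_nonneg_nonneg mult_nonneg_nonneg divide_nonneg_nonneg) auto
  qed
  have e2: "0 \<le> ?e2"
  proof -
    have "(real n - \<beta> - k) / n * ((real q - \<beta>) / q) \<le> 1 * 1" "real k / n * ((real q - \<beta>) / q) \<le> 1 * 1"
      using nonneg n_pos by (intro mult_mono; simp)+
    then show ?thesis by (intro add_nonneg_nonneg mult_nonneg_nonneg zero_le_power) auto
  qed
  have disj: "V - {z} = S \<union> ?Bg" using V(3) by auto
  have law: "Pi_pmf (V - {z}) [] (\<lambda>v. sample W (if v \<in> S then 1 else k + (k + k)) (V - {v}))
     = bind_pmf ?PS (\<lambda>s. bind_pmf ?PA (\<lambda>a. map_pmf (\<lambda>g v. if v \<in> S then s v else if v \<in> ?Bg then a v @ g v else []) (?q a)))"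
  proof -
    have "Pi_pmf (V - {z}) [] (\<lambda>v. sample W (if v \<in> S then 1 else k + (k + k)) (V - {v}))
      = bind_pmf (Pi_pmf S [] (\<lambda>v. sample W (if v \<in> S then 1 else k + (k + k)) (V - {v})))
         (\<lambda>s. map_pmf (\<lambda>f v. if v \<in> S then s v else f v) (Pi_pmf ?Bg [] (\<lambda>v. sample W (if v \<in> S then 1 else k + (k + k)) (V - {v}))))"
      using n_pos V
      by (subst disj, subst Pi_pmf_union) (auto simp: pair_pmf_def map_bind_pmf map_pmf_def[of "Pair _"] map_pmf_def bind_assoc_pmf bind_return_pmf)
    also have "Pi_pmf S [] (\<lambda>v. sample W (if v \<in> S then 1 else k + (k + k)) (V - {v})) = ?PS"
      by (intro Pi_pmf_cong) auto
    also have "Pi_pmf ?Bg [] (\<lambda>v. sample W (if v \<in> S then 1 else k + (k + k)) (V - {v}))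
       = Pi_pmf ?Bg [] (\<lambda>v. sample W (k + (k + k)) (V - {v}))"
      by (intro Pi_pmf_cong) auto
    also have "\<dots> = bind_pmf ?PA (\<lambda>a. map_pmf (\<lambda>g v. if v \<in> ?Bg then a v @ g v else []) (?q a))"
      unfolding sample_add[of W k "k + k"] Pi_pmf_bind[OF finBg, where d' = "[]"]
      by (simp add: Pi_pmf_map_dependent[OF finBg, where d' = "[]"])
    finally show ?thesis by (simp only: map_bind_pmf pmf.map_comp o_def)
  qed
  have "measure_pmf.prob (bind_pmf ?PS (\<lambda>s. bind_pmf ?PA (\<lambda>a. map_pmf (\<lambda>g v. if v \<in> S then s v else if v \<in> ?Bg then a v @ g v else []) (?q a))))
      {X. \<not> rainbow_choice V z X} \<le> ?e1 + (?e2 + ?e3)"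
  proof (rule prob_bind_pmf_le_add)
    let ?clash = "{f. \<not> ((\<forall>v\<in>S. fst (hd (f v)) \<notin> S) \<and> inj_on (\<lambda>v. snd (hd (f v))) S)}"
    have "measure_pmf.prob ?PS ?clash \<le> card S * (card S / (card V - 1) + card S / card W)"
      using V W n_pos \<beta>(1) by (intro prob_single_arcs_clash_le) auto
    also have "\<dots> \<le> ?e1"
    proof -
      have "real (card V - 1) = real n - 1" using V n_pos by simp
      moreover have "0 \<le> real n - 1" using n_pos by simp
      ultimately show ?thesis unfolding W(2) \<open>real (card V - 1) = real n - 1\<close>
        using V(4) n_pos by (intro mult_mono add_mono divide_right_mono) auto
    qed
    finally show "measure_pmf.prob ?PS ?clash \<le> ?e1" .
    fix s assume s: "s \<in> set_pmf ?PS" "s \<notin> ?clash"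
    have sv: "s v \<noteq> [] \<and> fst (hd (s v)) \<in> V - S" if "v \<in> S" for v
    proof -
      have sm: "s v \<in> set_pmf (sample W 1 (V - {v}))" using s(1) that n_pos by (auto simp: set_Pi_pmf PiE_dflt_def)
      have "1 \<le> card (V - {v})" using cV[of v] that V n_pos \<beta>(1) by auto
      then have "fst ` set (s v) \<subseteq> V - {v}" using sample_fst[OF _ _ sm] V by auto
      moreover have ne: "s v \<noteq> []" using length_sample[OF sm] by auto
      ultimately have "fst (hd (s v)) \<in> V - {v}" using imageI[OF hd_in_set[OF ne], of fst] by blast
      then show ?thesis using s(2) that ne by auto
    qed
    let ?F = "(\<lambda>v. snd (hd (s v))) ` S"
    have cF: "card ?F \<le> card S" using n_pos by (intro card_image_le) auto
    show "measure_pmf.prob (bind_pmf ?PA (\<lambda>a. map_pmf (\<lambda>g v. if v \<in> S then s v else if v \<in> ?Bg then a v @ g v else []) (?q a)))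
        {X. \<not> rainbow_choice V z X} \<le> ?e2 + ?e3"
    proof (rule prob_bind_pmf_le_add[OF _ _ e3])
      have "measure_pmf.prob ?PA {a. \<not> rainbow_path a z ?Bg ?F y i i}
         \<le> real (i + i) * (1 - (real n - \<beta> - k) / n * ((real q - \<beta>) / q)) ^ k + (1 - real k / n * ((real q - \<beta>) / q)) ^ i"
      proof (rule prob_no_rainbow_path_le[OF finBg y, where \<alpha> = "n - 1 - \<sigma> - 2 * i" and \<gamma> = "\<sigma> + 2 * i"])
        show "n - 1 - \<sigma> - 2 * i + i + i \<le> card ?Bg" using cBg V(4) \<beta>(1) n_pos by linarith
        show "card ?F + i + i \<le> \<sigma> + 2 * i" using cF V(4) by simp
        show "finite ?F" using n_pos by simp
        show "measure_pmf.prob (sample W k (V - {v})) {xs. set xs \<inter> U \<times> - F = {}}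
            \<le> (1 - (real n - \<beta> - k) / n * ((real q - \<beta>) / q)) ^ k"
          if "v \<in> ?Bg" "U \<subseteq> ?Bg" "n - 1 - \<sigma> - 2 * i \<le> card U" "finite F" "card F \<le> \<sigma> + 2 * i" for v U F
          using that \<beta>(1) by (intro fresh) auto
        show "measure_pmf.prob (sample W k (V - {v})) {xs. set xs \<inter> {z} \<times> - F = {}}
            \<le> 1 - real k / n * ((real q - \<beta>) / q)"
          if "v \<in> ?Bg" "finite F" "card F \<le> \<sigma> + 2 * i" for v F
          using that \<beta>(1) by (intro root) auto
        have "(real n - \<beta> - k) / n * ((real q - \<beta>) / q) \<le> 1 * 1"
          using nonneg n_pos by (intro mult_mono) auto
        then show "0 \<le> (1 - (real n - \<beta> - k) / n * ((real q - \<beta>) / q)) ^ k" by simp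
        show "0 \<le> real k / n * ((real q - \<beta>) / q)" using n_pos by simp
        have "real k / n * ((real q - \<beta>) / q) \<le> 1 * 1" using nonneg n_pos by (intro mult_mono) auto
        then show "real k / n * ((real q - \<beta>) / q) \<le> 1" by simp
      qed
      then show "measure_pmf.prob ?PA {a. \<not> rainbow_path a z ?Bg ?F y i i} \<le> ?e2" by simp
      fix a assume a: "a \<in> set_pmf ?PA" "a \<notin> {a. \<not> rainbow_path a z ?Bg ?F y i i}"
      have "{g. \<not> rainbow_choice V z (\<lambda>v. if v \<in> S then s v else if v \<in> ?Bg then a v @ g v else [])}
          = {g. \<not> rainbow_choice V z (\<lambda>v. if v \<in> S then s v else a v @ g v)}"
        by (intro Collect_cong arg_cong[where f=Not] rainbow_choice_cong) auto
      moreover have "measure_pmf.prob (?q a) {g. \<not> rainbow_choice V z (\<lambda>v. if v \<in> S then s v else a v @ g v)} \<le> ?e3"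
      proof (rule second_stage)
        show "a v \<in> set_pmf (sample W k (V - {v}))" if "v \<in> ?Bg" for v
          using a(1) that finBg by (auto simp: set_Pi_pmf PiE_dflt_def)
        show "inj_on (\<lambda>v. snd (hd (s v))) S" using s(2) by auto
        show "rainbow_path a z ?Bg ?F y i i" using a(2) by simp
      qed (use sv in auto)
      ultimately show "measure_pmf.prob (map_pmf (\<lambda>g v. if v \<in> S then s v else if v \<in> ?Bg then a v @ g v else []) (?q a))
          {X. \<not> rainbow_choice V z X} \<le> ?e3"
        by (simp only: measure_map_pmf vimage_Collect_eq)
    qed
  qed (use e2 e3 in auto)
  then show ?thesis unfolding law by (simp only: add.assoc)
qed

end

section \<open>In-degrees\<close>

lemma prob_random_permutation_Cons:
  assumes "finite A" "A \<noteq> {}"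
  shows "measure_pmf.prob (pmf_of_set (permutations_of_set A)) E =
    (\<Sum>x\<in>A. measure_pmf.prob (pmf_of_set (permutations_of_set (A - {x}))) {xs. x # xs \<in> E}) / card A"
  unfolding random_permutation_of_set[OF assms]
  using assms by (simp add: prob_bind_pmf_of_set map_pmf_def[symmetric] vimage_def)

text \<open>The exponential moment argument for prefixes of a random permutation. The rate loses
  \<open>m\<close> and not the prefix length, because at most \<open>m\<close> elements of
  \<open>H\<close> are drawn while the event is still possible. This matters: the prefix will be far
  longer than the number of arcs into one vertex.\<close>

lemma prob_prefix_count_le:
  fixes \<theta> \<pi> :: real
  assumes "finite A" "k \<le> card A" "0 \<le> \<theta>" "\<theta> \<le> 1" "0 \<le> \<pi>"
    and "\<pi> * card A \<le> real (card (A \<inter> H)) - m"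
  shows "\<theta> ^ m * measure_pmf.prob (pmf_of_set (permutations_of_set A))
    {xs. length (filter (\<lambda>x. x \<in> H) (take k xs)) \<le> m} \<le> (1 - \<pi> * (1 - \<theta>)) ^ k"
  using assms(1,2,6)
proof (induction k arbitrary: A m)
  case 0
  then show ?case using assms by (simp add: power_le_one)
next
  case (Suc k)
  have ne: "A \<noteq> {}" using Suc.prems by auto
  then have cA: "0 < card A" using Suc.prems by (simp add: card_gt_0_iff)
  define h where "h = card (A \<inter> H) / card A"
  define R where "R = (1 - \<pi> * (1 - \<theta>)) ^ k"
  let ?P = "\<lambda>A. measure_pmf.prob (pmf_of_set (permutations_of_set A))"
  let ?E = "\<lambda>k m. {xs. length (filter (\<lambda>x. x \<in> H) (take k xs)) \<le> m}"
  have "card (A \<inter> H) \<le> card A" using Suc.prems by (intro card_mono) auto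
  then have h1: "h \<le> 1" using cA by (simp add: h_def)
  have \<pi>h: "\<pi> \<le> h" using Suc.prems(3) cA by (simp add: h_def field_simps)
  then have "\<pi> * (1 - \<theta>) \<le> 1" using h1 assms by (intro mult_le_one) auto
  then have R: "0 \<le> R" by (simp add: R_def)
  have cH: "real (card ((A - {x}) \<inter> H)) = real (card (A \<inter> H)) - (if x \<in> H then 1 else 0)" if "x \<in> A" for x
  proof (cases "x \<in> H")
    case True
    then have "x \<in> A \<inter> H" "(A - {x}) \<inter> H = A \<inter> H - {x}" using that by auto
    moreover have "0 < card (A \<inter> H)" using calculation(1) Suc.prems(1) by (auto simp: card_gt_0_iff)
    ultimately show ?thesis using True by (simp add: of_nat_diff)
  next
    case False
    then have "(A - {x}) \<inter> H = A \<inter> H" by auto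
    then show ?thesis using False by simp
  qed
  have IH: "\<theta> ^ m' * ?P (A - {x}) (?E k m') \<le> R" if x: "x \<in> A" "real m' = real m - (if x \<in> H then 1 else 0)" for x m'
    unfolding R_def
  proof (rule Suc.IH)
    have "\<pi> * card (A - {x}) \<le> \<pi> * card A"
      using assms Suc.prems by (intro mult_left_mono) (auto intro: card_mono)
    then show "\<pi> * card (A - {x}) \<le> real (card ((A - {x}) \<inter> H)) - m'"
      using Suc.prems(3) cH[OF x(1)] x(2) by linarith
  qed (use Suc.prems x in auto)
  define g where "g x = ?P (A - {x}) {xs. x # xs \<in> ?E (Suc k) m}" for x
  have "\<theta> ^ m * ?P A (?E (Suc k) m) = (\<Sum>x\<in>A. \<theta> ^ m * g x) / card A"
    unfolding prob_random_permutation_Cons[OF Suc.prems(1) ne] by (simp add: g_def sum_distrib_left)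
  also have "\<dots> \<le> card (A \<inter> H) / card A * (\<theta> * R) + (1 - card (A \<inter> H) / card A) * R"
  proof (rule average_le_two_valued)
    fix x assume x: "x \<in> A" "x \<in> H"
    show "\<theta> ^ m * g x \<le> \<theta> * R"
    proof (cases m)
      case 0
      then show ?thesis using x R assms by (simp add: g_def)
    next
      case (Suc m')
      then have "g x = ?P (A - {x}) (?E k m')" using x by (simp add: g_def)
      then show ?thesis using IH[OF x(1), of m'] x Suc assms by (simp add: mult.assoc mult_left_mono)
    qed
  next
    fix x assume x: "x \<in> A" "x \<notin> H"
    then have "g x = ?P (A - {x}) (?E k m)" by (simp add: g_def)
    then show "\<theta> ^ m * g x \<le> R" using IH[OF x(1), of m] x by simp
  qed (use Suc.prems ne in auto)
  also have "\<dots> = (1 - h * (1 - \<theta>)) * R" by (simp add: h_def[symmetric] algebra_simps)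
  also have "\<dots> \<le> (1 - \<pi> * (1 - \<theta>)) * R"
    using \<pi>h R assms by (intro mult_right_mono) (auto intro: mult_right_mono)
  finally show ?case by (simp add: R_def)
qed

text \<open>An exact product, so that the value for two vertices can be compared factor by factor
  with the square of the value for one.\<close>

lemma prob_prefix_avoid:
  assumes "finite A" "H \<subseteq> A" "k + card H \<le> card A"
  shows "measure_pmf.prob (pmf_of_set (permutations_of_set A)) {xs. set (take k xs) \<inter> H = {}}
    = (\<Prod>i<k. 1 - card H / (real (card A) - real i))"
  using assms
proof (induction k arbitrary: A)
  case (Suc k)
  have ne: "A \<noteq> {}" using Suc.prems by auto
  then have cA: "0 < card A" using Suc.prems by (simp add: card_gt_0_iff)
  let ?P = "\<lambda>A. measure_pmf.prob (pmf_of_set (permutations_of_set A))"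
  have finH: "finite H" using Suc.prems finite_subset by blast
  have "?P (A - {x}) {xs. x # xs \<in> {xs. set (take (Suc k) xs) \<inter> H = {}}}
      = (if x \<in> H then 0 else (\<Prod>i<k. 1 - card H / (real (card A) - real (Suc i))))" if x: "x \<in> A" for x
  proof (cases "x \<in> H")
    case False
    have "?P (A - {x}) {xs. set (take k xs) \<inter> H = {}} = (\<Prod>i<k. 1 - card H / (real (card (A - {x})) - real i))"
      using x False Suc.prems by (intro Suc.IH) auto
    moreover have "real (card (A - {x})) - i = real (card A) - Suc i" for i
      using x cA Suc.prems by (simp add: of_nat_diff)
    ultimately show ?thesis using False by simp
  qed simp
  then have "?P A {xs. set (take (Suc k) xs) \<inter> H = {}}
      = (\<Sum>x\<in>A. if x \<in> H then 0 else (\<Prod>i<k. 1 - card H / (real (card A) - real (Suc i)))) / card A"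
    unfolding prob_random_permutation_Cons[OF Suc.prems(1) ne] by simp
  also have "\<dots> = (card A - card H) / card A * (\<Prod>i<k. 1 - card H / (real (card A) - real (Suc i)))"
  proof -
    have "A \<inter> {x. x \<notin> H} = A - H" by auto
    moreover have "A \<inter> - H = A - H" by auto
    ultimately show ?thesis using Suc.prems finH by (simp add: sum.If_cases card_Diff_subset)
  qed
  also have "real (card A - card H) / card A = 1 - card H / (real (card A) - (0::nat))"
    using cA card_mono[OF Suc.prems(1,2)] by (simp add: of_nat_diff field_simps)
  finally show ?case unfolding prod.lessThan_Suc_shift by simp
qed simp

text \<open>Chebyshev's inequality: pairwise nonpositive correlation bounds the variance of the
  count by its mean \<open>\<mu>\<close>, and a count of at most 1 deviates by at least
  \<open>\<mu> - 1\<close>.\<close>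

lemma prob_count_le_1_le:
  fixes p \<mu> :: real
  assumes "finite I" "\<And>i. i \<in> I \<Longrightarrow> measure_pmf.prob P (E i) = p"
    and "\<And>i j. i \<in> I \<Longrightarrow> j \<in> I \<Longrightarrow> i \<noteq> j \<Longrightarrow> measure_pmf.prob P (E i \<inter> E j) \<le> p\<^sup>2"
    and \<mu>: "\<mu> = card I * p" "1 < \<mu>"
  shows "measure_pmf.prob P {x. card {i \<in> I. x \<in> E i} \<le> 1} \<le> \<mu> / (\<mu> - 1)\<^sup>2"
proof -
  have ind: "integrable (measure_pmf P) (indicator B :: _ \<Rightarrow> real)" for B
    by (intro integrable_pmf_bounded[where B=1]) (auto simp: indicator_def)
  define f where "f x = (\<Sum>i\<in>I. indicator (E i) x :: real)" for x
  have f: "f x = card {i \<in> I. x \<in> E i}" for x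
    using assms(1) by (simp add: f_def indicator_def Int_def)
  have fint: "integrable (measure_pmf P) f"
    unfolding f_def[abs_def] by (intro Bochner_Integration.integrable_sum ind)
  have Ef: "measure_pmf.expectation P f = \<mu>"
    unfolding f_def[abs_def] using assms(2) by (simp add: ind \<mu>)
  have f2: "(f x)\<^sup>2 = (\<Sum>i\<in>I. \<Sum>j\<in>I. indicator (E i \<inter> E j) x)" for x
    by (simp add: f_def power2_eq_square sum_product indicator_inter_arith)
  have f2int: "integrable (measure_pmf P) (\<lambda>x. (f x)\<^sup>2)"
    unfolding f2 by (intro Bochner_Integration.integrable_sum ind)
  have "measure_pmf.expectation P (\<lambda>x. (f x)\<^sup>2) = (\<Sum>i\<in>I. \<Sum>j\<in>I. measure_pmf.prob P (E i \<inter> E j))"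
    unfolding f2 by (simp add: ind)
  also have "\<dots> \<le> (\<Sum>i\<in>I. \<Sum>j\<in>I. (if i = j then p else 0) + p\<^sup>2)"
    by (intro sum_mono) (use assms(2,3) in auto)
  also have "\<dots> = \<mu> + \<mu>\<^sup>2"
    using assms(1) by (simp add: sum.distrib \<mu> power2_eq_square algebra_simps)
  finally have Ef2: "measure_pmf.expectation P (\<lambda>x. (f x)\<^sup>2) \<le> \<mu> + \<mu>\<^sup>2" .
  have "(\<mu> - 1)\<^sup>2 * measure_pmf.prob P {x. card {i \<in> I. x \<in> E i} \<le> 1}
      = measure_pmf.expectation P (\<lambda>x. (\<mu> - 1)\<^sup>2 * indicator {x. card {i \<in> I. x \<in> E i} \<le> 1} x)" by simp
  also have "\<dots> \<le> measure_pmf.expectation P (\<lambda>x. (f x)\<^sup>2 - 2 * \<mu> * f x + \<mu>\<^sup>2)"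
  proof (intro integral_mono integrable_mult_right ind Bochner_Integration.integrable_add
      Bochner_Integration.integrable_diff f2int fint measure_pmf.integrable_const)
    fix x
    have "(\<mu> - 1)\<^sup>2 * indicator {x. card {i \<in> I. x \<in> E i} \<le> 1} x \<le> (\<mu> - f x)\<^sup>2"
    proof (cases "card {i \<in> I. x \<in> E i} \<le> 1")
      case True
      then have "\<mu> - 1 \<le> \<mu> - f x" by (simp add: f)
      then show ?thesis using \<mu> True by (simp add: power_mono)
    qed simp
    then show "(\<mu> - 1)\<^sup>2 * indicator {x. card {i \<in> I. x \<in> E i} \<le> 1} x \<le> (f x)\<^sup>2 - 2 * \<mu> * f x + \<mu>\<^sup>2"
      by (simp add: power2_diff algebra_simps)
  qed
  also have "\<dots> = measure_pmf.expectation P (\<lambda>x. (f x)\<^sup>2) - 2 * \<mu> * \<mu> + \<mu>\<^sup>2"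
    by (simp add: f2int fint Ef)
  also have "\<dots> \<le> \<mu>" using Ef2 by (simp add: power2_eq_square)
  finally show ?thesis using \<mu> by (simp add: field_simps)
qed

section \<open>In-degrees read off the arc order, and the time \<open>m_Z\<close>\<close>

definition in_deg :: "('a \<times> 'b) list \<Rightarrow> nat \<Rightarrow> 'b \<Rightarrow> nat" where
  "in_deg es m v = length (filter (\<lambda>e. snd e = v) (take m es))"

lemma in_deg_mono: "m \<le> m' \<Longrightarrow> in_deg es m v \<le> in_deg es m' v"
  by (auto simp: in_deg_def take_add le_iff_add)

lemma in_degree_digraph_at:
  assumes "distinct es"
  shows "in_degree (with_proj (digraph_at n es m)) v = in_deg es m v"
proof -
  have "in_arcs (with_proj (digraph_at n es m)) v = set (filter (\<lambda>e. snd e = v) (take m es))"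
    by (auto simp: in_arcs_def digraph_at_def)
  then show ?thesis using assms
    by (simp add: in_degree_def in_deg_def distinct_card del: set_filter)
qed

lemma finite_complete_arcs [simp]: "finite (complete_arcs n)"
proof -
  have "complete_arcs n \<subseteq> {1..n} \<times> {1..n}" by (auto simp: complete_arcs_def)
  then show ?thesis using finite_subset by blast
qed

lemma card_in_arcs:
  assumes "v \<in> {1..n}"
  shows "card {e \<in> complete_arcs n. snd e = v} = n - 1"
proof -
  have "{e \<in> complete_arcs n. snd e = v} = (\<lambda>u. (u, v)) ` ({1..n} - {v})"
    using assms by (auto simp: complete_arcs_def)
  then show ?thesis using assms by (simp add: card_image inj_on_def)
qed

lemma card_complete_arcs: "card (complete_arcs n) = n * (n - 1)"
proof -
  have "complete_arcs n = (\<Union>v\<in>{1..n}. {e \<in> complete_arcs n. snd e = v})" by (auto simp: complete_arcs_def)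
  also have "card \<dots> = (\<Sum>v\<in>{1..n}. card {e \<in> complete_arcs n. snd e = v})"
    by (intro card_UN_disjoint) auto
  finally show ?thesis by (simp add: card_in_arcs)
qed

lemma m_Z_eq:
  assumes "distinct es"
  shows "m_Z n es = (LEAST m. card {v \<in> {1..n}. in_deg es m v = 0} \<le> 1)"
  unfolding m_Z_def in_degree_digraph_at[OF assms] ..

lemma in_deg_full:
  assumes "es \<in> permutations_of_set (complete_arcs n)" "v \<in> {1..n}"
  shows "in_deg es (n * (n - 1)) v = n - 1"
proof -
  have es: "distinct es" "set es = complete_arcs n" using assms by (auto dest: permutations_of_setD)
  then have "length es = n * (n - 1)" using distinct_card[of es] card_complete_arcs by simp
  then have "in_deg es (n * (n - 1)) v = card (set (filter (\<lambda>e. snd e = v) es))"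
    using es(1) by (simp add: in_deg_def distinct_card del: set_filter)
  also have "\<dots> = n - 1" using card_in_arcs[OF assms(2)] es(2) by simp
  finally show ?thesis .
qed

text \<open>The set of vertices without in-arcs shrinks with time. Two such vertices at time
  \<open>m0\<close> therefore place \<open>m_Z\<close> no earlier than \<open>m0\<close>, and the
  full order leaves none, so \<open>m_Z\<close> exists.\<close>

lemma m_Z_props:
  assumes es: "es \<in> permutations_of_set (complete_arcs n)" and n: "2 \<le> n"
    and zero: "2 \<le> card {v \<in> {1..n}. in_deg es m0 v = 0}"
  shows "m_Z n es \<le> n * (n - 1)" "m0 \<le> m_Z n es"
    "\<exists>z\<in>{1..n}. \<forall>v\<in>{1..n} - {z}. 0 < in_deg es (m_Z n es) v"
proof -
  define Z where "Z m = {v \<in> {1..n}. in_deg es m v = 0}" for m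
  have mZ: "m_Z n es = (LEAST m. card (Z m) \<le> 1)"
    using es unfolding Z_def by (intro m_Z_eq) (auto dest: permutations_of_setD)
  have "Z (n * (n - 1)) = {}" using in_deg_full[OF es] n by (auto simp: Z_def)
  then have N: "card (Z (n * (n - 1))) \<le> 1" by simp
  show "m_Z n es \<le> n * (n - 1)" unfolding mZ using N by (rule Least_le)
  have le1: "card (Z (m_Z n es)) \<le> 1" unfolding mZ using N by (rule LeastI)
  have finZ: "finite (Z m)" for m by (simp add: Z_def)
  have anti: "Z m' \<subseteq> Z m" if "m \<le> m'" for m m'
  proof
    fix v assume "v \<in> Z m'"
    then show "v \<in> Z m" using in_deg_mono[OF that, of es v] by (simp add: Z_def)
  qed
  show "m0 \<le> m_Z n es"
  proof (rule ccontr)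
    assume "\<not> m0 \<le> m_Z n es"
    then have "card (Z m0) \<le> card (Z (m_Z n es))" by (intro card_mono finZ anti) auto
    then show False using zero le1 by (simp add: Z_def)
  qed
  have uniq: "v = w" if "v \<in> Z (m_Z n es)" "w \<in> Z (m_Z n es)" for v w
    using le1 card_le_Suc0_iff_eq[OF finZ] that by auto
  \<comment> \<open>If every vertex has an in-arc, any vertex can be the root, and 1 is
    picked.\<close>
  define z where "z = (if Z (m_Z n es) = {} then 1 else SOME z. z \<in> Z (m_Z n es))"
  have z: "z \<in> Z (m_Z n es)" if "Z (m_Z n es) \<noteq> {}"
    using that some_in_eq[of "Z (m_Z n es)"] by (simp add: z_def)
  have "z \<in> {1..n}"
  proof (cases "Z (m_Z n es) = {}")
    case True
    then show ?thesis using n by (simp add: z_def)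
  next
    case False
    then show ?thesis using z by (simp add: Z_def)
  qed
  moreover have "0 < in_deg es (m_Z n es) v" if v: "v \<in> {1..n} - {z}" for v
  proof (rule ccontr)
    assume "\<not> 0 < in_deg es (m_Z n es) v"
    then have "v \<in> Z (m_Z n es)" using v by (simp add: Z_def)
    then show False using uniq[of v z] z v by blast
  qed
  ultimately show "\<exists>z\<in>{1..n}. \<forall>v\<in>{1..n} - {z}. 0 < in_deg es (m_Z n es) v" by blast
qed

section \<open>Independence of the in-lists\<close>

text \<open>Drawing until \<open>A\<close> is exhausted produces a uniform ordering, and the
  interleaved colour draws commute past the later draws of tails.\<close>

lemma sample_conv_zip:
  assumes "finite A"
  shows "sample W (card A) A = bind_pmf (pmf_of_set (permutations_of_set A))
     (\<lambda>xs. map_pmf (zip xs) (replicate_pmf (card A) (pmf_of_set W)))"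
  using assms
proof (induction "card A" arbitrary: A)
  case 0
  then have "A = {}" by simp
  then show ?case by (simp add: pmf_of_set_singleton bind_return_pmf)
next
  case (Suc n)
  then have ne: "A \<noteq> {}" by auto
  have c: "card (A - {x}) = n" if "x \<in> A" for x using Suc that by simp
  have "sample W (card A) A = bind_pmf (pmf_of_set A) (\<lambda>u. bind_pmf (pmf_of_set W)
      (\<lambda>c. map_pmf ((#) (u, c)) (sample W n (A - {u}))))"
    using Suc(2)[symmetric] by simp
  also have "\<dots> = bind_pmf (pmf_of_set A) (\<lambda>u. bind_pmf (pmf_of_set W) (\<lambda>c.
      bind_pmf (pmf_of_set (permutations_of_set (A - {u}))) (\<lambda>xs.
      map_pmf (\<lambda>cs. (u, c) # zip xs cs) (replicate_pmf n (pmf_of_set W)))))"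
  proof (intro bind_pmf_cong refl)
    fix u c assume "u \<in> set_pmf (pmf_of_set A)"
    then have u: "u \<in> A" using ne Suc.prems by simp
    have "sample W n (A - {u}) = bind_pmf (pmf_of_set (permutations_of_set (A - {u})))
        (\<lambda>xs. map_pmf (zip xs) (replicate_pmf n (pmf_of_set W)))"
      using Suc(1)[of "A - {u}"] Suc.prems c[OF u] by simp
    then show "map_pmf ((#) (u, c)) (sample W n (A - {u})) = bind_pmf (pmf_of_set (permutations_of_set (A - {u}))) (\<lambda>xs.
      map_pmf (\<lambda>cs. (u, c) # zip xs cs) (replicate_pmf n (pmf_of_set W)))"
      by (simp add: map_bind_pmf pmf.map_comp o_def)
  qed
  also have "\<dots> = bind_pmf (pmf_of_set A) (\<lambda>u.
      bind_pmf (pmf_of_set (permutations_of_set (A - {u}))) (\<lambda>xs. bind_pmf (pmf_of_set W) (\<lambda>c.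
      map_pmf (\<lambda>cs. (u, c) # zip xs cs) (replicate_pmf n (pmf_of_set W)))))"
    by (intro bind_pmf_cong refl bind_commute_pmf)
  also have "\<dots> = bind_pmf (pmf_of_set (permutations_of_set A))
     (\<lambda>xs. map_pmf (zip xs) (replicate_pmf (card A) (pmf_of_set W)))"
    unfolding random_permutation_of_set[OF Suc.prems ne] Suc(2)[symmetric]
    by (simp add: bind_assoc_pmf bind_return_pmf map_bind_pmf pmf.map_comp o_def map_pmf_def)
  finally show ?case .
qed

lemma map_Pi_pmf_distinct_list:
  fixes xs :: "'x list" and p :: "'y pmf"
  assumes "distinct xs"
  shows "map_pmf (\<lambda>c. map c xs) (Pi_pmf (set xs) d (\<lambda>_. p)) = replicate_pmf (length xs) p"
  using assms
proof (induction xs)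
  case (Cons x xs)
  have "map_pmf (\<lambda>c. map c (x # xs)) (Pi_pmf (set (x # xs)) d (\<lambda>_. p))
      = bind_pmf p (\<lambda>y. map_pmf (\<lambda>f. y # map (f(x := y)) xs) (Pi_pmf (set xs) d (\<lambda>_. p)))"
    using Cons.prems by (simp add: Pi_pmf_insert_first map_bind_pmf pmf.map_comp o_def)
  also have "\<dots> = bind_pmf p (\<lambda>y. map_pmf ((#) y) (map_pmf (\<lambda>f. map f xs) (Pi_pmf (set xs) d (\<lambda>_. p))))"
  proof -
    have "map (f(x := y)) xs = map f xs" for f :: "'x \<Rightarrow> 'y" and y using Cons.prems by (intro map_cong) auto
    then show ?thesis by (simp only: pmf.map_comp o_def)
  qed
  also have "\<dots> = replicate_pmf (length (x # xs)) p"
    using Cons by (simp add: map_pmf_def)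
  finally show ?case .
qed simp

lemma map_random_permutes:
  assumes "finite A" "xs \<in> permutations_of_set A"
  shows "map_pmf (\<lambda>t. map t xs) (pmf_of_set {t. t permutes A}) = pmf_of_set (permutations_of_set A)"
proof -
  have xs: "set xs = A" "distinct xs" using assms(2) by (auto dest: permutations_of_setD)
  have inj: "inj_on (\<lambda>t. map t xs) {t. t permutes A}"
  proof (rule inj_onI)
    fix s t assume s: "s \<in> {t. t permutes A}" and t: "t \<in> {t. t permutes A}" and eq: "map s xs = map t xs"
    show "s = t"
    proof
      fix x show "s x = t x"
        using eq s t xs(1) by (cases "x \<in> A") (auto simp: permutes_not_in)
    qed
  qed
  have sub: "(\<lambda>t. map t xs) ` {t. t permutes A} \<subseteq> permutations_of_set A"
  proof clarify
    fix t assume t: "t permutes A"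
    have "inj_on t A" using permutes_inj_on[OF t] .
    then show "map t xs \<in> permutations_of_set A"
      using xs permutes_image[OF t] by (intro permutations_of_setI) (auto simp: distinct_map)
  qed
  have "card ((\<lambda>t. map t xs) ` {t. t permutes A}) = card (permutations_of_set A)"
    using assms(1) card_permutations[OF refl assms(1)] by (simp add: card_image[OF inj])
  then have "(\<lambda>t. map t xs) ` {t. t permutes A} = permutations_of_set A"
    using sub by (intro card_subset_eq) auto
  moreover have "{t. t permutes A} \<noteq> {}" using permutes_id by blast
  ultimately show ?thesis using inj assms(1) finite_permutations[OF assms(1)] by (simp add: map_pmf_of_set_inj)
qed

text \<open>The tail is relabelled by \<open>t\<close>, but the colour is still looked up at the
  original arc \<open>(u, v)\<close>. Thus a single colouring, independent of the relabelling,
  supplies the colours.\<close>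

lemma sample_conv_permutes:
  assumes "finite A" "xs \<in> permutations_of_set A"
  shows "sample W (card A) A = bind_pmf (pmf_of_set {t. t permutes A})
    (\<lambda>t. map_pmf (\<lambda>c. map (\<lambda>u. (t u, c (u, v))) xs) (Pi_pmf (A \<times> {v}) d (\<lambda>_. pmf_of_set W)))"
proof -
  have xs: "set xs = A" "distinct xs" "length xs = card A"
    using assms(2) by (auto dest: permutations_of_setD length_finite_permutations_of_set)
  define ys where "ys = map (\<lambda>u. (u, v)) xs"
  have ys: "distinct ys" "set ys = A \<times> {v}" "length ys = card A"
    using xs by (auto simp: ys_def distinct_map inj_on_def)
  have z: "map (\<lambda>u. (t u, c (u, v))) xs = zip (map t xs) (map c ys)" for t c
    by (simp add: ys_def zip_map_map o_def zip_same_conv_map)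
  have "bind_pmf (pmf_of_set {t. t permutes A})
      (\<lambda>t. map_pmf (\<lambda>c. map (\<lambda>u. (t u, c (u, v))) xs) (Pi_pmf (A \<times> {v}) d (\<lambda>_. pmf_of_set W)))
    = bind_pmf (pmf_of_set {t. t permutes A})
      (\<lambda>t. map_pmf (zip (map t xs)) (map_pmf (\<lambda>c. map c ys) (Pi_pmf (set ys) d (\<lambda>_. pmf_of_set W))))"
    by (simp only: z ys(2) pmf.map_comp o_def)
  also have "\<dots> = bind_pmf (map_pmf (\<lambda>t. map t xs) (pmf_of_set {t. t permutes A}))
      (\<lambda>zs. map_pmf (zip zs) (replicate_pmf (card A) (pmf_of_set W)))"
    unfolding map_Pi_pmf_distinct_list[OF ys(1)] ys(3) by (simp add: bind_map_pmf)
  also have "\<dots> = sample W (card A) A"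
    unfolding map_random_permutes[OF assms] sample_conv_zip[OF assms(1)] ..
  finally show ?thesis ..
qed

text \<open>Regroups an independent family into independent blocks; in the application the blocks
  are the arcs with a common head and \<open>ix\<close> reads off the head.\<close>

lemma Pi_pmf_UN:
  fixes A :: "'v \<Rightarrow> 'e set" and d :: 'p
  assumes "finite H" "\<And>v. v \<in> H \<Longrightarrow> finite (A v)" "\<And>v e. v \<in> H \<Longrightarrow> e \<in> A v \<Longrightarrow> ix e = v"
  shows "Pi_pmf (\<Union>v\<in>H. A v) d (\<lambda>_. p) =
    map_pmf (\<lambda>g e. if e \<in> (\<Union>v\<in>H. A v) then g (ix e) e else d) (Pi_pmf H d' (\<lambda>v. Pi_pmf (A v) d (\<lambda>_. p)))"
  using assms
proof (induction H)
  case (insert x H)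
  let ?AH = "\<Union>v\<in>H. A v" and ?P = "Pi_pmf H d' (\<lambda>v. Pi_pmf (A v) d (\<lambda>_. p))"
  have disj: "A x \<inter> ?AH = {}"
  proof (rule ccontr)
    assume "A x \<inter> ?AH \<noteq> {}"
    then obtain e v where "e \<in> A x" "v \<in> H" "e \<in> A v" by blast
    then have "x = v" using insert.prems(2)[of x e] insert.prems(2)[of v e] by simp
    then show False using \<open>v \<in> H\<close> insert.hyps by simp
  qed
  have IH: "Pi_pmf ?AH d (\<lambda>_. p) = map_pmf (\<lambda>g e. if e \<in> ?AH then g (ix e) e else d) ?P"
    using insert.prems by (intro insert.IH) auto
  have "Pi_pmf (\<Union>v\<in>insert x H. A v) d (\<lambda>_. p) = Pi_pmf (A x \<union> ?AH) d (\<lambda>_. p)" by simp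
  also have "\<dots> = map_pmf (\<lambda>(f, g) e. if e \<in> A x then f e else g e)
      (pair_pmf (Pi_pmf (A x) d (\<lambda>_. p)) (Pi_pmf ?AH d (\<lambda>_. p)))"
    using insert.hyps insert.prems disj by (intro Pi_pmf_union) auto
  also have "\<dots> = map_pmf (\<lambda>(y, g) e. if e \<in> A x then y e else if e \<in> ?AH then g (ix e) e else d)
      (pair_pmf (Pi_pmf (A x) d (\<lambda>_. p)) ?P)"
    unfolding IH pair_map_pmf2 pmf.map_comp by (intro map_pmf_cong refl) (auto simp: o_def)
  also have "\<dots> = map_pmf (\<lambda>(y, f) e. if e \<in> (\<Union>v\<in>insert x H. A v) then (f(x := y)) (ix e) e else d)
      (pair_pmf (Pi_pmf (A x) d (\<lambda>_. p)) ?P)"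
  proof (intro map_pmf_cong refl)
    fix yg :: "('e \<Rightarrow> 'p) \<times> ('v \<Rightarrow> 'e \<Rightarrow> 'p)"
    obtain y g where yg: "yg = (y, g)" by (cases yg)
    have "(if e \<in> A x then y e else if e \<in> ?AH then g (ix e) e else d)
        = (if e \<in> (\<Union>v\<in>insert x H. A v) then (g(x := y)) (ix e) e else d)" for e
    proof (cases "e \<in> A x")
      case True
      then show ?thesis using insert.prems(2)[of x e] by simp
    next
      case False
      show ?thesis
      proof (cases "e \<in> ?AH")
        case True
        then obtain v where "v \<in> H" "e \<in> A v" by blast
        then have "ix e \<noteq> x" using insert.prems(2)[of v e] insert.hyps by auto
        then show ?thesis using True False by simp
      qed (use False in simp)
    qed
    then show "(case yg of (y, g) \<Rightarrow> \<lambda>e. if e \<in> A x then y e else if e \<in> ?AH then g (ix e) e else d)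
      = (case yg of (y, f) \<Rightarrow> \<lambda>e. if e \<in> (\<Union>v\<in>insert x H. A v) then (f(x := y)) (ix e) e else d)"
      unfolding yg prod.case by (rule ext)
  qed
  also have "\<dots> = map_pmf (\<lambda>g e. if e \<in> (\<Union>v\<in>insert x H. A v) then g (ix e) e else d)
      (Pi_pmf (insert x H) d' (\<lambda>v. Pi_pmf (A v) d (\<lambda>_. p)))"
    unfolding Pi_pmf_insert[OF insert.hyps] pmf.map_comp by (intro map_pmf_cong refl) auto
  finally show ?case .
qed simp

section \<open>Symmetrisation by relabelling tails\<close>

definition in_tails :: "('a \<times> 'b) list \<Rightarrow> 'b \<Rightarrow> 'a list" where
  "in_tails es v = map fst (filter (\<lambda>e. snd e = v) es)"

text \<open>Relabelling the tails at every vertex by independent uniform permutations preserves the law of the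
  process and the order of the heads. For a fixed arc order it makes the in-lists independent
  samples.\<close>

definition relabel :: "('v \<Rightarrow> 'a \<Rightarrow> 'a) \<Rightarrow> 'a \<times> 'v \<Rightarrow> 'a \<times> 'v" where
  "relabel \<tau> e = (\<tau> (snd e) (fst e), snd e)"

text \<open>The default \<open>id\<close> makes \<open>relabel\<close> act trivially at heads
  outside \<open>{1..n}\<close>, so that it is a permutation in the sense of
  \<open>permutes\<close>.\<close>

definition random_relabelling :: "nat \<Rightarrow> (nat \<Rightarrow> nat \<Rightarrow> nat) pmf" where
  "random_relabelling n = Pi_pmf {1..n} id (\<lambda>v. pmf_of_set {t. t permutes ({1..n} - {v})})"

lemma complete_arcs_UN: "complete_arcs n = (\<Union>v\<in>{1..n}. ({1..n} - {v}) \<times> {v})"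
  by (auto simp: complete_arcs_def)

lemma in_tails_permutation:
  assumes "es \<in> permutations_of_set (complete_arcs n)" "v \<in> {1..n}"
  shows "in_tails es v \<in> permutations_of_set ({1..n} - {v})"
proof -
  have es: "set es = complete_arcs n" "distinct es" using assms(1) by (auto dest: permutations_of_setD)
  have "distinct (in_tails es v)"
    using es(2) by (auto simp: in_tails_def distinct_map inj_on_def)
  moreover have "set (in_tails es v) = {1..n} - {v}"
    using es(1) assms(2) by (force simp: in_tails_def complete_arcs_def)
  ultimately show ?thesis by (intro permutations_of_setI)
qed

text \<open>With the order \<open>es\<close> fixed, all randomness sits in \<open>\<tau>\<close> and
  \<open>c\<close>. Both split into independent parts according to the head, and within one head a
  uniform permutation of the tails with independent colours is an exhaustive sample.\<close>

lemma in_lists_law: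
  assumes es: "es \<in> permutations_of_set (complete_arcs n)"
  shows "bind_pmf (random_relabelling n) (\<lambda>\<tau>. map_pmf
      (\<lambda>c v. if v \<in> {1..n} then map (\<lambda>u. (\<tau> v u, c (u, v))) (in_tails es v) else [])
      (Pi_pmf (complete_arcs n) undefined (\<lambda>_. pmf_of_set W)))
    = Pi_pmf {1..n} [] (\<lambda>v. sample W (n - 1) ({1..n} - {v}))"
proof -
  let ?A = "\<lambda>v. ({1..n} - {v}) \<times> {v}"
  let ?Q = "Pi_pmf {1..n} (\<lambda>_. undefined) (\<lambda>v. Pi_pmf (?A v) undefined (\<lambda>_. pmf_of_set W))"
  have Col: "Pi_pmf (complete_arcs n) undefined (\<lambda>_. pmf_of_set W)
     = map_pmf (\<lambda>g e. if e \<in> complete_arcs n then g (snd e) e else undefined) ?Q"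
    unfolding complete_arcs_UN by (rule Pi_pmf_UN) auto
  have L: "set (in_tails es v) = {1..n} - {v}" if "v \<in> {1..n}" for v
    using permutations_of_setD[OF in_tails_permutation[OF es that]] by simp
  have "Pi_pmf {1..n} [] (\<lambda>v. sample W (n - 1) ({1..n} - {v}))
     = Pi_pmf {1..n} [] (\<lambda>v. bind_pmf (pmf_of_set {t. t permutes ({1..n} - {v})})
      (\<lambda>t. map_pmf (\<lambda>c. map (\<lambda>u. (t u, c (u, v))) (in_tails es v)) (Pi_pmf (?A v) undefined (\<lambda>_. pmf_of_set W))))"
  proof (rule Pi_pmf_cong)
    fix v assume v: "v \<in> {1..n}"
    have "n - 1 = card ({1..n} - {v})" using v by simp
    then show "sample W (n - 1) ({1..n} - {v}) = bind_pmf (pmf_of_set {t. t permutes ({1..n} - {v})})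
      (\<lambda>t. map_pmf (\<lambda>c. map (\<lambda>u. (t u, c (u, v))) (in_tails es v)) (Pi_pmf (?A v) undefined (\<lambda>_. pmf_of_set W)))"
      using sample_conv_permutes[OF _ in_tails_permutation[OF es v]] by simp
  qed auto
  also have "\<dots> = bind_pmf (random_relabelling n) (\<lambda>\<tau>. Pi_pmf {1..n} [] (\<lambda>v.
      map_pmf (\<lambda>c. map (\<lambda>u. (\<tau> v u, c (u, v))) (in_tails es v)) (Pi_pmf (?A v) undefined (\<lambda>_. pmf_of_set W))))"
    unfolding random_relabelling_def by (rule Pi_pmf_bind) simp
  also have "\<dots> = bind_pmf (random_relabelling n) (\<lambda>\<tau>. map_pmf
      (\<lambda>g v. if v \<in> {1..n} then map (\<lambda>u. (\<tau> v u, g v (u, v))) (in_tails es v) else []) ?Q)"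
    by (subst Pi_pmf_map_dependent[where d' = "\<lambda>_. undefined"]) auto
  also have "\<dots> = bind_pmf (random_relabelling n) (\<lambda>\<tau>. map_pmf
      (\<lambda>c v. if v \<in> {1..n} then map (\<lambda>u. (\<tau> v u, c (u, v))) (in_tails es v) else [])
      (Pi_pmf (complete_arcs n) undefined (\<lambda>_. pmf_of_set W)))"
    unfolding Col pmf.map_comp
  proof (intro bind_pmf_cong map_pmf_cong refl ext)
    fix \<tau> g v
    show "(if v \<in> {1..n} then map (\<lambda>u. (\<tau> v u, g v (u, v))) (in_tails es v) else []) =
      ((\<lambda>c v. if v \<in> {1..n} then map (\<lambda>u. (\<tau> v u, c (u, v))) (in_tails es v) else [])
        \<circ> (\<lambda>g e. if e \<in> complete_arcs n then g (snd e) e else undefined)) g v"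
      using L[of v] by (auto simp: complete_arcs_def intro!: map_cong)
  qed
  finally show ?thesis ..
qed

lemma relabel_permutes:
  assumes "\<tau> \<in> set_pmf (random_relabelling n)"
  shows "relabel \<tau> permutes complete_arcs n"
proof -
  have fin: "finite {t. t permutes ({1..n} - {v})}" for v by (intro finite_permutations) simp
  have ne: "{t. t permutes ({1..n} - {v})} \<noteq> {}" for v using permutes_id by blast
  have \<tau>: "\<tau> v permutes ({1..n} - {v})" if "v \<in> {1..n}" for v
    using assms that fin ne by (auto simp: random_relabelling_def set_Pi_pmf PiE_dflt_def)
  have \<tau>id: "\<tau> v = id" if "v \<notin> {1..n}" for v
    using assms that by (auto simp: random_relabelling_def set_Pi_pmf PiE_dflt_def)
  have per: "\<tau> v permutes ({1..n} - {v})" for v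
    using \<tau>[of v] \<tau>id[of v] permutes_id by (cases "v \<in> {1..n}") auto
  have out: "relabel \<tau> e = e" if "e \<notin> complete_arcs n" for e
  proof (cases "snd e \<in> {1..n}")
    case True
    then have "fst e \<notin> {1..n} - {snd e}" using that by (cases e) (auto simp: complete_arcs_def)
    then show ?thesis using permutes_not_in[OF per] by (simp add: relabel_def)
  next
    case False
    then show ?thesis using \<tau>id by (simp add: relabel_def)
  qed
  have "inj (relabel \<tau>)"
    using permutes_inj[OF per] by (auto simp: inj_def relabel_def prod_eq_iff)
  moreover have "relabel \<tau> ` complete_arcs n \<subseteq> complete_arcs n"
  proof
    fix e assume "e \<in> relabel \<tau> ` complete_arcs n"
    then obtain u v where uv: "u \<in> {1..n} - {v}" "v \<in> {1..n}" "e = (\<tau> v u, v)"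
      by (auto simp: complete_arcs_def relabel_def)
    have "\<tau> v u \<in> {1..n} - {v}" using permutes_in_image[OF per, of v u] uv by simp
    then show "e \<in> complete_arcs n" using uv by (auto simp: complete_arcs_def)
  qed
  ultimately have "bij_betw (relabel \<tau>) (complete_arcs n) (complete_arcs n)"
    using endo_inj_surj[of "complete_arcs n" "relabel \<tau>"] inj_on_subset[of "relabel \<tau>" UNIV]
    by (auto simp: bij_betw_def)
  then show ?thesis using out by (rule bij_imp_permutes)
qed

text \<open>The colour travels with its arc, hence the composition with \<open>inv \<sigma>\<close>;
  both factors of the process are invariant under a permutation of the arcs.\<close>

lemma coloured_process_relabel:
  assumes "\<sigma> permutes complete_arcs n"
  shows "map_pmf (\<lambda>(es, c). (map \<sigma> es, c \<circ> inv \<sigma>)) (coloured_process n W) = coloured_process n W"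
proof -
  have inj: "inj_on (map \<sigma>) X" for X
    using permutes_inj[OF assms] by (auto simp: inj_on_def)
  have 1: "map_pmf (map \<sigma>) (pmf_of_set (permutations_of_set (complete_arcs n)))
      = pmf_of_set (permutations_of_set (complete_arcs n))"
    by (subst map_pmf_of_set_inj[OF inj]) (simp_all add: permutations_of_set_image_permutes[OF assms])
  have inv: "inv \<sigma> permutes complete_arcs n" using assms by (rule permutes_inv)
  have 2: "map_pmf (\<lambda>c. c \<circ> inv \<sigma>) (Pi_pmf (complete_arcs n) undefined (\<lambda>_. pmf_of_set W))
      = Pi_pmf (complete_arcs n) undefined (\<lambda>_. pmf_of_set W)"
    by (rule Pi_pmf_bij_betw[symmetric])
      (use permutes_imp_bij[OF inv] permutes_in_image[OF inv] in auto)
  have "map_pmf (\<lambda>(es, c). (map \<sigma> es, c \<circ> inv \<sigma>)) (coloured_process n W)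
     = pair_pmf (map_pmf (map \<sigma>) (pmf_of_set (permutations_of_set (complete_arcs n))))
         (map_pmf (\<lambda>c. c \<circ> inv \<sigma>) (Pi_pmf (complete_arcs n) undefined (\<lambda>_. pmf_of_set W)))"
    by (simp add: coloured_process_def map_pair)
  then show ?thesis by (simp add: 1 2 coloured_process_def)
qed

text \<open>For every fixed \<open>\<tau>\<close> the probability is unchanged, hence also on
  average. On the right \<open>es\<close> is drawn before \<open>\<tau>\<close>, so one may
  condition on the arc order, which fixes the heads, and keep the tails random.\<close>

lemma coloured_process_symmetrised:
  "measure_pmf.prob (coloured_process n W) {(es, c). B es c} =
   measure_pmf.prob (bind_pmf (pmf_of_set (permutations_of_set (complete_arcs n)))
      (\<lambda>es. bind_pmf (random_relabelling n) (\<lambda>\<tau>. map_pmf (\<lambda>c. (es, \<tau>, c))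
         (Pi_pmf (complete_arcs n) undefined (\<lambda>_. pmf_of_set W)))))
     {(es, \<tau>, c). B (map (relabel \<tau>) es) (c \<circ> inv (relabel \<tau>))}"
proof -
  let ?Col = "Pi_pmf (complete_arcs n) undefined (\<lambda>_. pmf_of_set W)"
  let ?Perm = "pmf_of_set (permutations_of_set (complete_arcs n))"
  let ?E = "{(es, \<tau>, c). B (map (relabel \<tau>) es) (c \<circ> inv (relabel \<tau>))}"
  have "bind_pmf ?Perm (\<lambda>es. bind_pmf (random_relabelling n) (\<lambda>\<tau>. map_pmf (\<lambda>c. (es, \<tau>, c)) ?Col))
     = bind_pmf (random_relabelling n) (\<lambda>\<tau>. bind_pmf ?Perm (\<lambda>es. map_pmf (\<lambda>c. (es, \<tau>, c)) ?Col))"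
    by (rule bind_commute_pmf)
  also have "\<dots> = bind_pmf (random_relabelling n) (\<lambda>\<tau>. map_pmf (\<lambda>(es, c). (es, \<tau>, c)) (coloured_process n W))"
    by (simp add: coloured_process_def pair_pmf_def map_bind_pmf map_pmf_def bind_assoc_pmf bind_return_pmf)
  also have "measure_pmf.prob \<dots> ?E = measure_pmf.expectation (random_relabelling n)
      (\<lambda>\<tau>. measure_pmf.prob (coloured_process n W) {(es, c). B es c})"
    unfolding prob_bind_pmf
  proof (intro integral_cong_AE, simp, simp, unfold AE_measure_pmf_iff, intro ballI)
    fix \<tau> assume "\<tau> \<in> set_pmf (random_relabelling n)"
    from coloured_process_relabel[OF relabel_permutes[OF this], of W]
    have "measure_pmf.prob (coloured_process n W) {(es, c). B es c}
      = measure_pmf.prob (map_pmf (\<lambda>(es, c). (map (relabel \<tau>) es, c \<circ> inv (relabel \<tau>))) (coloured_process n W)) {(es, c). B es c}"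
      by simp
    then show "measure_pmf.prob (map_pmf (\<lambda>(es, c). (es, \<tau>, c)) (coloured_process n W)) ?E
      = measure_pmf.prob (coloured_process n W) {(es, c). B es c}"
      by (simp add: vimage_def case_prod_beta')
  qed
  also have "\<dots> = measure_pmf.prob (coloured_process n W) {(es, c). B es c}" by simp
  finally show ?thesis by (rule sym)
qed

section \<open>The probability of a bad outcome\<close>

definition good_outcome :: "nat \<Rightarrow> (nat \<times> nat) list \<Rightarrow> (nat \<times> nat \<Rightarrow> 'c) \<Rightarrow> bool" where
  "good_outcome n es c \<longleftrightarrow> (\<exists>m \<le> n * (n - 1). has_rainbow_arborescence c (digraph_at n es m)) \<and>
     m_R n es c = m_A n es \<and> m_A n es = m_Z n es"

lemma good_outcomeI:
  assumes es: "es \<in> permutations_of_set (complete_arcs n)" and le: "m_Z n es \<le> n * (n - 1)"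
    and rainbow: "has_rainbow_arborescence c (digraph_at n es (m_Z n es))"
  shows "good_outcome n es c"
proof -
  have weaken: "has_arborescence G" if "has_rainbow_arborescence c G" for G
    using that unfolding has_rainbow_arborescence_def has_arborescence_def by blast
  have Zle: "m_Z n es \<le> m" if "has_arborescence (digraph_at n es m)" for m
  proof -
    have "finite (parcs (digraph_at n es m))" by (simp add: digraph_at_def)
    from has_arborescence_indegree_zero[OF that this] obtain u where
      "{v \<in> {1..n}. in_degree (with_proj (digraph_at n es m)) v = 0} \<subseteq> {u}"
      by (auto simp: digraph_at_def)
    then have "card {v \<in> {1..n}. in_degree (with_proj (digraph_at n es m)) v = 0} \<le> card {u}"
      by (rule card_mono[rotated]) simp
    then show ?thesis unfolding m_Z_def by (intro Least_le) simp
  qed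
  have A: "m_A n es = m_Z n es"
    unfolding m_A_def
  proof (rule Least_equality)
    show "has_arborescence (digraph_at n es (m_Z n es))" using rainbow by (rule weaken)
  qed (rule Zle)
  have R: "m_R n es c = m_Z n es"
    unfolding m_R_def
  proof (rule Least_equality)
    show "m_Z n es \<le> m" if "has_rainbow_arborescence c (digraph_at n es m)" for m
      using that by (intro Zle weaken)
  qed (rule rainbow)
  show ?thesis unfolding good_outcome_def A R using rainbow le by blast
qed

lemma take_filter_prefix: "take (length (filter P (take m xs))) (filter P xs) = filter P (take m xs)"
proof -
  have "filter P xs = filter P (take m xs) @ filter P (drop m xs)"
    by (metis append_take_drop_id filter_append)
  then show ?thesis by simp
qed

lemma in_deg_relabel: "in_deg (map (relabel \<tau>) es) m v = in_deg es m v"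
  by (simp add: in_deg_def take_map filter_map o_def relabel_def)

lemma relabel_permutation:
  assumes "\<sigma> permutes A" "es \<in> permutations_of_set A"
  shows "map \<sigma> es \<in> permutations_of_set A"
  using permutations_of_set_image_permutes[OF assms(1)] assms(2) by blast

lemma m_Z_relabel:
  assumes "es \<in> permutations_of_set (complete_arcs n)" "relabel \<tau> permutes complete_arcs n"
  shows "m_Z n (map (relabel \<tau>) es) = m_Z n es"
  using assms(1) relabel_permutation[OF assms(2,1)]
  by (simp add: m_Z_eq in_deg_relabel permutations_of_setD)

text \<open>The first \<open>in_deg es m v\<close> entries of the in-list of \<open>v\<close> are
  exactly its arcs present at time \<open>m\<close>, so a choice from these prefixes lives in the
  digraph at that time.\<close>

lemma has_rainbow_arborescence_relabel:
  fixes c :: "nat \<times> nat \<Rightarrow> 'c"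
  assumes es: "es \<in> permutations_of_set (complete_arcs n)" and \<sigma>: "relabel \<tau> permutes complete_arcs n"
    and z: "z \<in> {1..n}"
    and ch: "rainbow_choice {1..n} z (\<lambda>v. take (in_deg es m v) (map (\<lambda>u. (\<tau> v u, c (u, v))) (in_tails es v)))"
  shows "has_rainbow_arborescence (c \<circ> inv (relabel \<tau>)) (digraph_at n (map (relabel \<tau>) es) m)"
proof -
  let ?G = "digraph_at n (map (relabel \<tau>) es) m"
  obtain par col rk where inj: "inj_on col ({1..n} - {z})"
    and mem: "\<And>v. v \<in> {1..n} - {z} \<Longrightarrow> (par v, col v) \<in> set (take (in_deg es m v) (map (\<lambda>u. (\<tau> v u, c (u, v))) (in_tails es v)))"
    and rk: "\<And>v. v \<in> {1..n} - {z} \<Longrightarrow> (rk (par v) :: nat) < rk v"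
    using ch unfolding rainbow_choice_def by blast
  have arc: "\<exists>u. (u, v) \<in> set (take m es) \<and> par v = \<tau> v u \<and> col v = c (u, v)" if v: "v \<in> {1..n} - {z}" for v
  proof -
    have "take (in_deg es m v) (in_tails es v) = map fst (filter (\<lambda>e. snd e = v) (take m es))"
      unfolding in_tails_def in_deg_def take_map take_filter_prefix ..
    then have "(par v, col v) \<in> set (map (\<lambda>u. (\<tau> v u, c (u, v))) (map fst (filter (\<lambda>e. snd e = v) (take m es))))"
      using mem[OF v] by (simp only: take_map)
    then show ?thesis by auto
  qed
  have perm: "map (relabel \<tau>) es \<in> permutations_of_set (complete_arcs n)"
    by (rule relabel_permutation[OF \<sigma> es])
  have sub: "parcs ?G \<subseteq> complete_arcs n"
    using permutations_of_setD(1)[OF perm] set_take_subset[of m "map (relabel \<tau>) es"] by (simp add: digraph_at_def)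
  have pv: "pverts ?G = {1..n}" by (simp add: digraph_at_def)
  have wf: "pair_wf_digraph ?G"
    using sub unfolding pv[symmetric] by unfold_locales (auto simp: complete_arcs_def pv)
  have parc: "(par v, v) \<in> parcs ?G \<and> (c \<circ> inv (relabel \<tau>)) (par v, v) = col v" if v: "v \<in> {1..n} - {z}" for v
  proof -
    obtain u where u: "(u, v) \<in> set (take m es)" "par v = \<tau> v u" "col v = c (u, v)" using arc[OF v] by blast
    have eq: "(par v, v) = relabel \<tau> (u, v)" using u by (simp add: relabel_def)
    have "(par v, v) \<in> relabel \<tau> ` set (take m es)" unfolding eq using u(1) by (rule imageI)
    then have "(par v, v) \<in> parcs ?G" by (simp add: digraph_at_def take_map)
    moreover have "inv (relabel \<tau>) (par v, v) = (u, v)"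
      unfolding eq by (rule inv_f_f[OF permutes_inj[OF \<sigma>]])
    ultimately show ?thesis using u(3) by simp
  qed
  have "arborescence_of \<lparr> pverts = pverts ?G, parcs = (\<lambda>v. (par v, v)) ` (pverts ?G - {z}) \<rparr> ?G"
    by (rule arborescence_of_parents[OF wf, where rk = rk]) (use z parc rk pv in auto)
  moreover have "inj_on (c \<circ> inv (relabel \<tau>)) ((\<lambda>v. (par v, v)) ` (pverts ?G - {z}))"
    unfolding pv
  proof (rule inj_onI)
    fix e e' assume e: "e \<in> (\<lambda>v. (par v, v)) ` ({1..n} - {z})" "e' \<in> (\<lambda>v. (par v, v)) ` ({1..n} - {z})"
      and eq: "(c \<circ> inv (relabel \<tau>)) e = (c \<circ> inv (relabel \<tau>)) e'"
    obtain v w where vw: "v \<in> {1..n} - {z}" "e = (par v, v)" "w \<in> {1..n} - {z}" "e' = (par w, w)" using e by blast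
    have "col v = col w" using eq parc[OF vw(1)] parc[OF vw(3)] unfolding vw(2,4) by simp
    then have "v = w" using inj_onD[OF inj] vw by blast
    then show "e = e'" using vw by simp
  qed
  ultimately show ?thesis unfolding has_rainbow_arborescence_def
    by (intro exI[of _ "\<lparr> pverts = pverts ?G, parcs = (\<lambda>v. (par v, v)) ` (pverts ?G - {z}) \<rparr>"]) simp
qed

lemma prob_bind_pmf_mono:
  assumes "\<And>x. x \<in> set_pmf p \<Longrightarrow> measure_pmf.prob (f x) E \<le> measure_pmf.prob (g x) E'"
  shows "measure_pmf.prob (bind_pmf p f) E \<le> measure_pmf.prob (bind_pmf p g) E'"
  unfolding prob_bind_pmf
  by (intro integral_mono_AE integrable_pmf_bounded[where B=1]) (auto simp: AE_measure_pmf_iff assms)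

text \<open>Relabelling preserves heads, so \<open>m_Z\<close>, the root and the set of low degree
  are constants once \<open>es\<close> is fixed, and the failure bound for given \<open>z\<close>
  and \<open>S\<close> applies to the remaining randomness.\<close>

lemma prob_bad_outcome_fixed_order:
  fixes W :: "'c set"
  assumes es: "es \<in> permutations_of_set (complete_arcs n)" and n: "2 \<le> n" "3 * k \<le> n - 1"
    and zero: "2 \<le> card {v \<in> {1..n}. in_deg es m0 v = 0}"
    and low: "card {v \<in> {1..n}. in_deg es m0 v \<le> 3 * k} \<le> \<sigma>"
    and bound: "\<And>z S. z \<in> {1..n} \<Longrightarrow> S \<subseteq> {1..n} - {z} \<Longrightarrow> card S \<le> \<sigma> \<Longrightarrow>
      measure_pmf.prob (Pi_pmf ({1..n} - {z}) [] (\<lambda>v. sample W (if v \<in> S then 1 else k + (k + k)) ({1..n} - {v})))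
      {X. \<not> rainbow_choice {1..n} z X} \<le> \<epsilon>"
  shows "measure_pmf.prob (bind_pmf (random_relabelling n) (\<lambda>\<tau>. map_pmf (\<lambda>c. (es, \<tau>, c))
         (Pi_pmf (complete_arcs n) undefined (\<lambda>_. pmf_of_set W))))
     {(es, \<tau>, c). \<not> good_outcome n (map (relabel \<tau>) es) (c \<circ> inv (relabel \<tau>))} \<le> \<epsilon>"
proof -
  define m where "m = m_Z n es"
  note props = m_Z_props[OF es n(1) zero, folded m_def]
  obtain z where z: "z \<in> {1..n}" "\<And>v. v \<in> {1..n} - {z} \<Longrightarrow> 0 < in_deg es m v" using props(3) by blast
  define S where "S = {v \<in> {1..n} - {z}. in_deg es m v \<le> 3 * k}"
  \<comment> \<open>One arc on \<open>S\<close> and three blocks elsewhere: the choice of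
    \<open>z\<close> and \<open>S\<close> ensures that these arcs are present at time
    \<open>m\<close>.\<close>
  define len where "len v = (if v \<in> S then 1 else k + (k + k))" for v
  let ?V = "{1..n}" and ?Col = "Pi_pmf (complete_arcs n) undefined (\<lambda>_. pmf_of_set W)"
  let ?F = "\<lambda>\<tau> c v. if v \<in> ?V then map (\<lambda>u. (\<tau> v u, c (u, v))) (in_tails es v) else []"
  let ?E = "{X. \<not> rainbow_choice ?V z (\<lambda>v. take (in_deg es m v) (X v))}"
  have S: "S \<subseteq> ?V - {z}" by (auto simp: S_def)
  \<comment> \<open>In-degrees only grow after \<open>m0\<close>, so a bound at this fixed time
    controls the low degrees at the random time \<open>m\<close>.\<close>
  have "S \<subseteq> {v \<in> ?V. in_deg es m0 v \<le> 3 * k}"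
    using in_deg_mono[OF props(2), of es] by (force simp: S_def intro: order_trans)
  then have "card S \<le> card {v \<in> ?V. in_deg es m0 v \<le> 3 * k}" by (intro card_mono) auto
  then have cS: "card S \<le> \<sigma>" using low by simp
  have len: "len v \<le> in_deg es m v" "len v \<le> n - 1" if "v \<in> ?V - {z}" for v
  proof -
    show "len v \<le> in_deg es m v" using z(2)[OF that] that by (auto simp: len_def S_def)
    show "len v \<le> n - 1" using n by (auto simp: len_def)
  qed
  have "measure_pmf.prob (bind_pmf (random_relabelling n) (\<lambda>\<tau>. map_pmf (\<lambda>c. (es, \<tau>, c)) ?Col))
      {(es, \<tau>, c). \<not> good_outcome n (map (relabel \<tau>) es) (c \<circ> inv (relabel \<tau>))}
    \<le> measure_pmf.prob (bind_pmf (random_relabelling n) (\<lambda>\<tau>. map_pmf (?F \<tau>) ?Col)) ?E"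
  proof (rule prob_bind_pmf_mono)
    fix \<tau> assume "\<tau> \<in> set_pmf (random_relabelling n)"
    then have per: "relabel \<tau> permutes complete_arcs n" by (rule relabel_permutes)
    have mZ: "m_Z n (map (relabel \<tau>) es) = m" unfolding m_def by (rule m_Z_relabel[OF es per])
    have "good_outcome n (map (relabel \<tau>) es) (c \<circ> inv (relabel \<tau>))" if "?F \<tau> c \<notin> ?E" for c
    proof (rule good_outcomeI[OF relabel_permutation[OF per es]])
      show "m_Z n (map (relabel \<tau>) es) \<le> n * (n - 1)" unfolding mZ by (rule props(1))
      have "rainbow_choice ?V z (\<lambda>v. take (in_deg es m v) (?F \<tau> c v))" using that by blast
      then have "rainbow_choice ?V z (\<lambda>v. take (in_deg es m v) (map (\<lambda>u. (\<tau> v u, c (u, v))) (in_tails es v)))"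
        by (rule rainbow_choice_mono) auto
      then show "has_rainbow_arborescence (c \<circ> inv (relabel \<tau>)) (digraph_at n (map (relabel \<tau>) es) (m_Z n (map (relabel \<tau>) es)))"
        unfolding mZ by (rule has_rainbow_arborescence_relabel[OF es per z(1)])
    qed
    then show "measure_pmf.prob (map_pmf (\<lambda>c. (es, \<tau>, c)) ?Col)
        {(es, \<tau>, c). \<not> good_outcome n (map (relabel \<tau>) es) (c \<circ> inv (relabel \<tau>))}
      \<le> measure_pmf.prob (map_pmf (?F \<tau>) ?Col) ?E"
      unfolding measure_map_pmf by (intro measure_pmf.finite_measure_mono) auto
  qed
  also have "\<dots> = measure_pmf.prob (Pi_pmf ?V [] (\<lambda>v. sample W (n - 1) (?V - {v}))) ?E"
    by (simp only: in_lists_law[OF es])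
  also have "\<dots> \<le> measure_pmf.prob (Pi_pmf (?V - {z}) [] (\<lambda>v. sample W (n - 1) (?V - {v})))
      {X. \<not> rainbow_choice ?V z (\<lambda>v. take (len v) (X v))}"
  proof (rule prob_Pi_pmf_subset_le)
    fix X assume X: "X \<in> ?E"
    have "rainbow_choice ?V z (\<lambda>v. take (in_deg es m v) (X v))"
      if "rainbow_choice ?V z (\<lambda>v. take (len v) (if v \<in> ?V - {z} then X v else []))"
      using that
    proof (rule rainbow_choice_mono)
      fix v assume v: "v \<in> ?V - {z}"
      then show "set (take (len v) (if v \<in> ?V - {z} then X v else [])) \<subseteq> set (take (in_deg es m v) (X v))"
        using set_take_subset_set_take[OF len(1)[OF v], of "X v"] by (simp only: if_True)
    qed
    then show "(\<lambda>v. if v \<in> ?V - {z} then X v else []) \<in> {X. \<not> rainbow_choice ?V z (\<lambda>v. take (len v) (X v))}"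
      using X by blast
  qed auto
  also have "\<dots> = measure_pmf.prob (Pi_pmf (?V - {z}) [] (\<lambda>v. sample W (len v) (?V - {v}))) {X. \<not> rainbow_choice ?V z X}"
  proof -
    have "Pi_pmf (?V - {z}) [] (\<lambda>v. sample W (len v) (?V - {v}))
        = Pi_pmf (?V - {z}) [] (\<lambda>v. map_pmf (take (len v)) (sample W (n - 1) (?V - {v})))"
    proof (intro Pi_pmf_cong refl)
      fix v assume v: "v \<in> ?V - {z}"
      have "n - 1 = len v + (n - 1 - len v)" using len(2)[OF v] by simp
      then show "sample W (len v) (?V - {v}) = map_pmf (take (len v)) (sample W (n - 1) (?V - {v}))"
        by (metis map_take_sample)
    qed
    also have "\<dots> = map_pmf (\<lambda>X v. if v \<in> ?V - {z} then take (len v) (X v) else [])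
        (Pi_pmf (?V - {z}) [] (\<lambda>v. sample W (n - 1) (?V - {v})))"
      by (rule Pi_pmf_map_dependent) simp
    finally have eq: "Pi_pmf (?V - {z}) [] (\<lambda>v. sample W (len v) (?V - {v})) = \<dots>" .
    have "rainbow_choice ?V z (\<lambda>v. if v \<in> ?V - {z} then take (len v) (X v) else [])
        \<longleftrightarrow> rainbow_choice ?V z (\<lambda>v. take (len v) (X v))" for X :: "nat \<Rightarrow> (nat \<times> 'c) list"
      by (rule rainbow_choice_cong) auto
    then show ?thesis unfolding eq measure_map_pmf vimage_Collect_eq by (simp only:)
  qed
  also have "\<dots> \<le> \<epsilon>" unfolding len_def by (rule bound[OF z(1) S cS])
  finally show ?thesis .
qed

section \<open>In-degrees at the reference time \<open>m0\<close>\<close>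

definition head_arcs :: "nat \<Rightarrow> nat \<Rightarrow> (nat \<times> nat) set" where
  "head_arcs n v = {e \<in> complete_arcs n. snd e = v}"

text \<open>The second moment method shows that at least two vertices lack in-arcs. The number of
  vertices of low degree is bounded in expectation by Chernoff's method and then by Markov's
  inequality.\<close>

lemma prob_degrees_bad_le:
  fixes \<sigma> :: nat and M :: real
  assumes n: "2 \<le> n" "m0 + 2 * (n - 1) \<le> n * (n - 1)" "3 * k \<le> n - 1" "0 < \<sigma>"
    and M: "2 \<le> M" "M \<le> n * (1 - (real n - 1) / (real (n * (n - 1)) - m0)) ^ m0"
  shows "measure_pmf.prob (pmf_of_set (permutations_of_set (complete_arcs n)))
      {es. \<not> (2 \<le> card {v \<in> {1..n}. in_deg es m0 v = 0} \<and> card {v \<in> {1..n}. in_deg es m0 v \<le> 3 * k} \<le> \<sigma>)}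
    \<le> 4 / M + n * (64 ^ (3 * k) * (1 - (real n - 1 - 3 * real k) / real (n * (n - 1)) * (63 / 64)) ^ m0) / \<sigma>"
proof -
  define N where "N = n * (n - 1)"
  define h where "h = n - 1"
  let ?A = "complete_arcs n" and ?V = "{1..n}"
  let ?P = "pmf_of_set (permutations_of_set ?A)"
  let ?H = "head_arcs n"
  have cA: "card ?A = N" by (simp add: card_complete_arcs N_def)
  have N0: "0 < N" "m0 + 2 * h \<le> N" "1 \<le> h" using n by (auto simp: N_def h_def)
  have H: "?H v \<subseteq> ?A" "finite (?H v)" for v by (auto simp: head_arcs_def)
  have cH: "card (?H v) = h" if "v \<in> ?V" for v using card_in_arcs[OF that] by (simp add: head_arcs_def h_def)
  have set_es: "set es = ?A" "distinct es" if "es \<in> set_pmf ?P" for es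
    using that by (auto dest: permutations_of_setD)
  define E where "E v = {es. set (take m0 es) \<inter> ?H v = {}}" for v
  define p where "p = (\<Prod>i<m0. 1 - h / (real N - real i))"
  have pE: "measure_pmf.prob ?P (E v) = p" if "v \<in> ?V" for v
    unfolding E_def p_def using N0 cH[OF that] H
    by (subst prob_prefix_avoid) (simp_all add: cA)
  have pEE: "measure_pmf.prob ?P (E v \<inter> E w) \<le> p\<^sup>2" if "v \<in> ?V" "w \<in> ?V" "v \<noteq> w" for v w
  proof -
    have c2: "card (?H v \<union> ?H w) = 2 * h"
      using that cH H by (subst card_Un_disjoint) (auto simp: head_arcs_def)
    have "E v \<inter> E w = {es. set (take m0 es) \<inter> (?H v \<union> ?H w) = {}}" by (auto simp: E_def)
    then have "measure_pmf.prob ?P (E v \<inter> E w) = (\<Prod>i<m0. 1 - (2 * h) / (real N - real i))"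
      using N0 c2 H by (simp add: prob_prefix_avoid cA)
    \<comment> \<open>The inequality \<open>1 - 2 * x \<le> (1 - x)\<^sup>2\<close> in each factor:
      lacking in-arcs is nonpositively correlated for two vertices.\<close>
    also have "\<dots> \<le> (\<Prod>i<m0. (1 - h / (real N - real i))\<^sup>2)"
    proof (intro prod_mono conjI)
      fix i assume "i \<in> {..<m0}"
      then have "real (2 * h) \<le> real N - real i" using N0 by simp
      then show "0 \<le> 1 - real (2 * h) / (real N - real i)" using N0 by simp
      show "1 - real (2 * h) / (real N - real i) \<le> (1 - h / (real N - real i))\<^sup>2"
        using power2_diff[of 1 "h / (real N - real i)"] by simp
    qed
    also have "\<dots> = p\<^sup>2" by (simp add: p_def prod_power_distrib)
    finally show ?thesis .
  qed
  define \<mu> where "\<mu> = real (card ?V) * p"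
  have "(1 - (real n - 1) / (real N - m0)) ^ m0 \<le> p"
  proof -
    have "(\<Prod>i<m0. 1 - (real n - 1) / (real N - m0)) \<le> p"
      unfolding p_def
    proof (intro prod_mono conjI)
      fix i assume i: "i \<in> {..<m0}"
      have h: "real h = real n - 1" using n by (simp add: h_def)
      have "real h \<le> real N - m0" using N0 by linarith
      then show "0 \<le> 1 - (real n - 1) / (real N - m0)" using N0 h by simp
      show "1 - (real n - 1) / (real N - m0) \<le> 1 - h / (real N - real i)"
        unfolding h[symmetric] using i N0 by (intro diff_left_mono divide_left_mono mult_pos_pos) auto
    qed
    then show ?thesis by simp
  qed
  then have "n * (1 - (real n - 1) / (real N - m0)) ^ m0 \<le> \<mu>" unfolding \<mu>_def by (simp add: mult_left_mono)
  then have M\<mu>: "M \<le> \<mu>" using M(2) by (simp add: N_def)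
  have zeros: "measure_pmf.prob ?P {es. \<not> 2 \<le> card {v \<in> ?V. in_deg es m0 v = 0}} \<le> 4 / M"
  proof -
    have "measure_pmf.prob ?P {es. \<not> 2 \<le> card {v \<in> ?V. in_deg es m0 v = 0}}
        \<le> measure_pmf.prob ?P {es. card {v \<in> ?V. es \<in> E v} \<le> 1}"
    proof (rule measure_pmf.finite_measure_mono_AE)
      show "AE es in ?P. es \<in> {es. \<not> 2 \<le> card {v \<in> ?V. in_deg es m0 v = 0}} \<longrightarrow> es \<in> {es. card {v \<in> ?V. es \<in> E v} \<le> 1}"
        unfolding AE_measure_pmf_iff
      proof (intro ballI impI)
        fix es assume es: "es \<in> set_pmf ?P" "es \<in> {es. \<not> 2 \<le> card {v \<in> ?V. in_deg es m0 v = 0}}"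
        have "in_deg es m0 v = 0 \<longleftrightarrow> es \<in> E v" for v
          using set_take_subset[of m0 es] set_es(1)[OF es(1)]
          by (auto simp: in_deg_def E_def head_arcs_def filter_empty_conv)
        then show "es \<in> {es. card {v \<in> ?V. es \<in> E v} \<le> 1}" using es(2) by simp
      qed
    qed simp
    also have "\<dots> \<le> \<mu> / (\<mu> - 1)\<^sup>2"
      using M M\<mu> by (intro prob_count_le_1_le[OF _ pE pEE \<mu>_def]) auto
    \<comment> \<open>Since \<open>\<mu> \<ge> 2\<close>, the difference \<open>\<mu> - 1\<close> is
      at least \<open>\<mu> / 2\<close>.\<close>
    also have "\<dots> \<le> 4 / \<mu>"
    proof -
      have "\<mu> * \<mu> \<le> 4 * (\<mu> - 1)\<^sup>2"
      proof -
        have "\<mu> \<le> 2 * (\<mu> - 1)" using M M\<mu> by simp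
        then have "\<mu>\<^sup>2 \<le> (2 * (\<mu> - 1))\<^sup>2" using M M\<mu> by (intro power_mono) auto
        moreover have "(2 * (\<mu> - 1))\<^sup>2 = 4 * (\<mu> - 1)\<^sup>2" by (simp only: power_mult_distrib) simp
        ultimately show ?thesis by (simp only: power2_eq_square[of \<mu>])
      qed
      moreover have "0 < (\<mu> - 1)\<^sup>2" "0 < \<mu>" using M M\<mu> by auto
      ultimately show ?thesis by (simp add: field_simps)
    qed
    also have "\<dots> \<le> 4 / M" using M M\<mu> by (intro divide_left_mono) auto
    finally show ?thesis .
  qed
  define \<pi> where "\<pi> = (real n - 1 - 3 * real k) / real N"
  have lowv: "measure_pmf.prob ?P {es. in_deg es m0 v \<le> 3 * k} \<le> 64 ^ (3 * k) * (1 - \<pi> * (63 / 64)) ^ m0"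
    if v: "v \<in> ?V" for v
  proof -
    \<comment> \<open>The parameter \<open>1 / 64\<close> balances two effects:
      \<open>64 ^ (3 * k)\<close> costs at most \<open>n powr (1 / 20)\<close> when
      \<open>3 * k \<le> l / 100\<close>, while the power with exponent \<open>m0\<close> is close
      to \<open>n powr (- 189 / 256)\<close>, where
      \<open>189 / 256 = 63 / 64 * (3 / 4)\<close>.\<close>
    have "(1 / 64) ^ (3 * k) * measure_pmf.prob ?P {xs. length (filter (\<lambda>x. x \<in> {e. snd e = v}) (take m0 xs)) \<le> 3 * k}
        \<le> (1 - \<pi> * (1 - 1 / 64)) ^ m0"
    proof (rule prob_prefix_count_le)
      have "?A \<inter> {e. snd e = v} = ?H v" by (auto simp: head_arcs_def)
      moreover have "real h = real n - 1" using n by (simp add: h_def)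
      ultimately show "\<pi> * card ?A \<le> real (card (?A \<inter> {e. snd e = v})) - real (3 * k)"
        using N0 cH[OF v] by (simp add: \<pi>_def cA)
      have "real (3 * k) \<le> real (n - 1)" using n by (simp only: of_nat_le_iff)
      then have "real (3 * k) \<le> real n - 1" using n by simp
      then show "0 \<le> \<pi>" by (simp add: \<pi>_def)
    qed (use N0 cA in auto)
    then show ?thesis by (simp add: in_deg_def power_one_over field_simps)
  qed
  have low: "measure_pmf.prob ?P {es. \<not> card {v \<in> ?V. in_deg es m0 v \<le> 3 * k} \<le> \<sigma>}
      \<le> n * (64 ^ (3 * k) * (1 - \<pi> * (63 / 64)) ^ m0) / \<sigma>"
  proof -
    have "measure_pmf.prob ?P {es. real \<sigma> < card {v \<in> ?V. es \<in> {es. in_deg es m0 v \<le> 3 * k}}}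
      \<le> card ?V * (64 ^ (3 * k) * (1 - \<pi> * (63 / 64)) ^ m0) / \<sigma>"
      using n(4) lowv by (intro prob_card_gt_le) auto
    then show ?thesis by (simp add: not_le)
  qed
  have Un: "{es. \<not> (2 \<le> card {v \<in> ?V. in_deg es m0 v = 0} \<and> card {v \<in> ?V. in_deg es m0 v \<le> 3 * k} \<le> \<sigma>)}
     = {es. \<not> 2 \<le> card {v \<in> ?V. in_deg es m0 v = 0}} \<union> {es. \<not> card {v \<in> ?V. in_deg es m0 v \<le> 3 * k} \<le> \<sigma>}" by auto
  have "measure_pmf.prob ?P {es. \<not> (2 \<le> card {v \<in> ?V. in_deg es m0 v = 0} \<and> card {v \<in> ?V. in_deg es m0 v \<le> 3 * k} \<le> \<sigma>)}
    \<le> measure_pmf.prob ?P {es. \<not> 2 \<le> card {v \<in> ?V. in_deg es m0 v = 0}}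
      + measure_pmf.prob ?P {es. \<not> card {v \<in> ?V. in_deg es m0 v \<le> 3 * k} \<le> \<sigma>}"
    unfolding Un by (intro measure_Un_le) simp_all
  also have "\<dots> \<le> 4 / M + n * (64 ^ (3 * k) * (1 - \<pi> * (63 / 64)) ^ m0) / \<sigma>"
    by (intro add_mono zeros low)
  finally show ?thesis unfolding \<pi>_def N_def .
qed

text \<open>The in-degrees at time \<open>m0\<close> depend on \<open>es\<close> alone and form the
  first stage; relabelling and colours form the second.\<close>

lemma prob_bad_outcome_le:
  fixes W :: "'c set" and t \<theta> \<delta> M :: real and n q \<sigma> \<beta> i k m m0 :: nat
  assumes W: "finite W" "card W = q" "n \<le> q"
    and \<beta>: "\<beta> = \<sigma> + 2 * i + 2" "\<beta> + 3 * k + t \<le> n" "2 * k \<le> i"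
    and t: "1 \<le> t" and \<theta>: "0 < \<theta>" "\<theta> \<le> 1" and m: "1 \<le> m"
    and \<delta>: "exp 2 * (real n / q) ^ (m - 1) \<le> \<delta>" "\<delta> \<le> 1 / 2"
    and n: "m0 + 2 * (n - 1) \<le> n * (n - 1)" "0 < \<sigma>"
    and M: "2 \<le> M" "M \<le> n * (1 - (real n - 1) / (real (n * (n - 1)) - m0)) ^ m0"
  shows "measure_pmf.prob (coloured_process n W) {(es, c). \<not> good_outcome n es c}
    \<le> (4 / M + n * (64 ^ (3 * k) * (1 - (real n - 1 - 3 * real k) / real (n * (n - 1)) * (63 / 64)) ^ m0) / \<sigma>)
      + (\<sigma> * (\<sigma> / (real n - 1) + \<sigma> / q)
      + (2 * i * (1 - (real n - \<beta> - k) / n * ((real q - \<beta>) / q)) ^ k + (1 - real k / n * ((real q - \<beta>) / q)) ^ i)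
      + (n * (2 ^ m * (1 - (real i - 2 * k) / n * ((real q - \<beta>) / q) / 2) ^ k) / t
      + n * ((1 - (real n - \<beta> - 3 * k - t) / n * ((real q - \<beta>) / q) * (1 - \<theta>)) ^ k / \<theta> ^ m) + 2 * \<delta>))"
    (is "_ \<le> ?deg + ?\<epsilon>")
proof -
  have "real (\<beta> + 3 * k) + 1 \<le> n" using \<beta>(2) t by simp
  then have "\<beta> + 3 * k + 1 \<le> n" by linarith
  then have n2: "2 \<le> n" "3 * k \<le> n - 1" using \<beta>(1) by auto
  have bound: "measure_pmf.prob (Pi_pmf ({1..n} - {z}) [] (\<lambda>v. sample W (if v \<in> S then 1 else k + (k + k)) ({1..n} - {v})))
      {X. \<not> rainbow_choice {1..n} z X} \<le> ?\<epsilon>"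
    if "z \<in> {1..n}" "S \<subseteq> {1..n} - {z}" "card S \<le> \<sigma>" for z S
    by (rule prob_no_rainbow_choice_le[OF _ that _ W \<beta> t \<theta> m \<delta>]) auto
  have "0 \<le> ?\<epsilon>"
    by (rule order_trans[OF measure_nonneg bound[of 1 "{}"]]) (use n2 in auto)
  have fixed: "measure_pmf.prob (bind_pmf (random_relabelling n) (\<lambda>\<tau>. map_pmf (\<lambda>c. (es, \<tau>, c))
         (Pi_pmf (complete_arcs n) undefined (\<lambda>_. pmf_of_set W))))
     {(es, \<tau>, c). \<not> good_outcome n (map (relabel \<tau>) es) (c \<circ> inv (relabel \<tau>))} \<le> ?\<epsilon>"
    if "es \<in> set_pmf (pmf_of_set (permutations_of_set (complete_arcs n)))"
      "es \<notin> {es. \<not> (2 \<le> card {v \<in> {1..n}. in_deg es m0 v = 0} \<and> card {v \<in> {1..n}. in_deg es m0 v \<le> 3 * k} \<le> \<sigma>)}"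
    for es
  proof (rule prob_bad_outcome_fixed_order[where k = k and \<sigma> = \<sigma> and n = n and es = es and W = W])
    show "es \<in> permutations_of_set (complete_arcs n)" using that(1) by simp
    show "2 \<le> card {v \<in> {1..n}. in_deg es m0 v = 0}"
      "card {v \<in> {1..n}. in_deg es m0 v \<le> 3 * k} \<le> \<sigma>" using that(2) by blast+
    show "measure_pmf.prob (Pi_pmf ({1..n} - {z}) [] (\<lambda>v. sample W (if v \<in> S then 1 else k + (k + k)) ({1..n} - {v})))
      {X. \<not> rainbow_choice {1..n} z X} \<le> ?\<epsilon>"
      if "z \<in> {1..n}" "S \<subseteq> {1..n} - {z}" "card S \<le> \<sigma>" for z S
      using that by (rule bound)
  qed ((rule n2)+)
  show ?thesis
    unfolding coloured_process_symmetrised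
    by (rule prob_bind_pmf_le_add[OF prob_degrees_bad_le[OF n2(1) n(1) n2(2) n(2) M] fixed \<open>0 \<le> ?\<epsilon>\<close>])
qed

section \<open>Asymptotics\<close>

lemma one_minus_mult_le:
  fixes a b :: real
  assumes "0 \<le> a" "0 \<le> b"
  shows "1 - (1 - a) * (1 - b) \<le> a + b"
  using mult_nonneg_nonneg[OF assms] by (simp add: algebra_simps)

lemma one_minus_power_le_exp:
  fixes x :: real
  assumes "x \<le> 1"
  shows "(1 - x) ^ k \<le> exp (- (x * k))"
proof -
  have "(1 - x) ^ k \<le> exp (- x) ^ k"
    using assms exp_ge_add_one_self[of "- x"] by (intro power_mono) auto
  then show ?thesis by (simp add: exp_of_nat_mult[symmetric] mult.commute)
qed

text \<open>Turns \<open>64 ^ (3 * k)\<close> into \<open>exp (15 * k)\<close>, which is at most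
  \<open>exp (l / 20)\<close> for \<open>k \<le> l / 300\<close>.\<close>

lemma sixty_four_le_exp_5: "64 \<le> exp (5 :: real)"
proof -
  have "(64 :: real) \<le> (1 + 1 / 4) ^ 20" by (simp add: power_divide)
  also have "\<dots> \<le> exp (1 / 4) ^ 20" by (intro power_mono exp_ge_add_one_self) auto
  also have "\<dots> = exp 5" by (simp add: exp_of_nat_mult[symmetric])
  finally show ?thesis .
qed

lemma add_terms_mono:
  fixes x :: real
  assumes "x \<le> (a + b) + (c + (d + e) + (f + g + 2 * h))"
    and "a \<le> a'" "b \<le> b'" "c \<le> c'" "d \<le> d'" "e \<le> e'" "f \<le> f'" "g \<le> g'" "h \<le> h'"
  shows "x \<le> a' + b' + c' + d' + e' + f' + g' + 2 * h'"
  using assms by linarith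

text \<open>In order, the summands bound: fewer than two vertices without in-arcs at time
  \<open>m0\<close>; too many vertices of low degree; a clash among the single arcs on
  \<open>S\<close>; a dead end of the walk; a walk that never meets the root; too many short
  vertices; a short vertex with too few hits in its third block; a violation of Hall's condition.
  Roundings are absorbed, so each summand is an explicit real function.\<close>

definition err :: "real \<Rightarrow> real \<Rightarrow> real \<Rightarrow> real" where
  "err x l s = 4 / (x * (1 - (x - 1) / (x * (x - 1) - 3 / 4 * x * l)) powr (3 / 4 * x * l))
   + x * exp (l / 20) * exp (- (63 / 64 * ((x - 1 - l / 100) / (x * (x - 1)))) * (3 / 4 * x * l - 1)) / (x powr (9 / 20))
   + 2 * (x powr (9 / 20) + 1)\<^sup>2 / (x - 1)
   + 2 * (x / s + 1) * (5 / s) powr (l / 300 - 1)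
   + exp (- (l / 300 - 1) / (2 * s))
   + l * (2 * exp (l / (9600 * s))) * exp (- (l / 300 - 1) / (6 * s))
   + x * (6 / s) powr (l / 300 - 1) * s powr (l / (9600 * s) + 1)
   + 2 * (exp 2 * (x / ((1 + 50 * (ln l / l)) * x - 1)) powr (l / (9600 * s) - 1))"

text \<open>All parameters are fixed here as rounded functions of \<open>n\<close>, \<open>l\<close>
  and \<open>s\<close>, with Chernoff parameter \<open>\<theta> = 1 / s\<close> for the third block.
  The numerical hypotheses hold for all large \<open>n\<close> once \<open>l\<close> and
  \<open>s\<close> are substituted; the rest is arithmetic that removes the roundings.\<close>

lemma prob_bad_outcome_le_err:
  fixes W :: "'c set" and n q :: nat and l s :: real
  assumes W: "finite W" "card W = q" and q: "(1 + 50 * (ln l / l)) * n - 1 \<le> q" "n \<le> (1 + 50 * (ln l / l)) * n - 1"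
    and l: "600 \<le> l" and s: "30 \<le> s" and ls: "l \<le> n / s" "2 \<le> l / (9600 * s)"
    and c1: "(2 * (n powr (9/20) + 2 * (n / s) + 5) + 3 * (l / 300) + n / l) / n \<le> 5 / s"
    and c3: "1 / (3 * s) \<le> (1 / s - 2 * (l / 300) / n) / 2"
    and c4: "3 / 4 * n * l + 2 * (real n - 1) \<le> real n * (real n - 1)"
    and c10: "2 \<le> n * (1 - (real n - 1) / (real n * (real n - 1) - 3 / 4 * n * l)) powr (3 / 4 * n * l)"
    and c11: "exp 2 * (n / ((1 + 50 * (ln l / l)) * n - 1)) powr (l / (9600 * s) - 1) \<le> 1 / 2"
  shows "measure_pmf.prob (coloured_process n W) {(es, c). \<not> good_outcome n es c} \<le> err n l s"
proof -
  \<comment> \<open>Three blocks together stay within the degree threshold \<open>l / 100\<close>.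
    The exponent \<open>9 / 20\<close> lies between about 0.31, the exponent in the bound on the
    expected number of vertices of low degree, and \<open>1 / 2\<close>, below which
    \<open>\<sigma>\<^sup>2 / n\<close> vanishes. A block has about \<open>l / (300 * s)\<close>
    arcs out of the path, and \<open>m\<close> asks for a 32nd of them. The time \<open>m0\<close>
    leaves about \<open>n powr (1 / 4)\<close> vertices without in-arcs.\<close>
  define k where "k = nat \<lfloor>l / 300\<rfloor>"
  define \<sigma> where "\<sigma> = nat \<lceil>n powr (9 / 20)\<rceil>"
  define i where "i = nat \<lceil>n / s\<rceil>"
  define m where "m = nat \<lceil>l / (9600 * s)\<rceil>"
  define m0 where "m0 = nat \<lfloor>3 / 4 * n * l\<rfloor>"
  define \<beta> where "\<beta> = \<sigma> + 2 * i + 2"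
  define t where "t = n / l"
  define Q where "Q = (1 + 50 * (ln l / l)) * n - 1"
  define \<delta> where "\<delta> = exp 2 * (real n / q) ^ (m - 1)"
  define D where "D = exp 2 * (n / Q) powr (l / (9600 * s) - 1)"
  have nl: "600 \<le> l" "l * 30 \<le> n"
  proof -
    have "l * 30 \<le> l * s" using l s by (intro mult_left_mono) auto
    also have "\<dots> \<le> n" using ls(1) s by (simp add: field_simps)
    finally show "l * 30 \<le> n" .
  qed (rule l)
  then have npos: "18000 \<le> real n" by linarith
  have nq: "n \<le> q" using q by linarith
  have qpos: "0 < real q" using nq npos by linarith
  have k: "l / 300 - 1 \<le> k" "k \<le> l / 300" using l unfolding k_def by linarith+
  have \<sigma>: "n powr (9 / 20) \<le> \<sigma>" "\<sigma> \<le> n powr (9 / 20) + 1"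
    using powr_ge_zero[of n "9 / 20"] unfolding \<sigma>_def by linarith+
  have npowr: "0 < n powr (9 / 20)" using npos by simp
  have \<sigma>pos: "0 < \<sigma>" using \<sigma>(1) npowr by linarith
  have "0 \<le> n / s" using s by simp
  then have i: "n / s \<le> i" "i \<le> n / s + 1" unfolding i_def by linarith+
  have m: "l / (9600 * s) \<le> m" "m \<le> l / (9600 * s) + 1" using ls(2) unfolding m_def by linarith+
  have "0 \<le> 3 / 4 * n * l" using l by simp
  then have m0: "3 / 4 * n * l - 1 \<le> m0" "m0 \<le> 3 / 4 * n * l" unfolding m0_def by linarith+
  have \<beta>: "\<beta> \<le> n powr (9/20) + 2 * (n / s) + 5" using \<sigma> i by (simp add: \<beta>_def)
  have "2 * (n powr (9/20) + 2 * (n / s) + 5) + 3 * (l / 300) + n / l \<le> 5 / s * n"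
    using c1 npos by (simp add: field_simps)
  moreover have "2 * real \<beta> + 3 * real k + t \<le> 2 * (n powr (9/20) + 2 * (n / s) + 5) + 3 * (l / 300) + n / l"
    unfolding t_def using \<beta> k by (intro add_mono mult_left_mono) auto
  ultimately have sumle: "2 * real \<beta> + 3 * real k + t \<le> 5 / s * n" by (rule order_trans[rotated])
  have s6: "5 / s \<le> 1 / 6" "6 / s \<le> 1" "0 < 5 / s" "0 < 1 / s" "1 / s \<le> 1" using s by (auto simp: field_simps)
  have "5 / s * n \<le> 1 / 6 * n" using s6 by (intro mult_right_mono) auto
  then have sumle6: "2 * real \<beta> + 3 * real k + t \<le> n / 6" using sumle by simp
  have t1: "1 \<le> t" using nl by (simp add: t_def field_simps)
  have \<beta>kt: "\<beta> + 3 * k + t \<le> n" using sumle6 by simp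
  have k2i: "2 * k \<le> i"
  proof -
    have "real (2 * k) \<le> i" using k(2) l ls(1) i(1) by simp
    then show ?thesis by linarith
  qed
  have m1: "1 \<le> m" "real (m - 1) = real m - 1"
  proof -
    have "2 \<le> real m" using m(1) ls(2) by linarith
    then show "1 \<le> m" by simp
    then show "real (m - 1) = real m - 1" by simp
  qed
  have Qn: "n \<le> Q" "Q \<le> q" using q by (simp_all add: Q_def)
  have Qpos: "0 < Q" using Qn npos by linarith
  have \<delta>D: "\<delta> \<le> D"
  proof -
    have "(real n / q) ^ (m - 1) = (real n / q) powr (real (m - 1))"
      using npos qpos by (simp add: powr_realpow)
    also have "\<dots> \<le> (real n / q) powr (l / (9600 * s) - 1)"
      using m(1) m1(2) nq npos qpos by (intro powr_mono') auto
    also have "\<dots> \<le> (n / Q) powr (l / (9600 * s) - 1)"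
      using ls(2) Qn Qpos npos by (intro powr_mono2 divide_left_mono) auto
    finally show ?thesis by (simp add: \<delta>_def D_def)
  qed
  have D2: "D \<le> 1 / 2" using c11 by (simp add: D_def Q_def)
  have nat_n: "real (n - 1) = real n - 1" using npos by simp
  have realN: "real (n * (n - 1)) = real n * (real n - 1)" by (simp only: of_nat_mult nat_n)
  have m0N: "m0 + 2 * (n - 1) \<le> n * (n - 1)"
  proof -
    have "real (m0 + 2 * (n - 1)) \<le> real (n * (n - 1))" using m0(2) c4 unfolding realN of_nat_add of_nat_mult nat_n of_nat_numeral by linarith
    then show ?thesis by (simp only: of_nat_le_iff)
  qed
  define Ml where "Ml = n * (1 - (real n - 1) / (real n * (real n - 1) - 3 / 4 * n * l)) powr (3 / 4 * n * l)"
  define M where "M = n * (1 - (real n - 1) / (real (n * (n - 1)) - m0)) ^ m0"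
  \<comment> \<open>\<open>Ml\<close> is \<open>M\<close> at the unrounded time. Both the base and,
    as the base is at most 1, the power decrease with time, so rounding down is harmless.\<close>
  have MlM: "Ml \<le> M"
  proof -
    define d where "d = real n * (real n - 1) - 3 / 4 * n * l"
    define b0 where "b0 = 1 - (real n - 1) / d"
    have den: "2 * (real n - 1) \<le> d" using c4 by (simp add: d_def)
    have dpos: "0 < d" by (rule less_le_trans[OF _ den]) (use npos in simp)
    have "(real n - 1) / d \<le> 1 / 2" using den dpos by (simp add: pos_divide_le_eq)
    moreover have "0 \<le> (real n - 1) / d" using npos dpos by simp
    ultimately have b0: "1 / 2 \<le> b0" "b0 \<le> 1" unfolding b0_def by linarith+
    have "b0 powr (3 / 4 * n * l) \<le> b0 powr m0" using m0(2) b0 by (intro powr_mono') auto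
    also have "\<dots> = b0 ^ m0" using b0 by (simp add: powr_realpow)
    also have "\<dots> \<le> (1 - (real n - 1) / (real (n * (n - 1)) - m0)) ^ m0"
    proof (intro power_mono)
      show "b0 \<le> 1 - (real n - 1) / (real (n * (n - 1)) - m0)"
        unfolding b0_def realN
      proof (intro diff_left_mono divide_left_mono mult_pos_pos dpos)
        show le: "d \<le> real n * (real n - 1) - m0" unfolding d_def using m0(2) by (rule diff_left_mono)
        show "0 < real n * (real n - 1) - m0" using dpos le by (rule less_le_trans)
      qed (use npos in simp)
    qed (use b0 in auto)
    finally show ?thesis unfolding Ml_def M_def b0_def d_def by (intro mult_left_mono) auto
  qed
  have Ml2: "2 \<le> Ml" using c10 by (simp add: Ml_def)
  have main: "measure_pmf.prob (coloured_process n W) {(es, c). \<not> good_outcome n es c}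
    \<le> (4 / M + n * (64 ^ (3 * k) * (1 - (real n - 1 - 3 * real k) / real (n * (n - 1)) * (63 / 64)) ^ m0) / \<sigma>)
      + (\<sigma> * (\<sigma> / (real n - 1) + \<sigma> / q)
      + (2 * i * (1 - (real n - \<beta> - k) / n * ((real q - \<beta>) / q)) ^ k + (1 - real k / n * ((real q - \<beta>) / q)) ^ i)
      + (n * (2 ^ m * (1 - (real i - 2 * k) / n * ((real q - \<beta>) / q) / 2) ^ k) / t
      + n * ((1 - (real n - \<beta> - 3 * k - t) / n * ((real q - \<beta>) / q) * (1 - 1 / s)) ^ k / (1 / s) ^ m) + 2 * \<delta>))"
    (is "_ \<le> (_ + ?T2) + (?T3 + (?T4 + ?T5) + (?T6 + ?T7 + _))")
  proof (rule prob_bad_outcome_le[OF W nq \<beta>_def _ k2i t1 _ _ m1(1) _ _ m0N \<sigma>pos _ M_def[THEN eq_refl]])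
    show "real (\<beta> + 3 * k) + t \<le> n" using \<beta>kt by simp
    show "exp 2 * (real n / q) ^ (m - 1) \<le> \<delta>" by (simp add: \<delta>_def)
    show "\<delta> \<le> 1 / 2" using \<delta>D D2 by simp
    show "2 \<le> M" using Ml2 MlM by simp
  qed (use s6 in auto)
  define y where "y = (real q - \<beta>) / q"
  have ye: "y = 1 - \<beta> / q" using qpos by (simp add: y_def field_simps)
  have \<beta>q: "\<beta> / real q \<le> \<beta> / n" using nq npos by (intro divide_left_mono) auto
  have "\<beta> / real n \<le> 1 / 2" using sumle6 npos t1 by (simp add: field_simps)
  then have "\<beta> / real q \<le> 1 / 2" by (rule order_trans[OF \<beta>q])
  moreover have "0 \<le> \<beta> / real q" by simp
  ultimately have y: "1 / 2 \<le> y" "y \<le> 1" unfolding ye by linarith+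
  have T1: "4 / M \<le> 4 / Ml" using Ml2 MlM by (intro divide_left_mono) auto
  have T2: "?T2 \<le> n * exp (l / 20) * exp (- (63 / 64 * ((real n - 1 - l / 100) / (real n * (real n - 1)))) * (3 / 4 * n * l - 1)) / (n powr (9 / 20))"
  proof -
    define x where "x = (real n - 1 - 3 * real k) / real (n * (n - 1)) * (63 / 64)"
    define x0 where "x0 = 63 / 64 * ((real n - 1 - l / 100) / (real n * (real n - 1)))"
    have Npos: "0 < real n * (real n - 1)" using npos by simp
    have x0x: "x0 \<le> x"
    proof -
      have "(real n - 1 - l / 100) / (real n * (real n - 1)) \<le> (real n - 1 - 3 * real k) / (real n * (real n - 1))"
        using k(2) Npos by (intro divide_right_mono) auto
      then show ?thesis unfolding x_def x0_def realN mult.commute[of "63 / 64"] by (rule mult_right_mono) simp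
    qed
    have x0: "0 \<le> x0" using nl Npos unfolding x0_def by (intro mult_nonneg_nonneg divide_nonneg_pos) auto
    have x1: "x \<le> 1"
    proof -
      have "real n - 1 - 3 * real k \<le> 1 * (real n - 1)" by simp
      also have "\<dots> \<le> real n * (real n - 1)" using npos by (intro mult_right_mono) auto
      finally have "(real n - 1 - 3 * real k) / (real n * (real n - 1)) \<le> 1"
        by (subst divide_le_eq_1_pos[OF Npos])
      then show ?thesis unfolding x_def realN by (rule mult_le_one) simp_all
    qed
    have "(64::real) ^ (3 * k) \<le> exp 5 ^ (3 * k)" by (intro power_mono sixty_four_le_exp_5) auto
    also have "\<dots> = exp (15 * k)" by (simp add: exp_of_nat_mult[symmetric])
    also have "\<dots> \<le> exp (l / 20)" using k(2) by simp
    finally have a: "(64::real) ^ (3 * k) \<le> exp (l / 20)" .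
    have "(1 - x) ^ m0 \<le> exp (- (x * m0))" by (rule one_minus_power_le_exp[OF x1])
    also have "\<dots> \<le> exp (- x0 * (3 / 4 * n * l - 1))"
    proof -
      have "1 * 600 \<le> real n * l" using npos nl by (intro mult_mono) auto
      then have "0 \<le> 3 / 4 * real n * l - 1" by simp
      then have "x0 * (3 / 4 * n * l - 1) \<le> x * m0"
        by (intro mult_mono x0x m0(1) order_trans[OF x0 x0x])
      then show ?thesis by (simp only: exp_le_cancel_iff minus_mult_left[symmetric] neg_le_iff_le)
    qed
    finally have b: "(1 - x) ^ m0 \<le> exp (- x0 * (3 / 4 * n * l - 1))" .
    have "?T2 = n * (64 ^ (3 * k) * (1 - x) ^ m0) / \<sigma>" by (simp only: x_def)
    also have "\<dots> \<le> n * (exp (l / 20) * exp (- x0 * (3 / 4 * n * l - 1))) / n powr (9 / 20)"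
      using a b x1 \<sigma>(1) npowr by (intro frac_le mult_left_mono mult_mono mult_nonneg_nonneg) auto
    finally show ?thesis unfolding x0_def by (simp only: mult.assoc)
  qed
  have T3: "?T3 \<le> 2 * (n powr (9 / 20) + 1)\<^sup>2 / (real n - 1)"
  proof -
    have "\<sigma> / real q \<le> \<sigma> / (real n - 1)" using nq npos by (intro divide_left_mono) auto
    then have "?T3 \<le> \<sigma> * (\<sigma> / (real n - 1) + \<sigma> / (real n - 1))" by (intro mult_left_mono add_left_mono) auto
    also have "\<dots> = 2 * (real \<sigma>)\<^sup>2 / (real n - 1)" by (simp add: power2_eq_square)
    also have "\<dots> \<le> 2 * (n powr (9 / 20) + 1)\<^sup>2 / (real n - 1)"
      using \<sigma>(2) npos by (intro divide_right_mono mult_left_mono power_mono) auto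
    finally show ?thesis .
  qed
  \<comment> \<open>Excluded tails and used colours together lower the rate by at most
    \<open>5 / s\<close>. This serves the walk with \<open>w = k\<close> and the third block with
    \<open>w = 3 * k + t\<close>.\<close>
  have gap: "1 - (real n - \<beta> - w) / n * y \<le> 5 / s" "(real n - \<beta> - w) / n * y \<le> 1" "0 \<le> (real n - \<beta> - w) / n * y"
    if w: "0 \<le> w" "w \<le> 3 * k + t" for w :: real
  proof -
    have x: "(real n - \<beta> - w) / n = 1 - (\<beta> + w) / n" using npos by (simp add: field_simps)
    have "1 - (real n - \<beta> - w) / n * y \<le> (\<beta> + w) / n + \<beta> / q"
      unfolding x ye by (intro one_minus_mult_le) (use w npos qpos in auto)
    also have "\<dots> \<le> (\<beta> + w) / n + \<beta> / n" by (rule add_left_mono[OF \<beta>q])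
    also have "\<dots> = (2 * \<beta> + w) / n" by (simp add: add_divide_distrib)
    also have "\<dots> \<le> 5 / s"
    proof -
      have "2 * \<beta> + w \<le> 5 / s * n" using sumle w by simp
      then show ?thesis using npos by (simp add: pos_divide_le_eq)
    qed
    finally show "1 - (real n - \<beta> - w) / n * y \<le> 5 / s" .
    have "(real n - \<beta> - w) / n \<le> 1" using w npos by (simp add: divide_le_eq_1)
    then show "(real n - \<beta> - w) / n * y \<le> 1" by (rule mult_le_one) (use y in auto)
    have "real \<beta> + w \<le> n" using \<beta>kt w by simp
    then show "0 \<le> (real n - \<beta> - w) / n * y" using y npos by (intro mult_nonneg_nonneg divide_nonneg_pos) auto
  qed
  have powk: "x ^ k \<le> b powr (l / 300 - 1)" if "0 \<le> x" "x \<le> b" "b \<le> 1" "0 < b" for x b :: real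
  proof -
    have "x ^ k \<le> b ^ k" using that by (intro power_mono) auto
    also have "\<dots> = b powr k" using that by (simp add: powr_realpow)
    also have "\<dots> \<le> b powr (l / 300 - 1)" using that k(1) by (intro powr_mono') auto
    finally show ?thesis .
  qed
  have T4: "?T4 \<le> 2 * (n / s + 1) * (5 / s) powr (l / 300 - 1)"
  proof -
    have g: "0 \<le> 1 - (real n - \<beta> - k) / n * y" "1 - (real n - \<beta> - k) / n * y \<le> 5 / s"
      using gap[of k] t1 by simp_all
    have "(1 - (real n - \<beta> - k) / n * y) ^ k \<le> (5 / s) powr (l / 300 - 1)"
      using s6 by (intro powk g) auto
    moreover have "real (2 * i) \<le> 2 * (n / s + 1)" using i(2) by simp
    ultimately show ?thesis unfolding y_def[symmetric]
      by (intro mult_mono zero_le_power g(1)) (use s in auto)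
  qed
  have T5: "?T5 \<le> exp (- (l / 300 - 1) / (2 * s))"
  proof -
    define p where "p = real k / n * y"
    have "real k / n \<le> 1" using \<beta>kt t1 npos by (simp add: divide_le_eq_1)
    then have p1: "p \<le> 1" unfolding p_def by (rule mult_le_one) (use y in auto)
    have kl: "0 \<le> l / 300 - 1" using l by simp
    have lep: "(l / 300 - 1) / n * (1 / 2) \<le> p"
      unfolding p_def using k(1) kl y npos by (intro mult_mono divide_right_mono) auto
    have p0: "0 \<le> p" unfolding p_def by (intro mult_nonneg_nonneg) (use y in auto)
    have "(l / 300 - 1) / (2 * s) = (l / 300 - 1) / n * (1 / 2) * (n / s)"
      using npos by simp
    also have "\<dots> \<le> p * i" by (rule mult_mono[OF lep i(1) p0]) (use s in simp)
    finally have "exp (- (p * i)) \<le> exp (- (l / 300 - 1) / (2 * s))"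
      by (simp only: exp_le_cancel_iff minus_divide_left[symmetric] neg_le_iff_le)
    moreover have "?T5 = (1 - p) ^ i" by (simp only: p_def y_def)
    ultimately show ?thesis using one_minus_power_le_exp[OF p1, of i] by (metis order_trans)
  qed
  have T6: "?T6 \<le> l * (2 * exp (l / (9600 * s))) * exp (- (l / 300 - 1) / (6 * s))"
  proof -
    define p where "p = (real i - 2 * k) / n * y"
    have "real i - 2 * k \<le> n" using sumle6 t1 by (simp add: \<beta>_def)
    then have "(real i - 2 * k) / n \<le> 1" using npos by (simp add: divide_le_eq_1)
    then have p1: "p \<le> 1" unfolding p_def by (rule mult_le_one) (use y in auto)
    have x: "1 / s - 2 * (l / 300) / n \<le> (real i - 2 * k) / n"
    proof -
      have "1 / s - 2 * (l / 300) / n = (n / s - 2 * (l / 300)) / n"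
        using npos by (simp add: diff_divide_distrib)
      also have "\<dots> \<le> (real i - 2 * k) / n" using i(1) k(2) by (intro divide_right_mono) auto
      finally show ?thesis .
    qed
    have x0: "0 \<le> 1 / s - 2 * (l / 300) / n"
    proof -
      have "0 < 1 / (3 * s)" using s by simp
      also have "\<dots> \<le> (1 / s - 2 * (l / 300) / n) / 2" by (rule c3)
      finally show ?thesis by simp
    qed
    \<comment> \<open>The factor \<open>1 / 2\<close> is the lower bound for the fraction
      \<open>y\<close> of free colours, and explains the halving in \<open>c3\<close>.\<close>
    have "(1 / s - 2 * (l / 300) / n) * (1 / 2) \<le> p" unfolding p_def using x x0 y by (intro mult_mono) auto
    moreover have "1 / (3 * s) \<le> (1 / s - 2 * (l / 300) / n) * (1 / 2)"
      using c3 by (simp only: times_divide_eq_right mult_1_right)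
    ultimately have p3: "1 / (3 * s) \<le> p" by (rule order_trans[rotated])
    have "(1 - p / 2) ^ k \<le> exp (- (p / 2 * k))" by (rule one_minus_power_le_exp) (use p1 in simp)
    also have "\<dots> \<le> exp (- (l / 300 - 1) / (6 * s))"
    proof -
      have "0 \<le> 1 / (3 * s)" using s by simp
      then have p0: "0 \<le> p / 2" using p3 by (metis divide_nonneg_pos order_trans zero_less_numeral)
      have "(l / 300 - 1) / (6 * s) = 1 / (3 * s) / 2 * (l / 300 - 1)" by simp
      also have "\<dots> \<le> p / 2 * k"
        by (rule mult_mono[OF divide_right_mono[OF p3] k(1) p0]) (use l in simp_all)
      finally show ?thesis by (simp only: exp_le_cancel_iff minus_divide_left[symmetric] neg_le_iff_le)
    qed
    finally have a: "(1 - p / 2) ^ k \<le> exp (- (l / 300 - 1) / (6 * s))" .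
    have b: "(2::real) ^ m \<le> 2 * exp (l / (9600 * s))"
    proof -
      obtain m' where m': "m = Suc m'" using m1(1) by (cases m) auto
      have "(2::real) ^ m' \<le> exp 1 ^ m'" using exp_ge_add_one_self[of 1] by (intro power_mono) auto
      also have "\<dots> = exp m'" by (simp add: exp_of_nat_mult[symmetric])
      also have "\<dots> \<le> exp (l / (9600 * s))" using m(2) m' by simp
      finally show ?thesis by (simp add: m')
    qed
    have "n / t = l" using npos nl by (simp add: t_def)
    moreover have "?T6 = n / t * (2 ^ m * (1 - p / 2) ^ k)" by (simp only: p_def y_def times_divide_eq_left)
    ultimately have "?T6 = l * (2 ^ m * (1 - p / 2) ^ k)" by (simp only:)
    also have "\<dots> \<le> l * (2 * exp (l / (9600 * s)) * exp (- (l / 300 - 1) / (6 * s)))"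
      using a b l p1 by (intro mult_left_mono mult_mono zero_le_power) auto
    finally show ?thesis by (simp only: mult.assoc)
  qed
  have T7: "?T7 \<le> n * (6 / s) powr (l / 300 - 1) * s powr (l / (9600 * s) + 1)"
  proof -
    define p where "p = (real n - \<beta> - (3 * real k + t)) / n * y"
    have p: "1 - p \<le> 5 / s" "p \<le> 1" "0 \<le> p" unfolding p_def by (rule gap; use t1 in simp)+
    \<comment> \<open>With \<open>\<theta> = 1 / s\<close> the Chernoff parameter loses no more than
      the gap \<open>1 - p\<close> is allowed to: the base stays of order
      \<open>1 / s\<close>.\<close>
    have "1 - p * (1 - 1 / s) = (1 - p) + p * (1 / s)" by (simp add: algebra_simps)
    also have "\<dots> \<le> 5 / s + 1 * (1 / s)" using p s6 by (intro add_mono mult_right_mono) auto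
    also have "\<dots> = 6 / s" using s by (simp add: field_simps)
    finally have u: "1 - p * (1 - 1 / s) \<le> 6 / s" .
    have "p * (1 - 1 / s) \<le> 1" using p s6 by (intro mult_le_one) auto
    then have "(1 - p * (1 - 1 / s)) ^ k \<le> (6 / s) powr (l / 300 - 1)"
      using u s6 by (intro powk) auto
    moreover have "1 / (1 / s) ^ m \<le> s powr (l / (9600 * s) + 1)"
    proof -
      have "1 / (1 / s) ^ m = s powr m" using s by (simp add: power_one_over powr_realpow)
      also have "\<dots> \<le> s powr (l / (9600 * s) + 1)" using m(2) s by (intro powr_mono) auto
      finally show ?thesis .
    qed
    ultimately have "(1 - p * (1 - 1 / s)) ^ k * (1 / (1 / s) ^ m) \<le> (6 / s) powr (l / 300 - 1) * s powr (l / (9600 * s) + 1)"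
      using s by (intro mult_mono) auto
    then have "n * ((1 - p * (1 - 1 / s)) ^ k * (1 / (1 / s) ^ m)) \<le> n * ((6 / s) powr (l / 300 - 1) * s powr (l / (9600 * s) + 1))"
      by (intro mult_left_mono) auto
    moreover have "?T7 = n * ((1 - p * (1 - 1 / s)) ^ k * (1 / (1 / s) ^ m))"
    proof -
      have e: "real n - real \<beta> - real (3 * k) - t = real n - \<beta> - (3 * real k + t)" by simp
      show ?thesis by (simp only: p_def y_def e times_divide_eq_right mult_1_right)
    qed
    ultimately show ?thesis by (simp only: mult.assoc)
  qed
  have "measure_pmf.prob (coloured_process n W) {(es, c). \<not> good_outcome n es c}
     \<le> (4 / M + ?T2) + (?T3 + (?T4 + ?T5) + (?T6 + ?T7 + 2 * \<delta>))" by (rule main)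
  then have "measure_pmf.prob (coloured_process n W) {(es, c). \<not> good_outcome n es c}
     \<le> 4 / Ml + (n * exp (l / 20) * exp (- (63 / 64 * ((real n - 1 - l / 100) / (real n * (real n - 1)))) * (3 / 4 * n * l - 1)) / (n powr (9 / 20)))
       + 2 * (n powr (9 / 20) + 1)\<^sup>2 / (real n - 1) + 2 * (n / s + 1) * (5 / s) powr (l / 300 - 1)
       + exp (- (l / 300 - 1) / (2 * s)) + l * (2 * exp (l / (9600 * s))) * exp (- (l / 300 - 1) / (6 * s))
       + n * (6 / s) powr (l / 300 - 1) * s powr (l / (9600 * s) + 1) + 2 * D"
    using T1 T2 T3 T4 T5 T6 T7 \<delta>D by (rule add_terms_mono)
  then show ?thesis unfolding err_def Ml_def D_def Q_def .
qed

text \<open>With \<open>s\<^sup>2 = ln l\<close>, the first three summands decay like negative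
  powers of \<open>n\<close>. The walk's dead ends and the third block give \<open>n\<close> to an
  exponent tending to minus infinity like \<open>- ln s / 300\<close>; the two bounds for the root
  and for short vertices are exponentially small in \<open>l / s\<close>. The last summand is the
  slowest, about \<open>exp (- s / 192)\<close>, from
  \<open>50 * (ln l / l) * (l / (9600 * s))\<close>.\<close>

lemma err_tendsto_0: "(\<lambda>n. err (real n) (ln (real n)) (sqrt (ln (ln (real n))))) \<longlonglongrightarrow> 0"
proof -
  have "(\<lambda>n. 4 / (real n * (1 - (real n - 1) / (real n * (real n - 1) - 3 / 4 * real n * ln (real n))) powr (3 / 4 * real n * ln (real n)))) \<longlonglongrightarrow> 0"
    by real_asymp
  moreover have "(\<lambda>n. real n * exp (ln (real n) / 20) * exp (- (63 / 64 * ((real n - 1 - ln (real n) / 100) / (real n * (real n - 1))))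
      * (3 / 4 * real n * ln (real n) - 1)) / (real n powr (9 / 20))) \<longlonglongrightarrow> 0"
    by real_asymp
  moreover have "(\<lambda>n. 2 * (real n powr (9 / 20) + 1)\<^sup>2 / (real n - 1)) \<longlonglongrightarrow> 0"
    by real_asymp
  moreover have "(\<lambda>n. 2 * (real n / sqrt (ln (ln (real n))) + 1) * (5 / sqrt (ln (ln (real n)))) powr (ln (real n) / 300 - 1)) \<longlonglongrightarrow> 0"
    by real_asymp
  moreover have "(\<lambda>n. exp (- (ln (real n) / 300 - 1) / (2 * sqrt (ln (ln (real n)))))) \<longlonglongrightarrow> 0"
    by real_asymp
  moreover have "(\<lambda>n. ln (real n) * (2 * exp (ln (real n) / (9600 * sqrt (ln (ln (real n))))))
      * exp (- (ln (real n) / 300 - 1) / (6 * sqrt (ln (ln (real n)))))) \<longlonglongrightarrow> 0"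
    by real_asymp
  moreover have "(\<lambda>n. real n * (6 / sqrt (ln (ln (real n)))) powr (ln (real n) / 300 - 1)
      * sqrt (ln (ln (real n))) powr (ln (real n) / (9600 * sqrt (ln (ln (real n)))) + 1)) \<longlonglongrightarrow> 0"
    by real_asymp
  moreover have "(\<lambda>n. 2 * (exp 2 * (real n / ((1 + 50 * (ln (ln (real n)) / ln (real n))) * real n - 1))
      powr (ln (real n) / (9600 * sqrt (ln (ln (real n)))) - 1))) \<longlonglongrightarrow> 0"
    by real_asymp
  ultimately show ?thesis unfolding err_def by (intro tendsto_add_zero)
qed

lemma eventually_prob_bad_outcome_le_err:
  fixes W :: "nat \<Rightarrow> 'c set"
  assumes "\<And>n. finite (W n)"
    and "\<forall>\<^sub>F n in sequentially.
           int (card (W n)) = \<lfloor>(1 + 50 * eps n) * real n\<rfloor> \<or>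
           int (card (W n)) = \<lceil>(1 + 50 * eps n) * real n\<rceil>"
  shows "\<forall>\<^sub>F n in sequentially. measure_pmf.prob (coloured_process n (W n)) {(es, c). \<not> good_outcome n es c}
    \<le> err (real n) (ln (real n)) (sqrt (ln (ln (real n))))"
proof -
  have ev: "\<forall>\<^sub>F n in sequentially. real n \<le> (1 + 50 * (ln (ln (real n)) / ln (real n))) * real n - 1"
    "\<forall>\<^sub>F n in sequentially. 600 \<le> ln (real n)"
    "\<forall>\<^sub>F n in sequentially. 30 \<le> sqrt (ln (ln (real n)))"
    "\<forall>\<^sub>F n in sequentially. ln (real n) \<le> real n / sqrt (ln (ln (real n)))"
    "\<forall>\<^sub>F n in sequentially. 2 \<le> ln (real n) / (9600 * sqrt (ln (ln (real n))))"
    "\<forall>\<^sub>F n in sequentially. (2 * (real n powr (9/20) + 2 * (real n / sqrt (ln (ln (real n)))) + 5)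
      + 3 * (ln (real n) / 300) + real n / ln (real n)) / real n \<le> 5 / sqrt (ln (ln (real n)))"
    "\<forall>\<^sub>F n in sequentially. 1 / (3 * sqrt (ln (ln (real n)))) \<le> (1 / sqrt (ln (ln (real n))) - 2 * (ln (real n) / 300) / real n) / 2"
    "\<forall>\<^sub>F n in sequentially. 3 / 4 * real n * ln (real n) + 2 * (real n - 1) \<le> real n * (real n - 1)"
    "\<forall>\<^sub>F n in sequentially. 2 \<le> real n * (1 - (real n - 1) / (real n * (real n - 1) - 3 / 4 * real n * ln (real n))) powr (3 / 4 * real n * ln (real n))"
    "\<forall>\<^sub>F n in sequentially. exp 2 * (real n / ((1 + 50 * (ln (ln (real n)) / ln (real n))) * real n - 1))
      powr (ln (real n) / (9600 * sqrt (ln (ln (real n)))) - 1) \<le> 1 / 2"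
    by real_asymp+
  show ?thesis
    using assms(2) ev
  proof eventually_elim
    case (elim n)
    have "(1 + 50 * (ln (ln (real n)) / ln (real n))) * real n - 1 \<le> card (W n)"
      using elim(1) unfolding eps_def by linarith
    then show ?case
      by (rule prob_bad_outcome_le_err[OF assms(1) refl]) (use elim in auto)
  qed
qed

theorem theorem1p1:
  fixes W :: "nat \<Rightarrow> 'c set"
  assumes "\<And>n. finite (W n)"
    and "\<forall>\<^sub>F n in sequentially.
           int (card (W n)) = \<lfloor>(1 + 50 * eps n) * real n\<rfloor> \<or>
           int (card (W n)) = \<lceil>(1 + 50 * eps n) * real n\<rceil>"
  shows "(\<lambda>n. measure_pmf.prob (coloured_process n (W n))
            {(es, c). (\<exists>m \<le> n * (n - 1). has_rainbow_arborescence c (digraph_at n es m)) \<and>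
                      m_R n es c = m_A n es \<and> m_A n es = m_Z n es})
         \<longlonglongrightarrow> 1"
proof -
  let ?err = "\<lambda>n. err (real n) (ln (real n)) (sqrt (ln (ln (real n))))"
  let ?P = "\<lambda>n. measure_pmf.prob (coloured_process n (W n))"
  have compl: "?P n {(es, c). good_outcome n es c} = 1 - ?P n {(es, c). \<not> good_outcome n es c}" for n
  proof -
    have "{(es, c). good_outcome n es c} = space (measure_pmf (coloured_process n (W n))) - {(es, c). \<not> good_outcome n es c}"
      by auto
    then show ?thesis by (simp only: measure_pmf.prob_compl[OF sets_measure_pmf[THEN equalityD2, THEN subsetD, OF UNIV_I]])
  qed
  have "(\<lambda>n. ?P n {(es, c). good_outcome n es c}) \<longlonglongrightarrow> 1"
  proof (rule tendsto_sandwich)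
    show "\<forall>\<^sub>F n in sequentially. 1 - ?err n \<le> ?P n {(es, c). good_outcome n es c}"
      using eventually_prob_bad_outcome_le_err[OF assms] unfolding compl by eventually_elim simp
    show "(\<lambda>n. 1 - ?err n) \<longlonglongrightarrow> 1"
      using tendsto_diff[OF tendsto_const[of 1] err_tendsto_0] by simp
    show "\<forall>\<^sub>F n in sequentially. ?P n {(es, c). good_outcome n es c} \<le> 1" by simp
  qed simp
  then show ?thesis unfolding good_outcome_def .
qed

end
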